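(* Consider the setting where the set of alternatives equals the set $C$ of $n$ agents, and let $\mathcal A$ be any $\rho$-approximation algorithm for (cardinal, weighted) $\ell$-centrum, where $\rho=O(1)$. The mechanism Meyerson-BB defined in the context, run with $\mathcal A$ and parameter $\delta\in(0,1)$, has $O\bigl((\log(1/\delta)+\log k)\log n\bigr)$ per-agent query complexity, and achieves $O(1)$-distortion for the $\ell$-centrum problem with probability at least $1-\delta$; that is, with probability at least $1-\delta$ its output $F$ satisfies $|F|\le k$ and $\mathrm{Top}_\ell(d(C,F))\le O(1)\cdot\mathrm{OPT}_\ell$.
   Context: Setting. $C$ is a finite set of $n$ agents, which is also the set of alternatives; $1\le k,\ell\le n$. There is an unknown underlying metric $d$ on $C$ (distinct points may be co-located). The preference profile $\sigma=(\succeq_i)_{i\in C}$ consists of total orders on $C$ consistent with $d$: $a\succeq_i b$ implies $d(i,a)\le d(i,b)$. For $S\subseteq C$ nonempty, $d(i,S)=\min_{a\in S}d(i,a)$, $d(C,S)=(d(i,S))_{i\in C}$, and $\mathrm{top}_S(i)$ is $i$'s most preferred element of $S$. $\mathrm{Top}_\ell(v)$ is the sum of the $\ell$ largest entries of $v$; $z^+=\max\{z,0\}$. $\mathrm{OPT}_\ell=\min\{\mathrm{Top}_\ell(d(C,S)):S\subseteq C,|S|\le k\}$. Mechanisms know $\sigma$ but not $d$; a value query to agent $i$ about $a$ returns $d(i,a)$. Per-agent query complexity is the maximum number of queries made to any single agent. A $\rho$-approximation algorithm for weighted $\ell$-centrum takes a point set $P$, integer weights $w$ on $P$ and a known metric $d'$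 on $P$, and returns at most $k$ points of $P$ whose $\mathrm{Top}_\ell$-cost (counting each $i\in P$ with multiplicity $w_i$) is at most $\rho$ times the minimum. Subroutine Boruvka. Edges are pairs $\{i,j\}\subseteq C$ with cost $d(i,j)$; $\delta(S)$ is the set of edges with exactly one endpoint in $S$. Fix a tie-breaking rule on edges; start with $F=\emptyset$ and all agents as singleton supernodes. While there is more than one supernode: for each supernode $S$, query for each $v\in S$ the cost of the cheapest edge from $v$ to $C\setminus S$ (one value query to $v$), and add to $F$ the cheapest edge of $\delta(S)$; then contract the resulting components into supernodes. Finally remove edges of $F$ in non-increasing order of cost until exactly $k$ components are left, and return $n\sum_{e\in F}d(e)$. Subroutine Meyerson-$\mathrm{Top}_\ell$ (input: sequence of agents $x_1,\dots,x_n$, number $B$). Set $S=\{x_1\}$, $f=B/k$. For $i=2,\dots,n$: compute $\delta_i=\bigl(d(x_i,S)-3\cdot\frac B\ell\bigr)^+$ (one value query to $x_i$) and add $x_i$ to $S$ with probability $\min(1,\delta_i/f)$. Return $S$. Subroutine BB-$\mathrm{Top}_\ell$ (input: point set $P\subseteq C$, $\sigma$, integer weights $w_i\ge0$ on $P$ with sum $n$, number $B$, algorithm $\mathcal A$; constant $\varepsilon\in(0,1]$ and parameter $\alpha$, here $\alpha=n^2$). Let $w_i'=\min\{w_i,\ell\}$. For each $i\in P$ with $w_i>0$: let $B_{i,0}=\rho(1+3\varepsilon)B/w'_i$, $q_i=\lceil\log_{1+\varepsilon}(\alpha w'_iB_{i,0}n/(\varepsilon B))\rceil$, and for $r=0,\dots,q_i$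 compute, by binary search on $i$'s preference order restricted to $P$ using value queries to $i$, $S_{i,r}=\{j\in P:d(i,j)\le B_{i,0}(1+\varepsilon)^{-r}\}$. Solve a linear program to find a metric $\tilde d$ on $P$ such that for all such $i$: $\tilde d(i,j)\ge B_{i,0}$ for $j\notin S_{i,0}$; $(1+\varepsilon)^{-(r+1)}B_{i,0}\le\tilde d(i,j)\le(1+\varepsilon)^{-r}B_{i,0}$ for $0\le r\le q_i-1$, $j\in S_{i,r}\setminus S_{i,r+1}$; $\tilde d(i,j)\le\varepsilon B/(\alpha n w'_i)$ for $j\in S_{i,q_i}$. Return $\mathcal A(P,w,\tilde d)$. Mechanism Meyerson-BB (input: $\sigma$, $\mathcal A$; parameter $\delta$). 1. $\mathcal S\leftarrow\{S_0\}$, where $S_0$ is an arbitrary set of $k$ centers. Let $B'$ be the output of Boruvka. Let $x_1,\dots,x_n$ be a randomly shuffled sequence of the agents. 2. For $i=0,\dots,\lceil\log_2n^2\rceil$: let $B_i=2^iB'/n^2$ (so $f=B_i/k$ below). Repeat $\log(1/\delta)$ times: let $S$ be the output of Meyerson-$\mathrm{Top}_\ell$ on $x_1,\dots,x_n$ with $B=B_i$; if $|S|\le104k$, add $S$ to $\mathcal S$ and compute $d(C,S)$ using one query per agent. 3. If $\mathcal S=\emptyset$ return failure. Otherwise let $\bar S=\arg\min_{S\in\mathcal S}\mathrm{Top}_\ell(d(C,S))$. For $i\in\bar S$ set $w_i=|\{j\in C:\mathrm{top}_{\bar S}(j)=i\}|$; for $i\notin\bar S$ set $w_i=0$. 4.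 Return the output of BB-$\mathrm{Top}_\ell$ on $(\bar S,\sigma,\{w_j\}_{j\in\bar S},B',\mathcal A)$.
   Formalization: Agents are reshuffled independently for every Meyerson run (one shared shuffle fails for tiny δ); if B'=0, where the mechanism divides by zero, one agent per Boruvka component is returned; the query bound uses max(1, log(1/δ)+log k), as the literal bound tends to 0 for k=1, δ→1. *)

theory Defs
  imports "HOL-Probability.Probability" "HOL-Combinatorics.Multiset_Permutations"
begin

section \<open>The setting\<close>

text \<open>
  Agents (= alternatives) are natural numbers and \<open>C\<close> is a finite set of agents. The label type is
  fixed so that an absolute constant can be quantified outside all instances, of all sizes.
  Distinct agents may be co-located, so \<open>d\<close> is a pseudometric.
\<close>

type_synonym dist_fun = "nat \<Rightarrow> nat \<Rightarrow> real"

definition pmetric_on :: "nat set \<Rightarrow> dist_fun \<Rightarrow> bool" where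
  "pmetric_on P d \<longleftrightarrow>
     (\<forall>i\<in>P. d i i = 0) \<and> (\<forall>i\<in>P. \<forall>j\<in>P. 0 \<le> d i j \<and> d i j = d j i) \<and>
     (\<forall>i\<in>P. \<forall>j\<in>P. \<forall>m\<in>P. d i m \<le> d i j + d j m)"

text \<open>\<open>(a, b) \<in> \<sigma> i\<close> means that agent \<open>i\<close> weakly prefers \<open>a\<close> to \<open>b\<close>.\<close>

type_synonym profile = "nat \<Rightarrow> (nat \<times> nat) set"

definition consistent_profile :: "nat set \<Rightarrow> profile \<Rightarrow> dist_fun \<Rightarrow> bool" where
  "consistent_profile C \<sigma> d \<longleftrightarrow>
     (\<forall>i\<in>C. linear_order_on C (\<sigma> i) \<and> (\<forall>(a, b)\<in>\<sigma> i. d i a \<le> d i b))"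

definition top_of :: "profile \<Rightarrow> nat set \<Rightarrow> nat \<Rightarrow> nat" where
  "top_of \<sigma> S i = (THE a. a \<in> S \<and> (\<forall>b\<in>S. (a, b) \<in> \<sigma> i))"

definition pref_list :: "profile \<Rightarrow> nat set \<Rightarrow> nat \<Rightarrow> nat list" where
  "pref_list \<sigma> P i =
     (THE xs. set xs = P \<and> distinct xs \<and> sorted_wrt (\<lambda>a b. (a, b) \<in> \<sigma> i) xs)"

text \<open>Vectors are represented by the multiset of their entries.\<close>

definition Top :: "nat \<Rightarrow> real multiset \<Rightarrow> real" where
  "Top l v = sum_list (take l (rev (sorted_list_of_multiset v)))"

definition set_dist :: "dist_fun \<Rightarrow> nat \<Rightarrow> nat set \<Rightarrow> real" where
  "set_dist d i S = Min (d i ` S)"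

definition cost :: "nat \<Rightarrow> nat set \<Rightarrow> dist_fun \<Rightarrow> nat set \<Rightarrow> real" where
  "cost l C d S = Top l {# set_dist d i S. i \<in># mset_set C #}"

definition OPT :: "nat \<Rightarrow> nat \<Rightarrow> nat set \<Rightarrow> dist_fun \<Rightarrow> real" where
  "OPT k l C d = Min (cost l C d ` {S. S \<subseteq> C \<and> S \<noteq> {} \<and> card S \<le> k})"

definition weighted_cost :: "nat \<Rightarrow> nat set \<Rightarrow> (nat \<Rightarrow> nat) \<Rightarrow> dist_fun \<Rightarrow> nat set \<Rightarrow> real" where
  "weighted_cost l P w d S = Top l (\<Sum>i\<in>P. replicate_mset (w i) (set_dist d i S))"

type_synonym centrum_alg = "nat set \<Rightarrow> (nat \<Rightarrow> nat) \<Rightarrow> dist_fun \<Rightarrow> nat set"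

definition approx_alg :: "nat \<Rightarrow> nat \<Rightarrow> real \<Rightarrow> centrum_alg \<Rightarrow> bool" where
  "approx_alg k l \<rho> \<A> \<longleftrightarrow>
     (\<forall>P w d. finite P \<and> P \<noteq> {} \<and> l \<le> sum w P \<and> pmetric_on P d \<longrightarrow>
        \<A> P w d \<subseteq> P \<and> \<A> P w d \<noteq> {} \<and> card (\<A> P w d) \<le> k \<and>
        weighted_cost l P w d (\<A> P w d)
          \<le> \<rho> * Min (weighted_cost l P w d ` {S. S \<subseteq> P \<and> S \<noteq> {} \<and> card S \<le> k}))"


section \<open>Randomised mechanisms with value queries\<close>

text \<open>
  A mechanism is an interactive program. It has no access to the metric except through
  \<open>Query i a K\<close>, which asks agent \<open>i\<close> for the value \<open>d i a\<close> and continues with the answer.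
  \<open>Flip p K\<close> tosses a coin of bias \<open>p\<close>, and \<open>Shuffle X K\<close> draws a uniformly random ordering of \<open>X\<close>.
\<close>

datatype 'r mech =
    Return 'r
  | Query nat nat "real \<Rightarrow> 'r mech"
  | Flip real "bool \<Rightarrow> 'r mech"
  | Shuffle "nat set" "nat list \<Rightarrow> 'r mech"

primrec bind_mech :: "'r mech \<Rightarrow> ('r \<Rightarrow> 's mech) \<Rightarrow> 's mech" where
  "bind_mech (Return r) f = f r"
| "bind_mech (Query i a K) f = Query i a (\<lambda>x. bind_mech (K x) f)"
| "bind_mech (Flip p K) f = Flip p (\<lambda>b. bind_mech (K b) f)"
| "bind_mech (Shuffle X K) f = Shuffle X (\<lambda>xs. bind_mech (K xs) f)"

adhoc_overloading Monad_Syntax.bind \<rightleftharpoons> bind_mech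

text \<open>
  Joint distribution of the output and of the multiset of queried agents, where each agent occurs
  as often as it has been queried.
\<close>

primrec run :: "dist_fun \<Rightarrow> 'r mech \<Rightarrow> ('r \<times> nat multiset) pmf" where
  "run d (Return r) = return_pmf (r, {#})"
| "run d (Query i a K) = map_pmf (\<lambda>(r, Q). (r, add_mset i Q)) (run d (K (d i a)))"
| "run d (Flip p K) = bind_pmf (bernoulli_pmf p) (\<lambda>b. run d (K b))"
| "run d (Shuffle X K) = bind_pmf (pmf_of_set (permutations_of_set X)) (\<lambda>xs. run d (K xs))"

definition ask :: "nat \<Rightarrow> nat \<Rightarrow> real mech" where
  "ask i a = Query i a Return"

primrec map_mech :: "('a \<Rightarrow> 'r mech) \<Rightarrow> 'a list \<Rightarrow> 'r list mech" where
  "map_mech f [] = Return []"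
| "map_mech f (x # xs) = do { y \<leftarrow> f x; ys \<leftarrow> map_mech f xs; Return (y # ys) }"

definition for_each :: "nat set \<Rightarrow> (nat \<Rightarrow> 'r mech) \<Rightarrow> (nat \<Rightarrow> 'r) mech" where
  "for_each X f = (let xs = sorted_list_of_set X in do {
     ys \<leftarrow> map_mech f xs;
     Return (\<lambda>x. the (map_of (zip xs ys) x)) })"

text \<open>
  The vector \<open>(d i S)\<close> for \<open>i\<close> in \<open>C\<close>, with one query per agent: \<open>d i S\<close> is the distance from \<open>i\<close> to its
  most preferred element of \<open>S\<close>.
\<close>

definition distance_vector :: "nat set \<Rightarrow> profile \<Rightarrow> nat set \<Rightarrow> (nat \<Rightarrow> real) mech" where
  "distance_vector C \<sigma> S = for_each C (\<lambda>i. ask i (top_of \<sigma> S i))"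


section \<open>Boruvka\<close>

text \<open>
  An edge \<open>{i, j}\<close> is stored together with its cost, as learned from a query. The tie-breaking rule
  is an injective ranking \<open>\<tau>\<close> of the edges.
\<close>

type_synonym edge = "real \<times> nat set"

definition all_edges :: "nat set \<Rightarrow> nat set set" where
  "all_edges C = {{i, j} | i j. i \<in> C \<and> j \<in> C \<and> i \<noteq> j}"

definition cheaper :: "(nat set \<Rightarrow> nat) \<Rightarrow> edge \<Rightarrow> edge \<Rightarrow> bool" where
  "cheaper \<tau> e e' \<longleftrightarrow> fst e < fst e' \<or> fst e = fst e' \<and> \<tau> (snd e) < \<tau> (snd e')"

definition cheapest :: "(nat set \<Rightarrow> nat) \<Rightarrow> edge set \<Rightarrow> edge" where
  "cheapest \<tau> E = (THE e. e \<in> E \<and> (\<forall>e'\<in>E. e' = e \<or> cheaper \<tau> e e'))"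

definition costliest :: "(nat set \<Rightarrow> nat) \<Rightarrow> edge set \<Rightarrow> edge" where
  "costliest \<tau> E = (THE e. e \<in> E \<and> (\<forall>e'\<in>E. e' = e \<or> cheaper \<tau> e' e))"

definition component :: "nat set \<Rightarrow> edge set \<Rightarrow> nat \<Rightarrow> nat set" where
  "component C F v = {u \<in> C. (v, u) \<in> {(a, b). {a, b} \<in> snd ` F}\<^sup>*}"

definition components :: "nat set \<Rightarrow> edge set \<Rightarrow> nat set set" where
  "components C F = component C F ` C"

text \<open>
  The supernodes are the components of \<open>(C, F)\<close>. The cheapest edge from \<open>v \<in> S\<close> to \<open>C - S\<close> leads to
  \<open>v\<close>'s most preferred agent outside \<open>S\<close>, so its cost is learned by one query to \<open>v\<close>.
\<close>

definition boruvka_round ::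
    "nat set \<Rightarrow> profile \<Rightarrow> (nat set \<Rightarrow> nat) \<Rightarrow> edge set \<Rightarrow> edge set mech" where
  "boruvka_round C \<sigma> \<tau> F = do {
     x \<leftarrow> for_each C (\<lambda>v. ask v (top_of \<sigma> (C - component C F v) v));
     Return (F \<union> (\<lambda>S. cheapest \<tau> ((\<lambda>v. (x v, {v, top_of \<sigma> (C - S) v})) ` S)) ` components C F) }"

text \<open>
  The first argument bounds the number of rounds. Every round at least halves the number of
  supernodes, so with the bound \<open>card C\<close> used below the loop always ends with a single supernode.
\<close>

primrec boruvka_loop ::
    "nat \<Rightarrow> nat set \<Rightarrow> profile \<Rightarrow> (nat set \<Rightarrow> nat) \<Rightarrow> edge set \<Rightarrow> edge set mech" where
  "boruvka_loop 0 C \<sigma> \<tau> F = Return F"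
| "boruvka_loop (Suc t) C \<sigma> \<tau> F =
     (if card (components C F) > 1
      then do { F' \<leftarrow> boruvka_round C \<sigma> \<tau> F; boruvka_loop t C \<sigma> \<tau> F' }
      else Return F)"

definition drop_costliest :: "(nat set \<Rightarrow> nat) \<Rightarrow> edge set \<Rightarrow> edge set" where
  "drop_costliest \<tau> F = F - {costliest \<tau> F}"

definition prune :: "nat set \<Rightarrow> nat \<Rightarrow> (nat set \<Rightarrow> nat) \<Rightarrow> edge set \<Rightarrow> edge set" where
  "prune C k \<tau> F =
     (drop_costliest \<tau> ^^ (LEAST m. card (components C ((drop_costliest \<tau> ^^ m) F)) = k)) F"

text \<open>Besides the number, Boruvka also hands back its final edge set.\<close>

definition boruvka ::
    "nat set \<Rightarrow> nat \<Rightarrow> profile \<Rightarrow> (nat set \<Rightarrow> nat) \<Rightarrow> (real \<times> edge set) mech" where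
  "boruvka C k \<sigma> \<tau> = do {
     F \<leftarrow> boruvka_loop (card C) C \<sigma> \<tau> {};
     let F' = prune C k \<tau> F in Return (real (card C) * (\<Sum>e\<in>F'. fst e), F') }"


section \<open>Meyerson-Top\<close>

fun meyerson_from ::
    "profile \<Rightarrow> nat \<Rightarrow> nat \<Rightarrow> real \<Rightarrow> nat set \<Rightarrow> nat list \<Rightarrow> nat set mech" where
  "meyerson_from \<sigma> k l B S [] = Return S"
| "meyerson_from \<sigma> k l B S (x # xs) = do {
     z \<leftarrow> ask x (top_of \<sigma> S x);
     let \<delta> = max (z - 3 * (B / real l)) 0; f = B / real k in
     Flip (min 1 (\<delta> / f)) (\<lambda>b. meyerson_from \<sigma> k l B (if b then insert x S else S) xs) }"

definition meyerson ::
    "profile \<Rightarrow> nat \<Rightarrow> nat \<Rightarrow> real \<Rightarrow> nat list \<Rightarrow> nat set mech" where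
  "meyerson \<sigma> k l B xs = meyerson_from \<sigma> k l B {hd xs} (tl xs)"


section \<open>BB-Top\<close>

text \<open>
  Binary search on a preference list: assuming that the first \<open>lo\<close> entries are within distance \<open>b\<close>
  of \<open>i\<close> and the entries from position \<open>hi\<close> on are not, find the number of entries that are.
\<close>

function binary_search :: "nat \<Rightarrow> nat list \<Rightarrow> real \<Rightarrow> nat \<Rightarrow> nat \<Rightarrow> nat mech" where
  "binary_search i js b lo hi =
     (if lo < hi
      then Query i (js ! ((lo + hi) div 2))
             (\<lambda>z. if z \<le> b then binary_search i js b (Suc ((lo + hi) div 2)) hi
                  else binary_search i js b lo ((lo + hi) div 2))
      else Return lo)"
  by pat_completeness auto
termination by (relation "Wellfounded.measure (\<lambda>(i, js, b, lo, hi). hi - lo)") auto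

declare binary_search.simps [simp del]

definition query_ball :: "profile \<Rightarrow> nat set \<Rightarrow> nat \<Rightarrow> real \<Rightarrow> nat set mech" where
  "query_ball \<sigma> P i b = (let js = pref_list \<sigma> P i in do {
     m \<leftarrow> binary_search i js b 0 (length js);
     Return (set (take m js)) })"

definition bb_top ::
    "real \<Rightarrow> real \<Rightarrow> real \<Rightarrow> nat \<Rightarrow> nat \<Rightarrow> nat set \<Rightarrow> profile \<Rightarrow> (nat \<Rightarrow> nat) \<Rightarrow> real \<Rightarrow> centrum_alg
      \<Rightarrow> nat set mech" where
  "bb_top \<rho> \<epsilon> \<alpha> n l P \<sigma> w B \<A> =
    (let I = {i \<in> P. w i > 0};
         w' = (\<lambda>i. real (min (w i) l));
         B0 = (\<lambda>i. \<rho> * (1 + 3 * \<epsilon>) * B / w' i);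
         q = (\<lambda>i. nat \<lceil>log (1 + \<epsilon>) (\<alpha> * w' i * B0 i * real n / (\<epsilon> * B))\<rceil>)
     in do {
       S \<leftarrow> for_each I (\<lambda>i. for_each {0..q i} (\<lambda>r. query_ball \<sigma> P i (B0 i / (1 + \<epsilon>) ^ r)));
       let d' = (SOME d'. pmetric_on P d' \<and>
                  (\<forall>i\<in>I.
                     (\<forall>j \<in> P - S i 0. B0 i \<le> d' i j) \<and>
                     (\<forall>r<q i. \<forall>j \<in> S i r - S i (Suc r).
                        B0 i / (1 + \<epsilon>) ^ Suc r \<le> d' i j \<and> d' i j \<le> B0 i / (1 + \<epsilon>) ^ r) \<and>
                     (\<forall>j \<in> S i (q i). d' i j \<le> \<epsilon> * B / (\<alpha> * real n * w' i))))
       in Return (\<A> P w d') })"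


section \<open>Meyerson-BB\<close>

text \<open>
  If Boruvka returns \<open>B' = 0\<close> (which happens iff \<open>OPT = 0\<close>), all quotients by \<open>B'\<close> in the
  subroutines are undefined. As each component of Boruvka's final edge set is then co-located, the
  mechanism picks one agent from each of these \<open>k\<close> components, without further queries.

  The runs of Meyerson-Top are independent repetitions, each on a freshly shuffled sequence. (If all
  runs shared a single ordering, repeating could not drive the failure probability to \<open>0\<close>, as a bad
  ordering may be drawn, with a positive probability not depending on \<open>\<delta>\<close>.)

  The set of candidates always contains \<open>S0\<close>, so there is no failure branch.
\<close>

definition meyerson_bb ::
    "nat set \<Rightarrow> nat \<Rightarrow> nat \<Rightarrow> real \<Rightarrow> real \<Rightarrow> (nat set \<Rightarrow> nat) \<Rightarrow> nat set \<Rightarrow> profile \<Rightarrow> centrum_alg \<Rightarrow> real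
      \<Rightarrow> nat set mech" where
  "meyerson_bb C k l \<rho> \<epsilon> \<tau> S0 \<sigma> \<A> \<delta> =
    (let n = card C;
         top_cost = (\<lambda>v. Top l {# v i. i \<in># mset_set C #})
     in do {
       (B', F) \<leftarrow> boruvka C k \<sigma> \<tau>;
       if B' = 0 then Return (Min ` components C F)
       else do {
         v0 \<leftarrow> distance_vector C \<sigma> S0;
         cands \<leftarrow> map_mech
           (\<lambda>(i, j). Shuffle C (\<lambda>xs. do {
              S \<leftarrow> meyerson \<sigma> k l (2 ^ i * B' / (real n)\<^sup>2) xs;
              if card S \<le> 104 * k
              then do { v \<leftarrow> distance_vector C \<sigma> S; Return [(S, top_cost v)] }
              else Return [] }))
           (List.product [0..<Suc (nat \<lceil>log 2 ((real n)\<^sup>2)\<rceil>)] [0..<nat \<lceil>log 2 (1 / \<delta>)\<rceil>]);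
         let P = fst (arg_min_list snd ((S0, top_cost v0) # concat cands));
             w = (\<lambda>i. if i \<in> P then card {j \<in> C. top_of \<sigma> P j = i} else 0)
         in bb_top \<rho> \<epsilon> ((real n)\<^sup>2) n l P \<sigma> w B' \<A> } })"

end

theory Submission
  imports Defs
begin

text \<open>
  If \<open>B\<close> is \<open>n\<close> times the cost of Boruvka's pruned edge set, then \<open>OPT \<le> B \<le> 2 n\<^sup>2 OPT\<close>, so one of the
  logarithmically many guesses lies in \<open>[OPT, 2 OPT]\<close>. For that guess, a run of Meyerson-Top on a random order opens
  \<open>104 k\<close> centers at most and has cost \<open>O(OPT)\<close> with probability at least \<open>1/2\<close>. This rests on potentials that are
  functions of the set of agents still to come, one for each cluster of an optimal solution, and on Markov's
  inequality for the sum of opening and connection costs. The repetitions fail simultaneously with probability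
  \<open>\<delta>\<close> at most. Rounding loses a constant factor only, since any solution \<open>d'\<close> of the linear program agrees
  with \<open>d\<close> up to a factor \<open>1 + \<epsilon>\<close> and a negligible additive term on all pairs relevant to near-optimal centers;
  here \<open>B\<close> also bounds the optimum restricted to centers in the point set of BB-Top, as one
  agent of the point set in each of Boruvka's components serves its component.
\<close>

section \<open>Sums of the largest entries\<close>

text \<open>The hard part is a single run of Meyerson-Top. The distance from a cluster's center to
  the open set may drop at any time through openings elsewhere, so no estimate can fix it in
  advance. The potential of a cluster therefore sees the open set through one bit only, whether a
  core agent of the cluster is open. The unknown distance enters the one-step inequality with
  opposite signs for core and rim agents and cancels, because all agents still to come are equally
  likely to be next. This is where the random order is used.

  The constants descend from there: a run has expected outlay at most \<open>17 * B\<close>, and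
  Markov's inequality at level \<open>104 * B\<close> matches the limit of \<open>104 * k\<close>
  centers. The cost is then at most \<open>107 * B\<close>, hence \<open>214\<close> times the
  optimum for a guess within a factor 2. Moving centers into the point set gives
  \<open>2 * 214 + 2 = 430\<close>, and rounding ends with at most \<open>2000 * \<rho>\<close>.

  The query bound must hold in every execution and not just in good ones, so queries are counted on
  the whole support, separately from the probability estimates.\<close>

abbreviation Top_on :: "nat \<Rightarrow> 'a set \<Rightarrow> ('a \<Rightarrow> real) \<Rightarrow> real" where
  "Top_on l A f \<equiv> Top l {# f i. i \<in># mset_set A #}"

text \<open>Greedy exchange: \<open>N\<close> gives up \<open>y\<close> if it contains it and
  otherwise any element, which is at most \<open>y\<close>; what is left fits the tail with one
  entry fewer. Nonnegativity covers an \<open>N\<close> smaller than the prefix.\<close>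

lemma sum_mset_le_sum_list_take:
  fixes ys :: "real list"
  assumes "sorted_wrt (\<ge>) ys" "N \<subseteq># mset ys" "size N \<le> l" "\<forall>y\<in>set ys. 0 \<le> y"
  shows "sum_mset N \<le> sum_list (take l ys)"
  using assms
proof (induction ys arbitrary: l N)
  case Nil
  then show ?case by simp
next
  case (Cons y ys)
  show ?case
  proof (cases "N = {#}")
    case True
    have "\<forall>z\<in>set (take l (y # ys)). 0 \<le> z" using Cons.prems(4) by (meson in_set_takeD)
    then show ?thesis using True by (simp add: sum_list_nonneg)
  next
    case False
    then obtain l' where l: "l = Suc l'" using Cons.prems(3) by (cases l) auto
    obtain z N' where N: "N = add_mset z N'" "N' \<subseteq># mset ys" "z \<le> y"
    proof (cases "y \<in># N")
      case True
      then obtain N' where "N = add_mset y N'" by (metis insert_DiffM)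
      then show ?thesis using Cons.prems(2) that[of y N'] by auto
    next
      case no: False
      obtain z N' where N: "N = add_mset z N'" using False by (metis multiset_cases)
      have sub: "N \<subseteq># mset ys"
        using Cons.prems(2) no subset_eq_diff_conv[of N "{#y#}" "mset ys"] by (simp add: diff_single_trivial)
      then have "z \<in># mset ys" using N by (simp add: insert_subset_eq_iff)
      then have "z \<le> y" using Cons.prems(1) by auto
      moreover have "N' \<subseteq># mset ys" using sub N
        by (meson mset_subset_eq_insertD subset_mset.less_imp_le)
      ultimately show ?thesis using that N by blast
    qed
    have "sum_mset N' \<le> sum_list (take l' ys)"
      using Cons.prems N l by (intro Cons.IH) auto
    then show ?thesis using N l by simp
  qed
qed

lemma sum_mset_le_Top:
  assumes "N \<subseteq># M" "size N \<le> l" "\<forall>x\<in>#M. 0 \<le> x"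
  shows "sum_mset N \<le> Top l M"
  unfolding Top_def using assms
  by (intro sum_mset_le_sum_list_take) (auto simp: sorted_wrt_rev)

lemma sum_le_Top_on:
  assumes "finite C" "A \<subseteq> C" "card A \<le> l" "\<And>i. i \<in> C \<Longrightarrow> 0 \<le> f i"
  shows "sum f A \<le> Top_on l C f"
proof -
  have "sum_mset {# f i. i \<in># mset_set A #} \<le> Top_on l C f"
    using assms finite_subset[OF assms(2,1)]
    by (intro sum_mset_le_Top) (auto intro!: image_mset_subseteq_mono subset_imp_msubset_mset_set)
  then show ?thesis by (simp add: sum_unfold_sum_mset)
qed

text \<open>The multiset of values forgets the agents; sorting the agents by \<open>f\<close>
  recovers a set that attains the value. Together with \<open>sum_le_Top_on\<close>, this makes
  \<open>Top_on\<close> of a nonnegative function the maximum of its sums over sets of size at most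
  \<open>l\<close>.\<close>

lemma Top_on_witness:
  assumes "finite C"
  obtains A where "A \<subseteq> C" "card A \<le> l" "Top_on l C f = sum f A"
proof -
  obtain cs where cs: "sorted_list_of_multiset {# f i. i \<in># mset_set C #} = map f cs" "mset cs = mset_set C"
  proof -
    obtain ys where ys: "mset ys = mset_set C" using ex_mset by blast
    have "sort (map f ys) = map f (sort_key f ys)"
      by (rule properties_for_sort) simp_all
    then have "sorted_list_of_multiset {# f i. i \<in># mset_set C #} = map f (sort_key f ys)"
      using sorted_list_of_multiset_mset[of "map f ys"] by (simp add: ys)
    then show ?thesis using that ys by simp
  qed
  let ?A = "set (take l (rev cs))"
  have d: "distinct cs" using cs(2) assms
    by (simp add: distinct_count_atmost_1 count_mset_set' flip: set_mset_mset)
  have "?A \<subseteq> C" using cs(2) assms by (metis set_mset_mset finite_set_mset_mset_set set_rev set_take_subset)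
  moreover have "card ?A \<le> l" by (metis card_length le_trans length_take min.cobounded2)
  moreover have "Top_on l C f = sum f ?A"
    using d by (simp add: Top_def cs(1) rev_map take_map sum_list_distinct_conv_sum_set)
  ultimately show ?thesis using that by blast
qed

lemma Top_on_le:
  assumes "finite C" "\<And>A. A \<subseteq> C \<Longrightarrow> card A \<le> l \<Longrightarrow> sum f A \<le> b"
  shows "Top_on l C f \<le> b"
  using assms by (metis Top_on_witness)

lemma Top_on_nonneg:
  assumes "finite C" "\<And>i. i \<in> C \<Longrightarrow> 0 \<le> f i"
  shows "0 \<le> Top_on l C f"
  using sum_le_Top_on[of C "{}" l f] assms by simp

lemma Top_on_linear_le:
  assumes "finite C" "0 \<le> a" "0 \<le> b" "\<And>i. i \<in> C \<Longrightarrow> 0 \<le> g i" "\<And>i. i \<in> C \<Longrightarrow> 0 \<le> h i"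
    and "\<And>i. i \<in> C \<Longrightarrow> f i \<le> a * g i + b * h i"
  shows "Top_on l C f \<le> a * Top_on l C g + b * Top_on l C h"
proof (rule Top_on_le[OF assms(1)])
  fix A assume A: "A \<subseteq> C" "card A \<le> l"
  then have "sum f A \<le> (\<Sum>i\<in>A. a * g i + b * h i)" using assms by (intro sum_mono) auto
  also have "\<dots> = a * sum g A + b * sum h A" by (simp add: sum.distrib sum_distrib_left)
  also have "\<dots> \<le> a * Top_on l C g + b * Top_on l C h"
    using assms A by (intro add_mono mult_left_mono sum_le_Top_on) auto
  finally show "sum f A \<le> a * Top_on l C g + b * Top_on l C h" .
qed

lemma Top_on_const_le:
  assumes "finite C" "0 \<le> b" "\<And>i. i \<in> C \<Longrightarrow> f i \<le> b"
  shows "Top_on l C f \<le> real l * b"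
proof (rule Top_on_le[OF assms(1)])
  fix A assume A: "A \<subseteq> C" "card A \<le> l"
  then have "sum f A \<le> real (card A) * b" using assms by (intro sum_bounded_above) auto
  also have "\<dots> \<le> real l * b" using A assms by (intro mult_right_mono) auto
  finally show "sum f A \<le> real l * b" .
qed

text \<open>Each of at most \<open>l\<close> entries is bounded by \<open>t\<close> plus its excess
  over \<open>t\<close>. This linear bound replaces the nonlinear objective in the analysis of
  Meyerson-Top; \<open>sum_excess_le_Top\<close> is a converse at \<open>t = B / l\<close>.\<close>

lemma Top_on_le_excess:
  assumes "finite C" "0 \<le> t"
  shows "Top_on l C f \<le> real l * t + (\<Sum>i\<in>C. max (f i - t) 0)"
proof (rule Top_on_le[OF assms(1)])
  fix A assume A: "A \<subseteq> C" "card A \<le> l"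
  have "sum f A \<le> (\<Sum>i\<in>A. t + max (f i - t) 0)" by (intro sum_mono) auto
  also have "\<dots> = real (card A) * t + (\<Sum>i\<in>A. max (f i - t) 0)" by (simp add: sum.distrib)
  also have "\<dots> \<le> real l * t + (\<Sum>i\<in>C. max (f i - t) 0)"
    using A assms by (intro add_mono mult_right_mono sum_mono2) auto
  finally show "sum f A \<le> real l * t + (\<Sum>i\<in>C. max (f i - t) 0)" .
qed

lemma card_above_average_of_Top:
  assumes "finite C" "1 \<le> l" "Top_on l C f \<le> B" "\<And>i. i \<in> C \<Longrightarrow> 0 \<le> f i"
  shows "card {i \<in> C. f i > B / real l} < l"
proof (rule ccontr)
  let ?J = "{i \<in> C. f i > B / real l}"
  assume "\<not> card ?J < l"
  then obtain A where A: "A \<subseteq> ?J" "card A = l"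
    by (meson not_less obtain_subset_with_card_n)
  have "A \<noteq> {}" "finite A" using A assms by (auto intro: card_ge_0_finite)
  then have "(\<Sum>i\<in>A. B / real l) < sum f A" using A by (intro sum_strict_mono) auto
  also have "\<dots> \<le> Top_on l C f" using assms A by (intro sum_le_Top_on) auto
  finally show False using A assms by simp
qed

text \<open>Fewer than \<open>l\<close> entries exceed \<open>B / l\<close>, so even their whole
  sum, not just their excess, is among the sums bounded by \<open>Top\<close>.\<close>

lemma sum_excess_le_Top:
  assumes "finite C" "1 \<le> l" "Top_on l C f \<le> B" "\<And>i. i \<in> C \<Longrightarrow> 0 \<le> f i"
  shows "(\<Sum>i\<in>C. max (f i - B / real l) 0) \<le> B"
proof -
  let ?J = "{i \<in> C. f i > B / real l}"
  have B: "0 \<le> B / real l" using Top_on_nonneg[of C f l] assms by auto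
  have "(\<Sum>i\<in>C. max (f i - B / real l) 0) = (\<Sum>i\<in>?J. max (f i - B / real l) 0)"
    using assms by (intro sum.mono_neutral_right) auto
  also have "\<dots> \<le> sum f ?J" using B assms by (intro sum_mono) auto
  also have "\<dots> \<le> Top_on l C f"
    using assms card_above_average_of_Top[OF assms] by (intro sum_le_Top_on) auto
  finally show ?thesis using assms by simp
qed

section \<open>Value-query mechanisms\<close>

text \<open>A Hoare-style judgement about all executions of positive probability. The second
  argument of \<open>R\<close> holds the queries made by \<open>m\<close> alone, so that
  \<open>ensures_bind\<close> adds up the queries of two stages.\<close>

definition ensures :: "dist_fun \<Rightarrow> 'r mech \<Rightarrow> ('r \<Rightarrow> nat multiset \<Rightarrow> bool) \<Rightarrow> bool" where
  "ensures d m R \<longleftrightarrow> (\<forall>(r, Q) \<in> set_pmf (run d m). R r Q)"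

lemma run_bind:
  "run d (bind_mech m f) =
     bind_pmf (run d m) (\<lambda>(r, Q). map_pmf (\<lambda>(s, Q'). (s, Q + Q')) (run d (f r)))"
proof (induction m)
  case (Return r)
  then show ?case by (simp add: bind_return_pmf case_prod_beta)
next
  case (Query i a K)
  have "run d (bind_mech (Query i a K) f) =
    map_pmf (\<lambda>(r, Q). (r, add_mset i Q))
      (bind_pmf (run d (K (d i a))) (\<lambda>(r, Q). map_pmf (\<lambda>(s, Q'). (s, Q + Q')) (run d (f r))))"
    using Query.IH[of "K (d i a)"] by simp
  then show ?case
    by (simp add: map_bind_pmf bind_map_pmf pmf.map_comp case_prod_beta comp_def)
next
  case (Flip p K)
  then show ?case by (simp add: bind_assoc_pmf)
next
  case (Shuffle X K)
  then show ?case by (simp add: bind_assoc_pmf)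
qed

lemma map_fst_run_bind:
  "map_pmf fst (run d (bind_mech m f)) = bind_pmf (map_pmf fst (run d m)) (\<lambda>r. map_pmf fst (run d (f r)))"
  by (simp add: run_bind map_bind_pmf bind_map_pmf pmf.map_comp case_prod_beta comp_def)

lemma ensures_mono:
  assumes "ensures d m R" "\<And>r Q. R r Q \<Longrightarrow> R' r Q"
  shows "ensures d m R'"
  using assms unfolding ensures_def by auto

lemma ensures_Return: "R r {#} \<Longrightarrow> ensures d (Return r) R"
  by (simp add: ensures_def)

lemma ensures_Query:
  "ensures d (K (d i a)) (\<lambda>r Q. R r (add_mset i Q)) \<Longrightarrow> ensures d (Query i a K) R"
  unfolding ensures_def by auto

lemma ensures_ask: "R (d i a) {#i#} \<Longrightarrow> ensures d (ask i a) R"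
  by (simp add: ensures_def ask_def)

lemma ensures_Flip: "(\<And>b. ensures d (K b) R) \<Longrightarrow> ensures d (Flip p K) R"
  unfolding ensures_def by auto

lemma ensures_Shuffle:
  assumes "finite X" "\<And>xs. set xs = X \<Longrightarrow> distinct xs \<Longrightarrow> ensures d (K xs) R"
  shows "ensures d (Shuffle X K) R"
proof -
  have *: "set_pmf (pmf_of_set (permutations_of_set X)) = permutations_of_set X"
    using assms(1) by (intro set_pmf_of_set) auto
  show ?thesis using assms(2) unfolding ensures_def by (auto simp: * dest: permutations_of_setD)
qed

lemma ensures_bind:
  assumes "ensures d m R'" "\<And>r Q. R' r Q \<Longrightarrow> ensures d (f r) (\<lambda>s Q'. R s (Q + Q'))"
  shows "ensures d (bind_mech m f) R"
  using assms unfolding ensures_def run_bind by fastforce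

lemma ensures_map_mech:
  assumes "\<And>x. x \<in> set xs \<Longrightarrow> ensures d (f x) (\<lambda>r Q. A x r \<and> (\<forall>i. count Q i \<le> N x i))"
  shows "ensures d (map_mech f xs)
    (\<lambda>rs Q. list_all2 A xs rs \<and> (\<forall>i. count Q i \<le> (\<Sum>x\<leftarrow>xs. N x i)))"
  using assms
proof (induction xs)
  case Nil
  then show ?case by (simp add: ensures_Return)
next
  case (Cons x xs)
  show ?case unfolding map_mech.simps
    apply (rule ensures_bind[OF Cons.prems[of x]])
     apply simp
    apply (rule ensures_bind[OF Cons.IH])
    using Cons.prems apply simp
    apply (rule ensures_Return)
    apply (auto intro: add_mono)
    done
qed

lemma ensures_for_each:
  assumes "finite X"
    and "\<And>x. x \<in> X \<Longrightarrow> ensures d (f x) (\<lambda>r Q. A x r \<and> (\<forall>i. count Q i \<le> N x i))"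
  shows "ensures d (for_each X f)
    (\<lambda>g Q. (\<forall>x\<in>X. A x (g x)) \<and> (\<forall>i. count Q i \<le> (\<Sum>x\<in>X. N x i)))"
  unfolding for_each_def Let_def
proof (rule ensures_bind[OF ensures_map_mech[where A = A and N = N]])
  fix x assume "x \<in> set (sorted_list_of_set X)"
  then show "ensures d (f x) (\<lambda>r Q. A x r \<and> (\<forall>i. count Q i \<le> N x i))"
    using assms by simp
next
  let ?xs = "sorted_list_of_set X"
  fix ys Q
  assume *: "list_all2 A ?xs ys \<and> (\<forall>i. count Q i \<le> (\<Sum>x\<leftarrow>?xs. N x i))"
  have "A x (the (map_of (zip ?xs ys) x))" if x: "x \<in> X" for x
  proof -
    obtain i where i: "i < length ?xs" "?xs ! i = x"
      using x assms(1) by (metis in_set_conv_nth sorted_list_of_set.set_sorted_key_list_of_set)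
    have len: "length ?xs = length ys" using * list_all2_lengthD by blast
    have "map_of (zip ?xs ys) (?xs ! i) = Some (ys ! i)"
      using i len by (intro map_of_zip_nth) auto
    then show ?thesis using * i by (auto dest: list_all2_nthD)
  qed
  moreover have "(\<Sum>x\<leftarrow>?xs. N x i) = (\<Sum>x\<in>X. N x i)" for i
    using assms(1) by (simp add: sum_list_distinct_conv_sum_set)
  ultimately show "ensures d (Return (\<lambda>x. the (map_of (zip ?xs ys) x)))
     (\<lambda>g Q'. (\<forall>x\<in>X. A x (g x)) \<and> (\<forall>i. count (Q + Q') i \<le> (\<Sum>x\<in>X. N x i)))"
    using * by (auto intro!: ensures_Return)
qed

lemma ensures_for_each_ask:
  assumes "finite X"
  shows "ensures d (for_each X (\<lambda>x. ask x (t x))) (\<lambda>g Q. (\<forall>x\<in>X. g x = d x (t x)) \<and> (\<forall>i. count Q i \<le> 1))"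
proof (rule ensures_mono)
  show "ensures d (for_each X (\<lambda>x. ask x (t x)))
    (\<lambda>g Q. (\<forall>x\<in>X. g x = d x (t x)) \<and> (\<forall>i. count Q i \<le> (\<Sum>x\<in>X. if x = i then 1 else 0)))"
    using assms by (intro ensures_for_each) (auto intro: ensures_ask)
qed (use assms in \<open>auto simp: sum.delta not_in_iff split: if_splits intro: le_trans\<close>)

section \<open>Probabilities of sequential composition\<close>

lemma prob_bind_pmf:
  "measure_pmf.prob (bind_pmf p f) A = measure_pmf.expectation p (\<lambda>x. measure_pmf.prob (f x) A)"
  unfolding measure_pmf_bind
  by (subst measure_pmf.measure_bind[where N = "count_space UNIV"])
    (auto simp: space_subprob_algebra prob_space_imp_subprob_space measure_pmf.prob_space_axioms)

lemma prob_bind_pmf_ge: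
  assumes "\<And>x. x \<in> set_pmf p \<Longrightarrow> c \<le> measure_pmf.prob (f x) A"
  shows "c \<le> measure_pmf.prob (bind_pmf p f) A"
proof -
  have "measure_pmf.expectation p (\<lambda>_. c) \<le> measure_pmf.expectation p (\<lambda>x. measure_pmf.prob (f x) A)"
  proof (rule integral_mono_AE)
    show "integrable p (\<lambda>x. measure_pmf.prob (f x) A)"
      by (intro measure_pmf.integrable_const_bound[where B = 1]) auto
  qed (use assms in \<open>auto simp: AE_measure_pmf_iff\<close>)
  then show ?thesis by (simp add: prob_bind_pmf)
qed

text \<open>\<open>X\<close> collects the intermediate results from which the bad event can still be
  reached. With \<open>c\<close> a bound for the second stage this multiplies failure probabilities;
  with \<open>c = 1\<close> it passes a failure probability through a later stage.\<close>

lemma prob_bind_pmf_le: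
  assumes "\<And>x. x \<in> set_pmf p \<Longrightarrow> measure_pmf.prob (f x) A \<le> (if x \<in> X then c else 0)"
  shows "measure_pmf.prob (bind_pmf p f) A \<le> measure_pmf.prob p X * c"
proof -
  have "measure_pmf.expectation p (\<lambda>x. measure_pmf.prob (f x) A)
      \<le> measure_pmf.expectation p (\<lambda>x. indicator X x * c)"
  proof (rule integral_mono_AE)
    show "integrable p (\<lambda>x. measure_pmf.prob (f x) A)"
      by (intro measure_pmf.integrable_const_bound[where B = 1]) auto
    show "integrable p (\<lambda>x. indicator X x * c)"
      by (intro measure_pmf.integrable_const_bound[where B = "\<bar>c\<bar>"]) (auto simp: indicator_def)
    show "AE x in p. measure_pmf.prob (f x) A \<le> indicator X x * c"
      using assms by (fastforce simp: AE_measure_pmf_iff indicator_def)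
  qed
  then show ?thesis by (simp add: prob_bind_pmf)
qed

text \<open>No run depends on the results of earlier ones, so failure probabilities multiply.
  \<open>P\<close> selects the runs with a useful guess; every other run contributes a factor of at
  most 1.\<close>

lemma prob_map_mech_none_le:
  assumes "\<And>x. x \<in> set xs \<Longrightarrow> P x \<Longrightarrow> measure_pmf.prob (map_pmf fst (run d (f x))) Bad \<le> 1 / 2"
  shows "measure_pmf.prob (map_pmf fst (run d (map_mech f xs))) {ys. \<forall>y\<in>set ys. y \<in> Bad}
    \<le> (1 / 2) ^ length (filter P xs)"
  using assms
proof (induction xs)
  case Nil
  then show ?case by simp
next
  case (Cons x xs)
  let ?r = "measure_pmf.prob (map_pmf fst (run d (map_mech f xs))) {ys. \<forall>y\<in>set ys. y \<in> Bad}"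
  have IH: "?r \<le> (1 / 2) ^ length (filter P xs)" using Cons by auto
  have "measure_pmf.prob (map_pmf fst (run d (map_mech f (x # xs)))) {ys. \<forall>y\<in>set ys. y \<in> Bad}
     \<le> measure_pmf.prob (map_pmf fst (run d (f x))) Bad * ?r"
    unfolding map_mech.simps map_fst_run_bind
    by (rule prob_bind_pmf_le)
       (auto simp: bind_return_pmf map_fst_run_bind vimage_def simp flip: map_pmf_def)
  also have "\<dots> \<le> (if P x then 1 / 2 else 1) * (1 / 2) ^ length (filter P xs)"
    using IH Cons.prems[of x] by (intro mult_mono) auto
  finally show ?case
    by (cases "P x") (simp_all del: measure_map_pmf map_mech.simps)
qed

section \<open>Preferences and binary search\<close>

lemma consistentD:
  assumes "consistent_profile C \<sigma> d" "i \<in> C"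
  shows "a \<in> C \<Longrightarrow> (a, a) \<in> \<sigma> i"
    and "(a, b) \<in> \<sigma> i \<Longrightarrow> (b, c) \<in> \<sigma> i \<Longrightarrow> (a, c) \<in> \<sigma> i"
    and "(a, b) \<in> \<sigma> i \<Longrightarrow> (b, a) \<in> \<sigma> i \<Longrightarrow> a = b"
    and "a \<in> C \<Longrightarrow> b \<in> C \<Longrightarrow> (a, b) \<in> \<sigma> i \<or> (b, a) \<in> \<sigma> i"
    and "(a, b) \<in> \<sigma> i \<Longrightarrow> d i a \<le> d i b"
proof -
  have lin: "linear_order_on C (\<sigma> i)" using assms unfolding consistent_profile_def by auto
  show r: "(a, a) \<in> \<sigma> i" if "a \<in> C" for a using lin that
    by (simp add: order_on_defs refl_on_def)
  show "(a, b) \<in> \<sigma> i \<Longrightarrow> (b, c) \<in> \<sigma> i \<Longrightarrow> (a, c) \<in> \<sigma> i"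
    using lin unfolding order_on_defs by (meson transD)
  show "(a, b) \<in> \<sigma> i \<Longrightarrow> (b, a) \<in> \<sigma> i \<Longrightarrow> a = b"
    using lin unfolding order_on_defs by (meson antisymD)
  show "a \<in> C \<Longrightarrow> b \<in> C \<Longrightarrow> (a, b) \<in> \<sigma> i \<or> (b, a) \<in> \<sigma> i"
    using lin r by (cases "a = b") (auto simp: order_on_defs total_on_def)
  show "(a, b) \<in> \<sigma> i \<Longrightarrow> d i a \<le> d i b"
    using assms unfolding consistent_profile_def by auto
qed

lemma ex_most_preferred:
  assumes "consistent_profile C \<sigma> d" "i \<in> C" "finite S" "S \<noteq> {}" "S \<subseteq> C"
  shows "\<exists>a\<in>S. \<forall>b\<in>S. (a, b) \<in> \<sigma> i"
  using assms(3-5)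
proof (induction S rule: finite_ne_induct)
  case (singleton x)
  then show ?case using consistentD(1)[OF assms(1,2)] by auto
next
  case (insert x S)
  then obtain a where a: "a \<in> S" "\<forall>b\<in>S. (a, b) \<in> \<sigma> i" by auto
  have "(a, x) \<in> \<sigma> i \<or> (x, a) \<in> \<sigma> i"
    using consistentD(4)[OF assms(1,2)] insert.prems a(1) by auto
  moreover have "(x, x) \<in> \<sigma> i" using consistentD(1)[OF assms(1,2)] insert.prems by auto
  ultimately show ?case using a consistentD(2)[OF assms(1,2)] by blast
qed

lemma top_of:
  assumes "consistent_profile C \<sigma> d" "i \<in> C" "finite S" "S \<noteq> {}" "S \<subseteq> C"
  shows "top_of \<sigma> S i \<in> S" "\<And>b. b \<in> S \<Longrightarrow> (top_of \<sigma> S i, b) \<in> \<sigma> i"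
proof -
  have "\<exists>!a. a \<in> S \<and> (\<forall>b\<in>S. (a, b) \<in> \<sigma> i)"
    using ex_most_preferred[OF assms] consistentD(3)[OF assms(1,2)] by blast
  from theI'[OF this] show "top_of \<sigma> S i \<in> S" "\<And>b. b \<in> S \<Longrightarrow> (top_of \<sigma> S i, b) \<in> \<sigma> i"
    unfolding top_of_def by blast+
qed

lemma dist_top_of:
  assumes "consistent_profile C \<sigma> d" "i \<in> C" "finite S" "S \<noteq> {}" "S \<subseteq> C"
  shows "d i (top_of \<sigma> S i) = set_dist d i S"
  unfolding set_dist_def using assms top_of[OF assms] consistentD(5)[OF assms(1,2)]
  by (intro Min_eqI[symmetric]) auto

lemma set_dist_le: "finite S \<Longrightarrow> a \<in> S \<Longrightarrow> set_dist d i S \<le> d i a"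
  unfolding set_dist_def by (intro Min_le) auto

lemma set_dist_attained:
  assumes "finite S" "S \<noteq> {}"
  obtains a where "a \<in> S" "set_dist d i S = d i a"
proof -
  have "set_dist d i S \<in> d i ` S" unfolding set_dist_def using assms by (intro Min_in) auto
  then show ?thesis using that by auto
qed

lemma set_dist_antimono:
  "finite T \<Longrightarrow> S \<subseteq> T \<Longrightarrow> S \<noteq> {} \<Longrightarrow> set_dist d i T \<le> set_dist d i S"
  unfolding set_dist_def by (intro Min_antimono) auto

lemma ensures_distance_vector:
  assumes "consistent_profile C \<sigma> d" "finite C" "S \<noteq> {}" "S \<subseteq> C"
  shows "ensures d (distance_vector C \<sigma> S) (\<lambda>v Q. (\<forall>i\<in>C. v i = set_dist d i S) \<and> (\<forall>i. count Q i \<le> 1))"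
  unfolding distance_vector_def
  by (rule ensures_mono[OF ensures_for_each_ask[OF assms(2)]])
     (use assms dist_top_of[OF assms(1) _ finite_subset[OF assms(4,2)] assms(3,4)] in auto)

lemma ex_sorted_list_of_preferences:
  assumes "consistent_profile C \<sigma> d" "i \<in> C" "finite P" "P \<subseteq> C"
  shows "\<exists>xs. set xs = P \<and> distinct xs \<and> sorted_wrt (\<lambda>a b. (a, b) \<in> \<sigma> i) xs"
  using assms(3,4)
proof (induction P rule: finite_psubset_induct)
  case (psubset P)
  show ?case
  proof (cases "P = {}")
    case False
    then obtain a where a: "a \<in> P" "\<forall>b\<in>P. (a, b) \<in> \<sigma> i"
      using ex_most_preferred[OF assms(1,2)] psubset.hyps psubset.prems by blast
    then obtain xs where "set xs = P - {a}" "distinct xs" "sorted_wrt (\<lambda>a b. (a, b) \<in> \<sigma> i) xs"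
      using psubset.IH[of "P - {a}"] psubset.prems by auto
    then show ?thesis using a by (intro exI[of _ "a # xs"]) auto
  qed auto
qed

lemma sorted_wrt_antisym_unique:
  assumes "\<And>a b. R a b \<Longrightarrow> R b a \<Longrightarrow> a = b"
    and "sorted_wrt R xs" "sorted_wrt R ys" "distinct xs" "distinct ys" "set xs = set ys"
  shows "xs = ys"
  using assms(2-)
proof (induction xs arbitrary: ys)
  case (Cons a xs)
  then obtain b ys' where ys: "ys = b # ys'" by (cases ys) auto
  have "b \<in> insert a (set xs)" "a \<in> insert b (set ys')" using Cons.prems ys by auto
  moreover have "\<forall>x\<in>set xs. R a x" "\<forall>x\<in>set ys'. R b x" using Cons.prems ys by auto
  ultimately have "a \<noteq> b \<Longrightarrow> R a b \<and> R b a" by auto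
  then have "a = b" using assms(1)[of a b] by auto
  have "a \<notin> set xs" "a \<notin> set ys'" using Cons.prems(3,4) ys \<open>a = b\<close> by auto
  moreover have "insert a (set xs) = insert a (set ys')" using Cons.prems(5) ys \<open>a = b\<close> by simp
  ultimately have "set xs = set ys'" by (simp add: insert_ident)
  then have "xs = ys'" using Cons.prems(1-4) ys by (intro Cons.IH) simp_all
  then show ?case using ys \<open>a = b\<close> by simp
next
  case Nil
  then show ?case by simp
qed

lemma pref_list:
  assumes "consistent_profile C \<sigma> d" "i \<in> C" "finite P" "P \<subseteq> C"
  shows "set (pref_list \<sigma> P i) = P" "distinct (pref_list \<sigma> P i)"
    "sorted_wrt (\<lambda>a b. d i a \<le> d i b) (pref_list \<sigma> P i)"
proof -
  obtain xs where xs: "set xs = P" "distinct xs" "sorted_wrt (\<lambda>a b. (a, b) \<in> \<sigma> i) xs"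
    using ex_sorted_list_of_preferences[OF assms] by blast
  have "\<exists>!xs. set xs = P \<and> distinct xs \<and> sorted_wrt (\<lambda>a b. (a, b) \<in> \<sigma> i) xs"
  proof (rule ex1I)
    show "set xs = P \<and> distinct xs \<and> sorted_wrt (\<lambda>a b. (a, b) \<in> \<sigma> i) xs" using xs by simp
  next
    fix ys assume "set ys = P \<and> distinct ys \<and> sorted_wrt (\<lambda>a b. (a, b) \<in> \<sigma> i) ys"
    with xs show "ys = xs"
      using sorted_wrt_antisym_unique[of "\<lambda>a b. (a, b) \<in> \<sigma> i" ys xs]
        consistentD(3)[OF assms(1,2)] by blast
  qed
  from theI'[OF this] have *: "set (pref_list \<sigma> P i) = P \<and> distinct (pref_list \<sigma> P i) \<and>
      sorted_wrt (\<lambda>a b. (a, b) \<in> \<sigma> i) (pref_list \<sigma> P i)"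
    unfolding pref_list_def .
  then show "set (pref_list \<sigma> P i) = P" "distinct (pref_list \<sigma> P i)" by auto
  show "sorted_wrt (\<lambda>a b. d i a \<le> d i b) (pref_list \<sigma> P i)"
    using * by (blast intro: sorted_wrt_mono_rel[of _ "\<lambda>a b. (a, b) \<in> \<sigma> i"] consistentD(5)[OF assms(1,2)])
qed

text \<open>A probe splits off the middle entry, so an interval shorter than
  \<open>2 ^ Suc t\<close> leaves one shorter than \<open>2 ^ t\<close> on either side. The
  inequality is strict because an interval of length \<open>m\<close> has \<open>m + 1\<close>
  possible answers.\<close>

lemma ensures_binary_search:
  assumes "sorted_wrt (\<lambda>a b. d i a \<le> d i b) js" "lo \<le> hi" "hi \<le> length js" "hi - lo < 2 ^ t"
    and "\<And>j. j < lo \<Longrightarrow> d i (js ! j) \<le> b" "\<And>j. hi \<le> j \<Longrightarrow> j < length js \<Longrightarrow> b < d i (js ! j)"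
  shows "ensures d (binary_search i js b lo hi)
    (\<lambda>m Q. m \<le> length js \<and> (\<forall>j<m. d i (js ! j) \<le> b) \<and> (\<forall>j. m \<le> j \<longrightarrow> j < length js \<longrightarrow> b < d i (js ! j))
       \<and> (\<forall>x. count Q x \<le> (if x = i then t else 0)))"
  using assms(2-)
proof (induction t arbitrary: lo hi)
  case 0
  then show ?case by (subst binary_search.simps) (auto intro: ensures_Return)
next
  case (Suc t)
  show ?case
  proof (cases "lo < hi")
    case False
    then show ?thesis using Suc.prems by (subst binary_search.simps) (auto intro: ensures_Return)
  next
    case True
    define mid where "mid = (lo + hi) div 2"
    have mid: "lo \<le> mid" "mid < hi" using True unfolding mid_def by auto
    have le: "d i (js ! j) \<le> d i (js ! m)" if "j \<le> m" "m < length js" for j m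
      using sorted_wrt_nth_less[OF assms(1), of j m] that by (cases "j = m") auto
    have step: "ensures d (if d i (js ! mid) \<le> b then binary_search i js b (Suc mid) hi
         else binary_search i js b lo mid)
     (\<lambda>m Q. m \<le> length js \<and> (\<forall>j<m. d i (js ! j) \<le> b) \<and> (\<forall>j. m \<le> j \<longrightarrow> j < length js \<longrightarrow> b < d i (js ! j))
       \<and> (\<forall>x. count Q x \<le> (if x = i then t else 0)))"
    proof (cases "d i (js ! mid) \<le> b")
      case lew: True
      have "hi - Suc mid < 2 ^ t" using Suc.prems(3) True unfolding mid_def by simp
      moreover have "d i (js ! j) \<le> b" if "j < Suc mid" for j
        using le[of j mid] that mid Suc.prems(2) lew by simp
      ultimately show ?thesis using lew Suc.prems mid
        by (simp only: if_True) (intro Suc.IH; simp)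
    next
      case gt: False
      have "mid - lo < 2 ^ t" using Suc.prems(3) True unfolding mid_def by simp
      moreover have "b < d i (js ! j)" if "mid \<le> j" "j < length js" for j
        using le[of mid j] that gt by simp
      ultimately show ?thesis using gt Suc.prems mid
        by (simp only: if_False) (intro Suc.IH; simp)
    qed
    have eq: "binary_search i js b lo hi =
        Query i (js ! mid) (\<lambda>z. if z \<le> b then binary_search i js b (Suc mid) hi
          else binary_search i js b lo mid)"
      using True unfolding mid_def by (subst binary_search.simps) simp
    show ?thesis
      unfolding eq by (rule ensures_Query, rule ensures_mono[OF step]) (auto simp: not_in_iff split: if_splits)
  qed
qed

lemma ensures_query_ball:
  assumes "consistent_profile C \<sigma> d" "i \<in> C" "finite P" "P \<subseteq> C" "card P < 2 ^ t"
  shows "ensures d (query_ball \<sigma> P i b)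
    (\<lambda>S Q. S = {j \<in> P. d i j \<le> b} \<and> (\<forall>x. count Q x \<le> (if x = i then t else 0)))"
proof -
  let ?js = "pref_list \<sigma> P i"
  note js = pref_list[OF assms(1-4)]
  have len: "length ?js = card P" using distinct_card[OF js(2)] js(1) by simp
  have "set (take m ?js) = {j \<in> P. d i j \<le> b}"
    if "m \<le> length ?js" "\<forall>j<m. d i (?js ! j) \<le> b" "\<forall>j. m \<le> j \<longrightarrow> j < length ?js \<longrightarrow> b < d i (?js ! j)" for m
  proof -
    have "set (take m ?js) = {?js ! j | j. j < m}"
      using that(1) by (force simp: in_set_conv_nth)
    also have "\<dots> = {j \<in> set ?js. d i j \<le> b}"
    proof (intro set_eqI iffI)
      fix x assume "x \<in> {?js ! j | j. j < m}"
      then show "x \<in> {j \<in> set ?js. d i j \<le> b}" using that by (auto intro!: nth_mem)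
    next
      fix x assume x: "x \<in> {j \<in> set ?js. d i j \<le> b}"
      then obtain j where "j < length ?js" "x = ?js ! j" by (auto simp: in_set_conv_nth)
      with x that(3) show "x \<in> {?js ! j | j. j < m}" by (cases "m \<le> j") auto
    qed
    finally show ?thesis using js(1) by simp
  qed
  note take_eq = this
  show ?thesis unfolding query_ball_def Let_def
  proof (rule ensures_bind[OF ensures_binary_search[where d = d and i = i and js = ?js and t = t and b = b]])
    fix m Q
    assume "m \<le> length ?js \<and> (\<forall>j<m. d i (?js ! j) \<le> b) \<and>
      (\<forall>j. m \<le> j \<longrightarrow> j < length ?js \<longrightarrow> b < d i (?js ! j)) \<and> (\<forall>x. count Q x \<le> (if x = i then t else 0))"
    then show "ensures d (Return (set (take m ?js)))
      (\<lambda>S Q'. S = {j \<in> P. d i j \<le> b} \<and> (\<forall>x. count (Q + Q') x \<le> (if x = i then t else 0)))"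
      by (intro ensures_Return) (simp add: take_eq)
  qed (use js(3) len assms(5) in auto)
qed

section \<open>Components of edge sets\<close>

definition linked :: "edge set \<Rightarrow> nat \<Rightarrow> nat \<Rightarrow> bool" where
  "linked F u v \<longleftrightarrow> (u, v) \<in> {(a, b). {a, b} \<in> snd ` F}\<^sup>*"

definition priced_edges :: "nat set \<Rightarrow> dist_fun \<Rightarrow> edge set \<Rightarrow> bool" where
  "priced_edges C d F \<longleftrightarrow> (\<forall>e\<in>F. \<exists>a\<in>C. \<exists>b\<in>C. a \<noteq> b \<and> e = (d a b, {a, b}))"

lemma priced_edges_subset: "priced_edges C d F \<Longrightarrow> G \<subseteq> F \<Longrightarrow> priced_edges C d G"
  unfolding priced_edges_def by auto

lemma linked_refl: "linked F u u"
  by (simp add: linked_def)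

lemma linked_trans: "linked F u v \<Longrightarrow> linked F v w \<Longrightarrow> linked F u w"
  unfolding linked_def by (rule rtrancl_trans)

lemma linked_mono: "linked F u v \<Longrightarrow> F \<subseteq> G \<Longrightarrow> linked G u v"
  unfolding linked_def by (erule rev_subsetD[OF _ rtrancl_mono]) auto

lemma linked_step: "{u, v} \<in> snd ` F \<Longrightarrow> linked F u v"
  unfolding linked_def by (intro r_into_rtrancl) simp

lemma linked_edge: "(c, {u, v}) \<in> F \<Longrightarrow> linked F u v"
  by (intro linked_step) force

lemma linked_induct [consumes 1, case_names refl step]:
  assumes "linked F u v" "P u"
    and "\<And>y z. linked F u y \<Longrightarrow> {y, z} \<in> snd ` F \<Longrightarrow> P y \<Longrightarrow> P z"
  shows "P v"
  using assms(1)[unfolded linked_def]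
proof (induction rule: rtrancl_induct)
  case (step y z)
  then show ?case using assms(3)[of y z] unfolding linked_def by auto
qed (rule assms(2))

lemma linked_sym:
  assumes "linked F u v"
  shows "linked F v u"
  using assms
proof (induction rule: linked_induct)
  case (step y z)
  then have "linked F z y" by (intro linked_step) (simp add: insert_commute)
  then show ?case using step by (blast intro: linked_trans)
qed (rule linked_refl)

lemma linked_closed:
  assumes "linked F u v" "u \<in> X" "\<And>a b. {a, b} \<in> snd ` F \<Longrightarrow> a \<in> X \<Longrightarrow> b \<in> X"
  shows "v \<in> X"
  using assms(1,2) by (induction rule: linked_induct) (blast intro: assms(3))+

lemma linked_in_carrier:
  assumes "priced_edges C d F" "linked F u v" "u \<in> C"
  shows "v \<in> C"
  using assms(2,3)
proof (rule linked_closed)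
  fix a b assume "{a, b} \<in> snd ` F"
  then obtain e where "e \<in> F" "{a, b} = snd e" by auto
  with assms(1) obtain x y where "x \<in> C" "y \<in> C" "{a, b} = {x, y}"
    unfolding priced_edges_def by fastforce
  then show "b \<in> C" by auto
qed

lemma linked_via_edge:
  assumes "linked F u v" "snd ` F \<subseteq> insert {a, b} (snd ` G)"
  shows "linked G u v \<or> (linked G u a \<and> linked G b v) \<or> (linked G u b \<and> linked G a v)"
  using assms(1)
proof (induction rule: linked_induct)
  case (step y z)
  show ?case
  proof (cases "{y, z} \<in> snd ` G")
    case True
    then have "linked G y z" by (rule linked_step)
    with step.IH show ?thesis by (meson linked_trans)
  next
    case False
    then have "{y, z} = {a, b}" using step.hyps assms(2) by auto
    with step.IH show ?thesis by (auto simp: doubleton_eq_iff intro: linked_refl)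
  qed
qed (simp add: linked_refl)

lemma in_component_iff: "u \<in> component C F v \<longleftrightarrow> u \<in> C \<and> linked F v u"
  by (simp add: component_def linked_def)

lemma component_self: "v \<in> C \<Longrightarrow> v \<in> component C F v"
  by (simp add: in_component_iff linked_refl)

lemma component_eq_iff:
  assumes "u \<in> C" "v \<in> C"
  shows "component C F u = component C F v \<longleftrightarrow> linked F u v"
  using assms unfolding set_eq_iff in_component_iff
  by (meson linked_sym linked_trans linked_refl)

lemma component_eqI: "K \<in> components C F \<Longrightarrow> v \<in> K \<Longrightarrow> component C F v = K"
  unfolding components_def using component_eq_iff in_component_iff by blast

lemma components_subset: "K \<in> components C F \<Longrightarrow> K \<subseteq> C \<and> K \<noteq> {}"
  unfolding components_def using component_self in_component_iff by blast

lemma finite_components: "finite C \<Longrightarrow> finite (components C F)"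
  by (simp add: components_def)

lemma card_components_empty: "card (components C {}) = card C"
proof -
  have "component C {} v = {v}" if "v \<in> C" for v
    using that by (auto simp: component_def)
  then have "components C {} = (\<lambda>v. {v}) ` C" unfolding components_def by auto
  then show ?thesis by (simp add: card_image)
qed

lemma card_components_le_hitting:
  assumes "finite S" "\<And>v. v \<in> C \<Longrightarrow> \<exists>s\<in>S. s \<in> C \<and> linked F v s"
  shows "card (components C F) \<le> card S"
proof -
  have "components C F \<subseteq> component C F ` S"
  proof
    fix K assume "K \<in> components C F"
    then obtain v where v: "v \<in> C" "K = component C F v" unfolding components_def by auto
    obtain s where "s \<in> S" "s \<in> C" "linked F v s" using assms(2)[OF v(1)] by auto
    then show "K \<in> component C F ` S" using v component_eq_iff[of v C s F] by simp
  qed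
  then show ?thesis using assms(1) surj_card_le by blast
qed

lemma components_coarsen:
  assumes "F \<subseteq> G"
  obtains \<phi> where "components C G = \<phi> ` components C F"
    "\<And>v. v \<in> C \<Longrightarrow> \<phi> (component C F v) = component C G v"
proof -
  define \<phi> where "\<phi> K = {u \<in> C. \<exists>v\<in>K. linked G v u}" for K
  have \<phi>: "\<phi> (component C F v) = component C G v" if "v \<in> C" for v
    unfolding \<phi>_def set_eq_iff mem_Collect_eq in_component_iff Bex_def
    using that linked_mono[OF _ assms] by (blast intro: linked_trans linked_refl)
  then have "components C G = \<phi> ` components C F" unfolding components_def by force
  then show ?thesis using that \<phi> by blast
qed

lemma card_components_strict:
  assumes "finite C" "F \<subseteq> G" "a \<in> C" "b \<in> C" "linked G a b" "\<not> linked F a b"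
  shows "card (components C G) < card (components C F)"
proof -
  obtain \<phi> where \<phi>: "components C G = \<phi> ` components C F"
    "\<And>v. v \<in> C \<Longrightarrow> \<phi> (component C F v) = component C G v"
    using components_coarsen[OF assms(2)] by blast
  have "\<not> inj_on \<phi> (components C F)"
  proof
    assume "inj_on \<phi> (components C F)"
    moreover have "\<phi> (component C F a) = \<phi> (component C F b)"
      using \<phi>(2) assms component_eq_iff by metis
    ultimately have "component C F a = component C F b"
      using assms(3,4) unfolding components_def by (auto dest: inj_onD)
    then show False using assms component_eq_iff by blast
  qed
  then have "card (\<phi> ` components C F) \<noteq> card (components C F)"
    using finite_components[OF assms(1)] inj_on_iff_eq_card by blast
  then show ?thesis
    using card_image_le[OF finite_components[OF assms(1)], of \<phi> F] \<phi>(1) by simp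
qed

lemma card_components_halve:
  assumes "finite C" "F \<subseteq> G"
    and "\<And>v. v \<in> C \<Longrightarrow> \<exists>u\<in>C. linked G v u \<and> \<not> linked F v u"
  shows "2 * card (components C G) \<le> card (components C F)"
proof -
  obtain \<phi> where \<phi>: "components C G = \<phi> ` components C F"
    "\<And>v. v \<in> C \<Longrightarrow> \<phi> (component C F v) = component C G v"
    using components_coarsen[OF assms(2)] by blast
  let ?X = "components C F"
  have fin: "finite ?X" using assms(1) by (rule finite_components)
  have fib: "2 \<le> card {K \<in> ?X. \<phi> K = L}" if L: "L \<in> \<phi> ` ?X" for L
  proof -
    obtain v where v: "v \<in> C" "L = component C G v"
      using L \<phi>(1)[symmetric] unfolding components_def by auto
    obtain u where u: "u \<in> C" "linked G v u" "\<not> linked F v u" using assms(3) v by blast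
    have "{component C F v, component C F u} \<subseteq> {K \<in> ?X. \<phi> K = L}"
      using u v \<phi>(2) component_eq_iff[of v C u G] unfolding components_def by auto
    moreover have "component C F v \<noteq> component C F u" using u v component_eq_iff by blast
    ultimately show ?thesis using fin
      by (metis (no_types, lifting) card_2_iff card_mono finite_subset mem_Collect_eq subsetI)
  qed
  have "2 * card (\<phi> ` ?X) = (\<Sum>L\<in>\<phi> ` ?X. 2)" by simp
  also have "\<dots> \<le> (\<Sum>L\<in>\<phi> ` ?X. card {K \<in> ?X. \<phi> K = L})" using fib by (intro sum_mono)
  also have "\<dots> = card ?X" using sum.image_gen[OF fin, of "\<lambda>_. 1::nat" \<phi>] by simp
  finally show ?thesis using \<phi>(1) by simp
qed

text \<open>Only the component containing the edge can split, and every part contains one of the two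
  ends.\<close>

lemma card_components_remove_edge:
  assumes "finite C" "G \<subseteq> F" "snd ` F \<subseteq> insert {a, b} (snd ` G)" "a \<in> C" "b \<in> C"
  shows "card (components C G) \<le> Suc (card (components C F))"
proof -
  have "components C G \<subseteq> (components C F - {component C F a}) \<union> {component C G a, component C G b}"
  proof
    fix K assume "K \<in> components C G"
    then obtain v where v: "v \<in> C" "K = component C G v" unfolding components_def by auto
    show "K \<in> (components C F - {component C F a}) \<union> {component C G a, component C G b}"
    proof (cases "linked G v a \<or> linked G v b")
      case True
      then show ?thesis
        using v assms(4,5) component_eq_iff[of v C a G] component_eq_iff[of v C b G] by auto
    next
      case False
      have "linked F v u \<longleftrightarrow> linked G v u" for u
        using linked_via_edge[OF _ assms(3), of v u] linked_mono[OF _ assms(2)] False by blast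
      then have "K = component C F v" using v by (auto simp: in_component_iff)
      moreover have "\<not> linked F v a"
        using linked_via_edge[OF _ assms(3), of v a] False by blast
      ultimately show ?thesis
        using v assms(4) component_eq_iff[of v C a F] unfolding components_def by auto
    qed
  qed
  then have "card (components C G) \<le>
      card ((components C F - {component C F a}) \<union> {component C G a, component C G b})"
    using assms(1) by (intro card_mono) (auto simp: finite_components)
  also have "\<dots> \<le> card (components C F - {component C F a}) + card {component C G a, component C G b}"
    by (rule card_Un_le)
  also have "\<dots> \<le> (card (components C F) - 1) + 2"
    using assms finite_components[OF assms(1), of F]
    by (intro add_mono) (auto simp: components_def card_insert_if)
  also have "\<dots> = Suc (card (components C F))"
    using assms finite_components[OF assms(1), of F] card_gt_0_iff[of "components C F"]
    by (auto simp: components_def)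
  finally show ?thesis .
qed

section \<open>Distances between linked agents\<close>

lemma pmetric_onD:
  assumes "pmetric_on P d"
  shows "i \<in> P \<Longrightarrow> d i i = 0" "i \<in> P \<Longrightarrow> j \<in> P \<Longrightarrow> 0 \<le> d i j" "i \<in> P \<Longrightarrow> j \<in> P \<Longrightarrow> d i j = d j i"
    "i \<in> P \<Longrightarrow> j \<in> P \<Longrightarrow> m \<in> P \<Longrightarrow> d i m \<le> d i j + d j m"
  using assms unfolding pmetric_on_def by blast+

lemma set_dist_nonneg:
  assumes "finite P" "pmetric_on P d" "S \<subseteq> P" "S \<noteq> {}" "i \<in> P"
  shows "0 \<le> set_dist d i S"
proof -
  obtain a where "a \<in> S" "set_dist d i S = d i a"
    using set_dist_attained[OF finite_subset[OF assms(3,1)] assms(4)] .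
  then show ?thesis using pmetric_onD(2)[OF assms(2), of i a] assms by auto
qed

lemma priced_edges_nonneg:
  assumes "pmetric_on C d" "priced_edges C d F" "e \<in> F"
  shows "0 \<le> fst e"
  using assms(2,3) pmetric_onD(2)[OF assms(1)] unfolding priced_edges_def by fastforce

lemma dist_le_component_cost:
  assumes "pmetric_on C d" "finite F" "priced_edges C d F" "u \<in> C" "linked F u v"
  shows "d u v \<le> (\<Sum>e\<in>{e \<in> F. \<forall>x\<in>snd e. linked F u x}. fst e)"
  using assms(2-)
proof (induction F arbitrary: u v rule: finite_induct)
  case empty
  have "u = v" using empty.prems(3) by (induction rule: linked_induct) auto
  then show ?case using pmetric_onD(1)[OF assms(1)] empty.prems(2) by simp
next
  case (insert e F)
  let ?W = "\<lambda>F u. {e \<in> F. \<forall>x\<in>snd e. linked F u x}"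
  note met = pmetric_onD[OF assms(1)]
  have pF: "priced_edges C d F" using insert.prems(1) by (rule priced_edges_subset) auto
  have mono: "linked F x y \<Longrightarrow> linked (insert e F) x y" for x y by (rule linked_mono) auto
  have nonneg: "\<And>e'. e' \<in> insert e F \<Longrightarrow> 0 \<le> fst e'"
    using priced_edges_nonneg[OF assms(1) insert.prems(1)] .
  have fin: "finite (?W (insert e F) u)" using insert.hyps by simp
  show ?case
  proof (cases "linked F u v")
    case True
    then have "d u v \<le> sum fst (?W F u)" using insert.IH[OF pF insert.prems(2)] by simp
    also have "\<dots> \<le> sum fst (?W (insert e F) u)"
      using mono nonneg fin by (intro sum_mono2) auto
    finally show ?thesis .
  next
    case False
    obtain a b where ab: "a \<in> C" "b \<in> C" "e = (d a b, {a, b})" "linked F u a" "linked F b v"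
    proof -
      obtain a b where ab: "a \<in> C" "b \<in> C" "e = (d a b, {a, b})"
        using insert.prems(1) unfolding priced_edges_def by auto
      have "snd ` insert e F \<subseteq> insert {a, b} (snd ` F)" using ab by auto
      from linked_via_edge[OF insert.prems(3) this] False
      consider "linked F u a" "linked F b v" | "linked F u b" "linked F a v" by blast
      then show ?thesis using that ab met(3)[of a b] by cases (auto simp: insert_commute)
    qed
    have vC: "v \<in> C" using linked_in_carrier[OF pF ab(5,2)] .
    have nub: "\<not> linked F u b" using False ab(5) by (meson linked_trans)
    have W: "?W F u \<inter> ?W F b = {}"
    proof (rule ccontr)
      assume "?W F u \<inter> ?W F b \<noteq> {}"
      then obtain e' where e': "e' \<in> F" "\<forall>x\<in>snd e'. linked F u x" "\<forall>x\<in>snd e'. linked F b x" by auto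
      moreover obtain x where "x \<in> snd e'" using pF e'(1) unfolding priced_edges_def by fastforce
      ultimately have "linked F u b" by (meson linked_sym linked_trans)
      then show False using nub by blast
    qed
    have lub: "linked (insert e F) u b" "linked (insert e F) u a"
      using mono[OF ab(4)] linked_edge[of "d a b" a b "insert e F"] ab(3) by (auto intro: linked_trans)
    have "d u v \<le> d u a + (d a b + d b v)"
      using met(4)[of u a v] met(4)[of a b v] ab vC insert.prems(2) by linarith
    also have "\<dots> \<le> sum fst (?W F u) + (fst e + sum fst (?W F b))"
      using insert.IH[OF pF insert.prems(2) ab(4)] insert.IH[OF pF ab(2) ab(5)] ab(3) by simp
    also have "\<dots> = sum fst (insert e (?W F u \<union> ?W F b))"
      using insert.hyps W by (simp add: sum.union_disjoint)
    also have "\<dots> \<le> sum fst (?W (insert e F) u)"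
    proof (intro sum_mono2 fin)
      show "insert e (?W F u \<union> ?W F b) \<subseteq> ?W (insert e F) u"
        using ab(3) lub mono by (auto intro: linked_trans)
    qed (use nonneg in auto)
    finally show ?thesis .
  qed
qed

lemma dist_le_forest_cost:
  assumes "pmetric_on C d" "finite F" "priced_edges C d F" "u \<in> C" "linked F u v"
  shows "d u v \<le> (\<Sum>e\<in>F. fst e)"
proof -
  have "d u v \<le> (\<Sum>e\<in>{e \<in> F. \<forall>x\<in>snd e. linked F u x}. fst e)"
    using assms by (rule dist_le_component_cost)
  also have "\<dots> \<le> (\<Sum>e\<in>F. fst e)"
    using assms(2) priced_edges_nonneg[OF assms(1,3)] by (intro sum_mono2) auto
  finally show ?thesis .
qed

section \<open>Boruvka\<close>

text \<open>All that is remembered of Boruvka's choice of an edge, without reference to ties: it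
  crosses the cut around \<open>S\<close>, and no pair across that cut is closer.\<close>

definition min_cut_edge :: "nat set \<Rightarrow> dist_fun \<Rightarrow> nat set \<Rightarrow> edge \<Rightarrow> bool" where
  "min_cut_edge C d S e \<longleftrightarrow>
     (\<exists>a\<in>S. \<exists>b\<in>C - S. e = (d a b, {a, b}) \<and> (\<forall>v\<in>S. \<forall>w\<in>C - S. d a b \<le> d v w))"

lemma priced_edges_min_cut:
  assumes "\<And>e. e \<in> F \<Longrightarrow> \<exists>S\<subseteq>C. min_cut_edge C d S e"
  shows "priced_edges C d F"
  unfolding priced_edges_def
proof
  fix e assume "e \<in> F"
  then obtain S a b where "S \<subseteq> C" "a \<in> S" "b \<in> C - S" "e = (d a b, {a, b})"
    using assms unfolding min_cut_edge_def by blast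
  then show "\<exists>a\<in>C. \<exists>b\<in>C. a \<noteq> b \<and> e = (d a b, {a, b})"
    by (intro bexI[of _ a] bexI[of _ b]) auto
qed

lemma priced_edge_dist:
  assumes "pmetric_on C d" "priced_edges C d F" "e \<in> F" "snd e = {p, q}"
  shows "p \<in> C" "q \<in> C" "fst e = d p q"
proof -
  obtain a b where ab: "a \<in> C" "b \<in> C" "e = (d a b, {a, b})"
    using assms(2,3) unfolding priced_edges_def by auto
  then have "{p, q} = {a, b}" using assms(4) by simp
  then have "p = a \<and> q = b \<or> p = b \<and> q = a" by (auto simp: doubleton_eq_iff)
  then show "p \<in> C" "q \<in> C" "fst e = d p q" using ab pmetric_onD(3)[OF assms(1), of a b] by auto
qed

text \<open>Stated for an abstract relation because it is applied in both directions, to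
  \<open>cheapest\<close> and to \<open>costliest\<close>.\<close>

lemma finite_total_ex1_least:
  assumes "finite E" "E \<noteq> {}"
    and total: "\<And>x y. x \<in> E \<Longrightarrow> y \<in> E \<Longrightarrow> x \<noteq> y \<Longrightarrow> R x y \<or> R y x"
    and trans: "\<And>x y z. R x y \<Longrightarrow> R y z \<Longrightarrow> R x z"
    and asym: "\<And>x y. R x y \<Longrightarrow> \<not> R y x"
  shows "\<exists>!e. e \<in> E \<and> (\<forall>e'\<in>E. e' = e \<or> R e e')"
proof -
  have "\<exists>e\<in>E. \<forall>e'\<in>E. e' = e \<or> R e e'"
    using assms(1,2) total
  proof (induction E rule: finite_ne_induct)
    case (insert x E)
    then obtain e where e: "e \<in> E" "\<forall>e'\<in>E. e' = e \<or> R e e'" by auto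
    show ?case
    proof (cases "R x e")
      case True
      then have "\<forall>e'\<in>insert x E. e' = x \<or> R x e'" using e trans[of x e] by auto
      then show ?thesis by blast
    next
      case False
      then have "x = e \<or> R e x" using insert.prems[of x e] e(1) by auto
      then have "\<forall>e'\<in>insert x E. e' = e \<or> R e e'" using e by auto
      then show ?thesis using e(1) by blast
    qed
  qed auto
  then obtain e where e: "e \<in> E" "\<forall>e'\<in>E. e' = e \<or> R e e'" by blast
  show ?thesis
  proof (rule ex1I)
    show "e \<in> E \<and> (\<forall>e'\<in>E. e' = e \<or> R e e')" using e by simp
  next
    fix e2 assume e2: "e2 \<in> E \<and> (\<forall>e'\<in>E. e' = e2 \<or> R e2 e')"
    then have "e = e2 \<or> R e2 e" "e2 = e \<or> R e e2" using e by simp_all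
    then show "e2 = e" using asym[of e e2] by auto
  qed
qed

lemma cheaper_total:
  assumes "priced_edges C d E" "inj_on \<tau> (all_edges C)" "e \<in> E" "e' \<in> E" "e \<noteq> e'"
  shows "cheaper \<tau> e e' \<or> cheaper \<tau> e' e"
proof (cases "fst e = fst e'")
  case True
  have "snd x \<in> all_edges C" if x: "x \<in> E" for x
  proof -
    obtain a b where "a \<in> C" "b \<in> C" "a \<noteq> b" "x = (d a b, {a, b})"
      using assms(1) x unfolding priced_edges_def by auto
    then show ?thesis unfolding all_edges_def by auto
  qed
  moreover have "snd e \<noteq> snd e'" using True assms(5) by (simp add: prod_eq_iff)
  ultimately have "\<tau> (snd e) \<noteq> \<tau> (snd e')" using assms(2-4) by (simp add: inj_on_eq_iff)
  then show ?thesis using True unfolding cheaper_def by auto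
qed (auto simp: cheaper_def)

lemma cheaper_trans: "cheaper \<tau> x y \<Longrightarrow> cheaper \<tau> y z \<Longrightarrow> cheaper \<tau> x z"
  unfolding cheaper_def by linarith

lemma cheaper_asym: "cheaper \<tau> x y \<Longrightarrow> \<not> cheaper \<tau> y x"
  unfolding cheaper_def by linarith

lemma cheapest:
  assumes "finite E" "E \<noteq> {}" "priced_edges C d E" "inj_on \<tau> (all_edges C)"
  shows "cheapest \<tau> E \<in> E" "\<And>e. e \<in> E \<Longrightarrow> fst (cheapest \<tau> E) \<le> fst e"
proof -
  have "\<exists>!e. e \<in> E \<and> (\<forall>e'\<in>E. e' = e \<or> cheaper \<tau> e e')"
    using assms(1,2) cheaper_total[OF assms(3,4)] cheaper_trans cheaper_asym
    by (rule finite_total_ex1_least)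
  from theI'[OF this] have *: "cheapest \<tau> E \<in> E \<and> (\<forall>e'\<in>E. e' = cheapest \<tau> E \<or> cheaper \<tau> (cheapest \<tau> E) e')"
    unfolding cheapest_def .
  then show "cheapest \<tau> E \<in> E" by simp
  show "fst (cheapest \<tau> E) \<le> fst e" if "e \<in> E" for e
    using * that unfolding cheaper_def[of _ "cheapest \<tau> E"] by fastforce
qed

lemma costliest:
  assumes "finite E" "E \<noteq> {}" "priced_edges C d E" "inj_on \<tau> (all_edges C)"
  shows "costliest \<tau> E \<in> E" "\<And>e. e \<in> E \<Longrightarrow> fst e \<le> fst (costliest \<tau> E)"
proof -
  have "\<exists>!e. e \<in> E \<and> (\<forall>e'\<in>E. e' = e \<or> cheaper \<tau> e' e)"
  proof (rule finite_total_ex1_least[OF assms(1,2)])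
    show "cheaper \<tau> y x \<or> cheaper \<tau> x y" if "x \<in> E" "y \<in> E" "x \<noteq> y" for x y
      using cheaper_total[OF assms(3,4) that] by auto
    show "cheaper \<tau> z x" if "cheaper \<tau> y x" "cheaper \<tau> z y" for x y z
      using that by (rule cheaper_trans[rotated])
    show "\<not> cheaper \<tau> x y" if "cheaper \<tau> y x" for x y using that by (rule cheaper_asym)
  qed
  from theI'[OF this] have *: "costliest \<tau> E \<in> E \<and> (\<forall>e'\<in>E. e' = costliest \<tau> E \<or> cheaper \<tau> e' (costliest \<tau> E))"
    unfolding costliest_def .
  then show "costliest \<tau> E \<in> E" by simp
  show "fst e \<le> fst (costliest \<tau> E)" if "e \<in> E" for e
    using * that unfolding cheaper_def[of _ _ "costliest \<tau> E"] by fastforce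
qed

lemma component_proper:
  assumes "card (components C F) > 1" "S \<in> components C F"
  shows "C - S \<noteq> {}"
proof
  assume "C - S = {}"
  have "components C F \<subseteq> {S}"
  proof
    fix K assume K: "K \<in> components C F"
    then obtain v where "v \<in> K" "v \<in> C" using components_subset by blast
    then have "component C F v = K" "component C F v = S"
      using \<open>C - S = {}\<close> component_eqI[OF K, of v] component_eqI[OF assms(2), of v] by auto
    then show "K \<in> {S}" by simp
  qed
  then have "card (components C F) \<le> card {S}" by (intro card_mono) auto
  then show False using assms(1) by simp
qed

lemma ensures_boruvka_round:
  assumes "finite C" "consistent_profile C \<sigma> d" "inj_on \<tau> (all_edges C)" "card (components C F) > 1"
  shows "ensures d (boruvka_round C \<sigma> \<tau> F)
    (\<lambda>F' Q. (\<exists>h. F' = F \<union> h ` components C F \<and> (\<forall>S\<in>components C F. min_cut_edge C d S (h S)))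
       \<and> (\<forall>i. count Q i \<le> 1))"
  unfolding boruvka_round_def
proof (rule ensures_bind[OF ensures_for_each_ask[OF assms(1)]])
  fix x and Q :: "nat multiset"
  assume x: "(\<forall>v\<in>C. x v = d v (top_of \<sigma> (C - component C F v) v)) \<and> (\<forall>i. count Q i \<le> 1)"
  define h where "h S = cheapest \<tau> ((\<lambda>v. (x v, {v, top_of \<sigma> (C - S) v})) ` S)" for S
  have "min_cut_edge C d S (h S)" if S: "S \<in> components C F" for S
  proof -
    let ?E = "(\<lambda>v. (x v, {v, top_of \<sigma> (C - S) v})) ` S"
    have SC: "S \<subseteq> C" "S \<noteq> {}" using components_subset[OF S] by auto
    \<comment> \<open>The query to \<open>v\<close> concerned the complement of \<open>v\<close>'s
      own supernode, which is \<open>S\<close> for \<open>v \<in> S\<close>.\<close>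
    have xv: "x v = d v (top_of \<sigma> (C - S) v)" if "v \<in> S" for v
      using x that SC component_eqI[OF S that] by auto
    have top: "top_of \<sigma> (C - S) v \<in> C - S" "\<And>w. w \<in> C - S \<Longrightarrow> d v (top_of \<sigma> (C - S) v) \<le> d v w"
      if "v \<in> S" for v
    proof -
      have v: "v \<in> C" using that SC by auto
      have fin: "finite (C - S)" "C - S \<subseteq> C" using assms(1) by auto
      note t = top_of[OF assms(2) v fin(1) component_proper[OF assms(4) S] fin(2)]
      show "top_of \<sigma> (C - S) v \<in> C - S" by (rule t(1))
      show "d v (top_of \<sigma> (C - S) v) \<le> d v w" if "w \<in> C - S" for w
        using t(2)[OF that] by (rule consistentD(5)[OF assms(2) v])
    qed
    have "priced_edges C d ?E"
      unfolding priced_edges_def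
    proof
      fix e assume "e \<in> ?E"
      then obtain v where v: "v \<in> S" "e = (x v, {v, top_of \<sigma> (C - S) v})" by auto
      then show "\<exists>a\<in>C. \<exists>b\<in>C. a \<noteq> b \<and> e = (d a b, {a, b})"
        using top(1)[OF v(1)] xv[OF v(1)] SC
        by (intro bexI[of _ v] bexI[of _ "top_of \<sigma> (C - S) v"]) auto
    qed
    note ch = cheapest[OF _ _ this assms(3)]
    have "finite ?E" "?E \<noteq> {}" using SC finite_subset[OF SC(1) assms(1)] by auto
    note ch = ch[OF this]
    obtain a where a: "a \<in> S" "h S = (x a, {a, top_of \<sigma> (C - S) a})"
      using ch(1) unfolding h_def by auto
    have "d a (top_of \<sigma> (C - S) a) \<le> d v w" if vw: "v \<in> S" "w \<in> C - S" for v w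
    proof -
      have "x a \<le> x v" using ch(2)[of "(x v, {v, top_of \<sigma> (C - S) v})"] a vw(1) unfolding h_def by auto
      also have "\<dots> \<le> d v w" using xv[OF vw(1)] top(2)[OF vw] by simp
      finally show ?thesis using xv[OF a(1)] by simp
    qed
    then show ?thesis unfolding min_cut_edge_def using a xv[OF a(1)] top(1)[OF a(1)]
      by (intro bexI[of _ a] bexI[of _ "top_of \<sigma> (C - S) a"]) auto
  qed
  then show "ensures d (Return (F \<union> (\<lambda>S. cheapest \<tau> ((\<lambda>v. (x v, {v, top_of \<sigma> (C - S) v})) ` S)) ` components C F))
    (\<lambda>F' Q'. (\<exists>h. F' = F \<union> h ` components C F \<and> (\<forall>S\<in>components C F. min_cut_edge C d S (h S)))
       \<and> (\<forall>i. count (Q + Q') i \<le> 1))"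
    using x unfolding h_def by (intro ensures_Return) auto
qed

section \<open>Connectivity through edges up to a cost threshold\<close>

definition below :: "real \<Rightarrow> edge set \<Rightarrow> edge set" where
  "below r F = {e \<in> F. fst e \<le> r}"

text \<open>The threshold component of \<open>u\<close> is unfinished: in the graph of all pairs at
  distance at most \<open>r\<close>, it is still joined to something outside.\<close>

definition active :: "nat set \<Rightarrow> dist_fun \<Rightarrow> real \<Rightarrow> edge set \<Rightarrow> nat \<Rightarrow> bool" where
  "active C d r F u \<longleftrightarrow>
     u \<in> C \<and> (\<exists>x\<in>C. \<exists>y\<in>C. linked (below r F) u x \<and> \<not> linked (below r F) u y \<and> d x y \<le> r)"

text \<open>
  Ties between edges leaving a common agent are broken by that agent's preferences and not by \<open>\<tau>\<close>,
  so the edge set may contain cycles. The following invariant replaces the usual fact that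
  Boruvka's edges lie in a minimum spanning tree.
\<close>

definition threshold_inv :: "nat set \<Rightarrow> dist_fun \<Rightarrow> real \<Rightarrow> edge set \<Rightarrow> bool" where
  "threshold_inv C d r F \<longleftrightarrow>
     (\<forall>u v. active C d r F u \<longrightarrow> active C d r F v \<longrightarrow> linked F u v \<longrightarrow> linked (below r F) u v)"

lemma below_subset: "below r F \<subseteq> F"
  by (auto simp: below_def)

lemma below_mono: "F \<subseteq> G \<Longrightarrow> below r F \<subseteq> below r G"
  by (auto simp: below_def)

lemma activeI:
  assumes "u \<in> C" "y \<in> C" "\<not> linked (below r F) u y" "d u y \<le> r"
  shows "active C d r F u"
  unfolding active_def using assms linked_refl[of "below r F" u] by auto

text \<open>A finished threshold component stays finished: no pair at distance at most
  \<open>r\<close> leaves it, so no later edge of such a cost can extend it.\<close>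

lemma active_antimono:
  assumes "pmetric_on C d" "priced_edges C d G" "F \<subseteq> G" "active C d r G u"
  shows "active C d r F u"
proof (rule ccontr)
  assume na: "\<not> active C d r F u"
  obtain x y where xy: "u \<in> C" "x \<in> C" "y \<in> C" "linked (below r G) u x"
    "\<not> linked (below r G) u y" "d x y \<le> r"
    using assms(4) unfolding active_def by auto
  have na': "linked (below r F) u q" if "linked (below r F) u p" "p \<in> C" "q \<in> C" "d p q \<le> r" for p q
    using na that xy(1) unfolding active_def by auto
  have "linked (below r F) u v" if "linked (below r G) u v" for v
    using that
  proof (induction rule: linked_induct)
    case (step p q)
    then obtain e where e: "e \<in> G" "fst e \<le> r" "snd e = {p, q}" unfolding below_def by auto
    note pd = priced_edge_dist[OF assms(1,2) e(1,3)]
    show ?case using na'[OF step.IH pd(1,2)] e(2) pd(3) by simp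
  qed (rule linked_refl)
  then have "linked (below r F) u y" using na' xy by blast
  then have "linked (below r G) u y" using below_mono[OF assms(3)] by (rule linked_mono)
  then show False using xy by simp
qed

text \<open>
  Contract the supernodes: each one points to the supernode at the other end of its chosen edge, and
  two supernodes are merged iff they have a common iterate under this map. Starting from an active
  agent, all edges met when iterating cost at most \<open>r\<close> and lead to active agents.
\<close>

lemma threshold_inv_step:
  assumes "pmetric_on C d" "priced_edges C d F" "threshold_inv C d r F"
    and G: "G = F \<union> h ` components C F"
    and h: "\<And>S. S \<in> components C F \<Longrightarrow> min_cut_edge C d S (h S)"
  shows "threshold_inv C d r G"
proof -
  let ?cc = "component C F"
  have "\<forall>S\<in>components C F. \<exists>p. fst p \<in> S \<and> snd p \<in> C - S \<and> h S = (d (fst p) (snd p), {fst p, snd p}) \<and>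
      (\<forall>v\<in>S. \<forall>w\<in>C - S. d (fst p) (snd p) \<le> d v w)"
    using h unfolding min_cut_edge_def by fastforce
  from bchoice[OF this] obtain p where p: "\<forall>S\<in>components C F. fst (p S) \<in> S \<and> snd (p S) \<in> C - S \<and>
      h S = (d (fst (p S)) (snd (p S)), {fst (p S), snd (p S)}) \<and>
      (\<forall>v\<in>S. \<forall>w\<in>C - S. d (fst (p S)) (snd (p S)) \<le> d v w)" ..
  define a where "a S = fst (p S)" for S
  define b where "b S = snd (p S)" for S
  have ab: "a S \<in> S" "b S \<in> C" "b S \<notin> S" "h S = (d (a S) (b S), {a S, b S})"
    "\<And>v w. v \<in> S \<Longrightarrow> w \<in> C \<Longrightarrow> w \<notin> S \<Longrightarrow> d (a S) (b S) \<le> d v w" if "S \<in> components C F" for S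
    using p that unfolding a_def b_def by auto
  have aC: "a S \<in> C" if "S \<in> components C F" for S
    using ab(1)[OF that] components_subset[OF that] by auto
  have cc: "?cc v \<in> components C F" if "v \<in> C" for v using that unfolding components_def by auto
  have FG: "F \<subseteq> G" using G by auto
  have pG: "priced_edges C d G"
    unfolding priced_edges_def
  proof
    fix e assume "e \<in> G"
    then consider "e \<in> F" | S where "S \<in> components C F" "e = h S" using G by auto
    then show "\<exists>a\<in>C. \<exists>b\<in>C. a \<noteq> b \<and> e = (d a b, {a, b})"
    proof cases
      case 2
      then show ?thesis using ab[OF 2(1)] aC[OF 2(1)]
        by (intro bexI[of _ "a S"] bexI[of _ "b S"]) auto
    qed (use assms(2) in \<open>auto simp: priced_edges_def\<close>)
  qed
  define f where "f S = ?cc (b S)" for S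
  \<comment> \<open>Each edge of a walk in \<open>G\<close> stays in a supernode, follows a pointer,
    or runs against one. The last two cases apply \<open>f\<close> once more on the side of
    \<open>u\<close> and on the side of the end of the walk, respectively.\<close>
  have common: "v \<in> C \<and> (\<exists>m n. (f ^^ m) (?cc u) = (f ^^ n) (?cc v))"
    if "linked G u v" "u \<in> C" for u v
    using that(1)
  proof (induction rule: linked_induct)
    case refl
    show ?case using that(2) by auto
  next
    case (step y z)
    then obtain m n where y: "y \<in> C" and mn: "(f ^^ m) (?cc u) = (f ^^ n) (?cc y)" by auto
    show ?case
    proof (cases "{y, z} \<in> snd ` F")
      case True
      then have l: "linked F y z" by (rule linked_step)
      then have z: "z \<in> C" using linked_in_carrier[OF assms(2) _ y] by simp
      then have "?cc y = ?cc z" using l y component_eq_iff[of y C z F] by simp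
      then show ?thesis using z mn by auto
    next
      case False
      then obtain S where S: "S \<in> components C F" "{y, z} = snd (h S)" using step.hyps(2) G by auto
      then have "y = a S \<and> z = b S \<or> y = b S \<and> z = a S" using ab(4)[OF S(1)] by (auto simp: doubleton_eq_iff)
      then show ?thesis
      proof
        assume yz: "y = a S \<and> z = b S"
        then have "?cc z = f (?cc y)" using component_eqI[OF S(1) ab(1)[OF S(1)]] unfolding f_def by simp
        then have "(f ^^ Suc m) (?cc u) = (f ^^ n) (?cc z)" using mn by (simp add: funpow_swap1)
        then show ?thesis using yz ab(2)[OF S(1)] by blast
      next
        assume yz: "y = b S \<and> z = a S"
        then have "?cc y = f (?cc z)" using component_eqI[OF S(1) ab(1)[OF S(1)]] unfolding f_def by simp
        then have "(f ^^ m) (?cc u) = (f ^^ Suc n) (?cc z)" using mn by (simp add: funpow_swap1)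
        then show ?thesis using yz aC[OF S(1)] by blast
      qed
    qed
  qed
  have hop: "active C d r F (b (?cc u)) \<and> linked (below r G) u (b (?cc u))"
    if u: "active C d r F u" for u
  proof -
    let ?S = "?cc u"
    obtain x y where xy: "u \<in> C" "x \<in> C" "y \<in> C" "linked (below r F) u x"
      "\<not> linked (below r F) u y" "d x y \<le> r"
      using u unfolding active_def by auto
    note S = cc[OF xy(1)]
    have x: "x \<in> ?S" using xy linked_mono[OF xy(4) below_subset] by (simp add: in_component_iff)
    \<comment> \<open>Otherwise \<open>y\<close> would be active through the same pair, and the
      invariant would already link \<open>u\<close> and \<open>y\<close> below the
      threshold.\<close>
    have y: "y \<notin> ?S"
    proof
      assume "y \<in> ?S"
      then have "linked F u y" by (simp add: in_component_iff)
      moreover have "\<not> linked (below r F) y x"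
        using xy(4,5) linked_sym linked_trans by metis
      then have "active C d r F y"
        using xy pmetric_onD(3)[OF assms(1), of x y] by (intro activeI[of _ _ x]) auto
      ultimately show False using u assms(3) xy(5) unfolding threshold_inv_def by blast
    qed
    have le: "d (a ?S) (b ?S) \<le> r" using ab(5)[OF S x xy(3) y] xy(6) by simp
    have nl: "\<not> linked F (a ?S) (b ?S)"
    proof
      assume "linked F (a ?S) (b ?S)"
      then have "linked F u (b ?S)" using ab(1)[OF S] linked_trans by (auto simp: in_component_iff)
      then show False using ab(2,3)[OF S] by (simp add: in_component_iff)
    qed
    then have nl': "\<not> linked (below r F) (a ?S) (b ?S)" "\<not> linked (below r F) (b ?S) (a ?S)"
      using linked_mono[OF _ below_subset] linked_sym by blast+
    have acts: "active C d r F (a ?S)" "active C d r F (b ?S)"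
      using le nl' aC[OF S] ab(2)[OF S] pmetric_onD(3)[OF assms(1), of "a ?S" "b ?S"]
      by (auto intro: activeI)
    \<comment> \<open>The inner end of the chosen edge is active too, so the invariant leads from
      \<open>u\<close> to it within the supernode by edges of cost at most \<open>r\<close>.\<close>
    have "linked F u (a ?S)" using ab(1)[OF S] by (simp add: in_component_iff)
    then have "linked (below r F) u (a ?S)"
      using u acts(1) assms(3) unfolding threshold_inv_def by blast
    then have "linked (below r G) u (a ?S)" using below_mono[OF FG] by (rule linked_mono)
    moreover have "h ?S \<in> G" using S G by simp
    then have "h ?S \<in> below r G" using le ab(4)[OF S] unfolding below_def by simp
    then have "linked (below r G) (a ?S) (b ?S)"
      unfolding ab(4)[OF S] by (rule linked_edge)
    ultimately show ?thesis using acts(2) linked_trans by blast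
  qed
  have iterate: "\<exists>y. active C d r F y \<and> ?cc y = (f ^^ m) (?cc u) \<and> linked (below r G) u y"
    if u: "active C d r F u" for u m
  proof (induction m)
    case 0
    then show ?case using u linked_refl by auto
  next
    case (Suc m)
    then obtain y where y: "active C d r F y" "?cc y = (f ^^ m) (?cc u)" "linked (below r G) u y" by blast
    have "?cc (b (?cc y)) = (f ^^ Suc m) (?cc u)" using y(2) unfolding f_def by simp
    then show ?case using hop[OF y(1)] linked_trans[OF y(3)] by blast
  qed
  show ?thesis
    unfolding threshold_inv_def
  proof (intro allI impI)
    fix u v assume "active C d r G u" "active C d r G v" and l: "linked G u v"
    then have uv: "active C d r F u" "active C d r F v"
      using active_antimono[OF assms(1) pG FG] by auto
    obtain m n where mn: "(f ^^ m) (?cc u) = (f ^^ n) (?cc v)"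
      using common[OF l] uv(1) unfolding active_def by blast
    obtain y where y: "active C d r F y" "?cc y = (f ^^ m) (?cc u)" "linked (below r G) u y"
      using iterate[OF uv(1)] by blast
    obtain z where z: "active C d r F z" "?cc z = (f ^^ n) (?cc v)" "linked (below r G) v z"
      using iterate[OF uv(2)] by blast
    have "?cc y = ?cc z" using y(2) z(2) mn by simp
    then have "linked F y z" using y(1) z(1) component_eq_iff[of y C z F] unfolding active_def by blast
    then have "linked (below r F) y z" using y(1) z(1) assms(3) unfolding threshold_inv_def by blast
    then have "linked (below r G) y z" using below_mono[OF FG] by (rule linked_mono)
    then show "linked (below r G) u v" using y(3) z(3) linked_sym linked_trans by metis
  qed
qed

text \<open>The third conjunct allows two edges for each component that has disappeared: a round
  adds at most one edge per supernode and removes at least half of the supernodes.\<close>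

definition boruvka_inv :: "nat set \<Rightarrow> dist_fun \<Rightarrow> edge set \<Rightarrow> bool" where
  "boruvka_inv C d F \<longleftrightarrow> finite F \<and> (\<forall>e\<in>F. \<exists>S\<subseteq>C. min_cut_edge C d S e) \<and>
     card F + 2 * card (components C F) \<le> 2 * card C \<and> (\<forall>r. threshold_inv C d r F)"

lemma boruvka_inv_empty: "boruvka_inv C d {}"
proof -
  have "u = v" if "linked {} u v" for u v
    using that by (induction rule: linked_induct) auto
  then have "threshold_inv C d r {}" for r
    unfolding threshold_inv_def using linked_refl by blast
  then show ?thesis unfolding boruvka_inv_def by (simp add: card_components_empty)
qed

lemma card_components_pos: "finite C \<Longrightarrow> C \<noteq> {} \<Longrightarrow> 0 < card (components C F)"
  by (simp add: components_def card_gt_0_iff)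

lemma ensures_boruvka_loop:
  assumes "finite C" "C \<noteq> {}" "pmetric_on C d" "consistent_profile C \<sigma> d" "inj_on \<tau> (all_edges C)"
    and "boruvka_inv C d F" "card (components C F) \<le> t"
  shows "ensures d (boruvka_loop t C \<sigma> \<tau> F)
    (\<lambda>F' Q. boruvka_inv C d F' \<and> card (components C F') = 1 \<and>
       (\<forall>i. real (count Q i) \<le> log 2 (real (card (components C F)))))"
  using assms(6,7)
proof (induction t arbitrary: F)
  case 0
  then show ?case using card_components_pos[OF assms(1,2), of F] by simp
next
  case (Suc t)
  let ?c = "\<lambda>F. card (components C F)"
  have pos: "0 < ?c F" for F using card_components_pos[OF assms(1,2)] .
  show ?case
  proof (cases "?c F > 1")
    case False
    then have "?c F = 1" using pos[of F] by simp
    then show ?thesis using Suc.prems(1) by (auto intro: ensures_Return)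
  next
    case True
    have "ensures d (bind_mech (boruvka_round C \<sigma> \<tau> F) (boruvka_loop t C \<sigma> \<tau>))
       (\<lambda>F' Q. boruvka_inv C d F' \<and> ?c F' = 1 \<and> (\<forall>i. real (count Q i) \<le> log 2 (real (?c F))))"
    proof (rule ensures_bind[OF ensures_boruvka_round[OF assms(1,4,5) True]])
      fix G and Q :: "nat multiset"
      assume "(\<exists>h. G = F \<union> h ` components C F \<and> (\<forall>S\<in>components C F. min_cut_edge C d S (h S))) \<and>
        (\<forall>i. count Q i \<le> 1)"
      then obtain h where G: "G = F \<union> h ` components C F"
        and h: "\<And>S. S \<in> components C F \<Longrightarrow> min_cut_edge C d S (h S)" and Q: "\<And>i. count Q i \<le> 1"
        by auto
      note inv = Suc.prems(1)[unfolded boruvka_inv_def]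
      have pF: "priced_edges C d F" using inv by (intro priced_edges_min_cut) auto
      have half: "2 * ?c G \<le> ?c F"
      proof (rule card_components_halve[OF assms(1)])
        show "F \<subseteq> G" using G by auto
        fix v assume v: "v \<in> C"
        let ?S = "component C F v"
        have S: "?S \<in> components C F" using v unfolding components_def by auto
        obtain a b where ab: "a \<in> ?S" "b \<in> C" "b \<notin> ?S" "h ?S = (d a b, {a, b})"
          using h[OF S] unfolding min_cut_edge_def by auto
        have "h ?S \<in> G" using S G by auto
        then have "linked G a b" unfolding ab(4) by (rule linked_edge)
        moreover have "linked G v a"
          using ab(1) G linked_mono[of F v a G] by (auto simp: in_component_iff)
        ultimately show "\<exists>u\<in>C. linked G v u \<and> \<not> linked F v u"
          using ab(2,3) linked_trans[of G v a b] by (auto simp: in_component_iff)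
      qed
      have "card G \<le> card F + card (h ` components C F)" unfolding G by (rule card_Un_le)
      also have "\<dots> \<le> card F + ?c F"
        using card_image_le[OF finite_components[OF assms(1)], of h F] by simp
      finally have "card G + 2 * ?c G \<le> 2 * card C" using inv half by linarith
      moreover have "\<exists>S\<subseteq>C. min_cut_edge C d S e" if eG: "e \<in> G" for e
      proof -
        consider "e \<in> F" | S where "S \<in> components C F" "e = h S" using eG G by blast
        then show ?thesis
        proof cases
          case 2
          then show ?thesis using h[OF 2(1)] components_subset[OF 2(1)] by auto
        qed (use inv in auto)
      qed
      moreover have "threshold_inv C d r G" for r
        using threshold_inv_step[OF assms(3) pF _ G h] inv by blast
      moreover have "finite G" using inv G finite_components[OF assms(1)] by auto
      ultimately have invG: "boruvka_inv C d G" unfolding boruvka_inv_def by blast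
      have "1 + log 2 (real (?c G)) = log 2 (2 * real (?c G))" using pos[of G] by (simp add: log_mult)
      also have "\<dots> \<le> log 2 (real (?c F))" using half pos[of G] by simp
      finally have log: "1 + log 2 (real (?c G)) \<le> log 2 (real (?c F))" .
      have "?c G \<le> t" using half pos[of G] Suc.prems(2) by linarith
      show "ensures d (boruvka_loop t C \<sigma> \<tau> G)
         (\<lambda>F' Q'. boruvka_inv C d F' \<and> ?c F' = 1 \<and> (\<forall>i. real (count (Q + Q') i) \<le> log 2 (real (?c F))))"
      proof (rule ensures_mono[OF Suc.IH[OF invG \<open>?c G \<le> t\<close>]], intro conjI allI)
        fix F' and Q' :: "nat multiset" and i
        assume *: "boruvka_inv C d F' \<and> ?c F' = 1 \<and> (\<forall>i. real (count Q' i) \<le> log 2 (real (?c G)))"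
        then show "boruvka_inv C d F'" "?c F' = 1" by auto
        have "real (count Q i) \<le> 1" using Q[of i] by simp
        moreover have "real (count Q' i) \<le> log 2 (real (?c G))" using * by blast
        ultimately show "real (count (Q + Q') i) \<le> log 2 (real (?c F))" using log by simp
      qed
    qed
    then show ?thesis using True by simp
  qed
qed

lemma linked_if_one_component:
  assumes "card (components C F) = 1" "u \<in> C" "v \<in> C"
  shows "linked F u v"
proof -
  obtain K where "components C F = {K}" using assms(1) card_1_singletonE by blast
  then have "component C F u = K" "component C F v = K" using assms(2,3) unfolding components_def by auto
  then show ?thesis using assms(2,3) component_eq_iff[of u C v F] by simp
qed

text \<open>If the pair were not linked below \<open>r\<close>, both ends would be active; as the
  final edge set links everything, the invariant links them below \<open>r\<close> after all. This
  is the bottleneck-path property of minimum spanning trees.\<close>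

lemma boruvka_inv_threshold:
  assumes "pmetric_on C d" "boruvka_inv C d F" "card (components C F) = 1"
    and "x \<in> C" "y \<in> C" "d x y \<le> r"
  shows "linked (below r F) x y"
proof (rule ccontr)
  assume n: "\<not> linked (below r F) x y"
  then have "\<not> linked (below r F) y x" using linked_sym by blast
  then have "active C d r F x" "active C d r F y"
    using n assms(4-6) pmetric_onD(3)[OF assms(1), of x y] by (auto intro: activeI)
  then show False
    using n assms(2) linked_if_one_component[OF assms(3-5)]
    unfolding boruvka_inv_def threshold_inv_def by blast
qed

section \<open>Pruning to \<open>k\<close> components\<close>

lemma drop_costliest_power:
  assumes "finite F" "priced_edges C d F" "inj_on \<tau> (all_edges C)"
  shows "(drop_costliest \<tau> ^^ m) F \<subseteq> F \<and> card ((drop_costliest \<tau> ^^ m) F) = card F - m \<and>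
    (\<forall>e\<in>F - (drop_costliest \<tau> ^^ m) F. \<forall>e'\<in>(drop_costliest \<tau> ^^ m) F. fst e' \<le> fst e)"
proof (induction m)
  case (Suc m)
  let ?D = "(drop_costliest \<tau> ^^ m) F"
  show ?case
  proof (cases "?D = {}")
    case True
    have "(drop_costliest \<tau> ^^ Suc m) F = drop_costliest \<tau> ?D" by simp
    also have "\<dots> = {}" unfolding True by (simp add: drop_costliest_def)
    finally show ?thesis using Suc True by simp
  next
    case False
    have D: "finite ?D" "priced_edges C d ?D"
      using Suc finite_subset[OF _ assms(1), of ?D] priced_edges_subset[OF assms(2), of ?D] by auto
    note c = costliest[OF D(1) False D(2) assms(3)]
    have eq: "(drop_costliest \<tau> ^^ Suc m) F = ?D - {costliest \<tau> ?D}"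
      by (simp only: funpow.simps comp_apply drop_costliest_def[of \<tau> ?D])
    have "card (?D - {costliest \<tau> ?D}) = card F - Suc m" using Suc c(1) D(1) by simp
    moreover have "fst e' \<le> fst e" if "e \<in> F - (?D - {costliest \<tau> ?D})" "e' \<in> ?D - {costliest \<tau> ?D}" for e e'
    proof (cases "e \<in> ?D")
      case True
      then have "e = costliest \<tau> ?D" using that(1) by blast
      then show ?thesis using c(2)[of e'] that(2) by simp
    qed (use that Suc in auto)
    ultimately show ?thesis unfolding eq using Suc by auto
  qed
qed auto

text \<open>The number of components starts at 1, ends at \<open>card C\<close> and rises by at most
  one per removed edge, so the value \<open>k\<close> is met. Because of possible cycles a removal
  may leave it unchanged, so the number of removals is not known beforehand.\<close>

lemma prune:
  assumes "finite C" "finite F" "priced_edges C d F" "inj_on \<tau> (all_edges C)"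
    and "card (components C F) = 1" "1 \<le> k" "k \<le> card C"
  shows "prune C k \<tau> F \<subseteq> F" "card (components C (prune C k \<tau> F)) = k"
    "\<And>e e'. e \<in> F - prune C k \<tau> F \<Longrightarrow> e' \<in> prune C k \<tau> F \<Longrightarrow> fst e' \<le> fst e"
proof -
  let ?D = "\<lambda>m. (drop_costliest \<tau> ^^ m) F"
  let ?c = "\<lambda>m. card (components C (?D m))"
  note D = drop_costliest_power[OF assms(2-4)]
  have Dsuc: "?D (Suc m) = ?D m - {costliest \<tau> (?D m)}" for m
    by (simp only: funpow.simps comp_apply drop_costliest_def[of \<tau> "?D m"])
  have step: "?c (Suc m) \<le> Suc (?c m)" for m
  proof (cases "?D m = {}")
    case True
    then show ?thesis unfolding Dsuc by simp
  next
    case False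
    have Dm: "finite (?D m)" "priced_edges C d (?D m)"
      using D[of m] finite_subset[OF _ assms(2), of "?D m"] priced_edges_subset[OF assms(3), of "?D m"] by auto
    have "costliest \<tau> (?D m) \<in> ?D m" using costliest(1)[OF Dm(1) False Dm(2) assms(4)] .
    then have "\<exists>a\<in>C. \<exists>b\<in>C. a \<noteq> b \<and> costliest \<tau> (?D m) = (d a b, {a, b})"
      using Dm(2) unfolding priced_edges_def by (rule bspec[rotated])
    then obtain a b where ab: "a \<in> C" "b \<in> C" "costliest \<tau> (?D m) = (d a b, {a, b})" by auto
    have "snd ` X \<subseteq> insert (snd e) (snd ` (X - {e}))" for X :: "edge set" and e by auto
    from this[of "?D m" "costliest \<tau> (?D m)"]
    have "?D (Suc m) \<subseteq> ?D m" "snd ` ?D m \<subseteq> insert {a, b} (snd ` ?D (Suc m))"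
      unfolding Dsuc ab(3) snd_conv by blast+
    then show ?thesis
      using card_components_remove_edge[OF assms(1), of "?D (Suc m)" "?D m" a b] ab(1,2) by simp
  qed
  have "card (?D (card F)) = 0" "finite (?D (card F))"
    using D[of "card F"] finite_subset[OF _ assms(2), of "?D (card F)"] by auto
  then have ex: "k \<le> ?c (card F)" using assms(7) card_components_empty by simp
  \<comment> \<open>The first \<open>m\<close> with at least \<open>k\<close> components has exactly
    \<open>k\<close> by the step bound; it is a witness for the \<open>LEAST\<close> in
    \<open>prune\<close>.\<close>
  define m where "m = (LEAST m. k \<le> ?c m)"
  have m: "k \<le> ?c m" unfolding m_def using ex by (rule LeastI)
  have "?c m = k"
  proof (cases m)
    case 0
    then show ?thesis using m assms(5,6) by simp
  next
    case (Suc p)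
    then have "\<not> k \<le> ?c p" unfolding m_def by (intro not_less_Least) simp
    then show ?thesis using m step[of p] Suc by simp
  qed
  then have "?c (LEAST m. ?c m = k) = k" by (rule LeastI)
  then show "card (components C (prune C k \<tau> F)) = k" unfolding prune_def .
  show "prune C k \<tau> F \<subseteq> F" using D unfolding prune_def by auto
  show "fst e' \<le> fst e" if "e \<in> F - prune C k \<tau> F" "e' \<in> prune C k \<tau> F" for e e'
    using D[of "LEAST m. ?c m = k"] that unfolding prune_def by auto
qed

text \<open>Suppose the largest remaining cost \<open>t\<close> exceeds \<open>r\<close>. Pruning
  kept the set \<open>L\<close> of all edges cheaper than \<open>t\<close>. A remaining edge of cost
  \<open>t\<close> crosses a cut that no member of \<open>L\<close> crosses, so \<open>L\<close> has
  more than \<open>k\<close> components. But \<open>L\<close> contains all edges of cost at most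
  \<open>r\<close>, which link every agent to a nearest center in \<open>T\<close>, so it has at
  most \<open>card T\<close> components.\<close>

lemma pruned_edge_le_radius:
  assumes "finite C" "pmetric_on C d" "boruvka_inv C d F" "card (components C F) = 1"
    and "inj_on \<tau> (all_edges C)" "1 \<le> k" "k \<le> card C"
    and "T \<subseteq> C" "T \<noteq> {}" "card T \<le> k" "\<And>i. i \<in> C \<Longrightarrow> set_dist d i T \<le> r"
    and "e \<in> prune C k \<tau> F"
  shows "fst e \<le> r"
proof (rule ccontr)
  let ?P = "prune C k \<tau> F"
  have fin: "finite F" and cut: "\<And>e. e \<in> F \<Longrightarrow> \<exists>S\<subseteq>C. min_cut_edge C d S e"
    using assms(3) unfolding boruvka_inv_def by auto
  have pF: "priced_edges C d F" using cut by (rule priced_edges_min_cut)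
  note pr = prune[OF assms(1) fin pF assms(5,4,6,7)]
  assume "\<not> fst e \<le> r"
  have ex: "?P \<noteq> {}" "finite ?P" using assms(12) fin finite_subset[OF pr(1)] by auto
  define t where "t = Max (fst ` ?P)"
  have tmax: "fst e' \<le> t" if "e' \<in> ?P" for e' using ex that unfolding t_def by simp
  have "t \<in> fst ` ?P" using ex unfolding t_def by (intro Max_in) auto
  then obtain e0 where e0: "e0 \<in> ?P" "fst e0 = t" by auto
  have "r < t" using tmax[OF assms(12)] \<open>\<not> fst e \<le> r\<close> by simp
  define L where "L = {e \<in> F. fst e < t}"
  have LP: "L \<subseteq> ?P" using pr(3)[OF _ e0(1)] e0(2) unfolding L_def by fastforce
  obtain S a b where S: "S \<subseteq> C" "a \<in> S" "b \<in> C" "b \<notin> S" "e0 = (d a b, {a, b})"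
    "\<And>v w. v \<in> S \<Longrightarrow> w \<in> C \<Longrightarrow> w \<notin> S \<Longrightarrow> d a b \<le> d v w"
    using cut[of e0] e0(1) pr(1) unfolding min_cut_edge_def by blast
  have aC: "a \<in> C" using S by auto
  have tab: "t = d a b" using S(5) e0(2) by simp
  have "\<not> linked L a b"
  proof
    assume "linked L a b"
    then have "b \<in> S" using S(2)
    proof (rule linked_closed)
      fix p q assume "{p, q} \<in> snd ` L" and p: "p \<in> S"
      then obtain e' where e': "e' \<in> L" "snd e' = {p, q}" by auto
      then have e'F: "e' \<in> F" "fst e' < t" unfolding L_def by auto
      note pd = priced_edge_dist[OF assms(2) pF e'F(1) e'(2)]
      show "q \<in> S" using S(6)[OF p pd(2)] e'F(2) pd(3) tab by linarith
    qed
    then show False using S(4) by simp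
  qed
  moreover have "linked ?P a b" using e0(1) unfolding S(5) by (rule linked_edge)
  ultimately have "card (components C ?P) < card (components C L)"
    using card_components_strict[OF assms(1) LP aC S(3)] by blast
  moreover have "card (components C L) \<le> card T"
  proof (rule card_components_le_hitting)
    show finT: "finite T" using assms(1,8) finite_subset by blast
    fix v assume v: "v \<in> C"
    obtain s where s: "s \<in> T" "set_dist d v T = d v s" using set_dist_attained[OF finT assms(9)] .
    then have "linked (below r F) v s"
      using assms(8) assms(11)[OF v] v by (intro boruvka_inv_threshold[OF assms(2-4)]) auto
    moreover have "below r F \<subseteq> L" using \<open>r < t\<close> unfolding below_def L_def by auto
    ultimately show "\<exists>s\<in>T. s \<in> C \<and> linked L v s" using s(1) assms(8) linked_mono by blast
  qed
  ultimately show False using pr(2) assms(10) by simp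
qed

text \<open>The upper bound on \<open>B\<close> has the factor 2 because of possible cycles.\<close>

definition boruvka_result :: "nat set \<Rightarrow> nat \<Rightarrow> dist_fun \<Rightarrow> real \<Rightarrow> edge set \<Rightarrow> bool" where
  "boruvka_result C k d B F \<longleftrightarrow>
     B = real (card C) * (\<Sum>e\<in>F. fst e) \<and> finite F \<and> priced_edges C d F \<and> card (components C F) = k \<and>
     (\<forall>T r. T \<subseteq> C \<longrightarrow> T \<noteq> {} \<longrightarrow> card T \<le> k \<longrightarrow> (\<forall>i\<in>C. set_dist d i T \<le> r) \<longrightarrow> 0 \<le> r \<longrightarrow>
        B \<le> 2 * (real (card C))\<^sup>2 * r)"

lemma ensures_boruvka:
  assumes "finite C" "pmetric_on C d" "consistent_profile C \<sigma> d" "inj_on \<tau> (all_edges C)"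
    and "1 \<le> k" "k \<le> card C"
  shows "ensures d (boruvka C k \<sigma> \<tau>)
    (\<lambda>r Q. boruvka_result C k d (fst r) (snd r) \<and> (\<forall>i. real (count Q i) \<le> log 2 (real (card C))))"
proof -
  have ne: "C \<noteq> {}" using assms by auto
  have "card (components C {}) \<le> card C" by (simp add: card_components_empty)
  note loop = ensures_boruvka_loop[OF assms(1) ne assms(2-4) boruvka_inv_empty this]
  show ?thesis unfolding boruvka_def Let_def
  proof (rule ensures_bind[OF loop])
    fix F and Q :: "nat multiset"
    assume F: "boruvka_inv C d F \<and> card (components C F) = 1 \<and>
      (\<forall>i. real (count Q i) \<le> log 2 (real (card (components C {}))))"
    let ?P = "prune C k \<tau> F"
    have fin: "finite F" and pF: "priced_edges C d F" and cF: "card F \<le> 2 * card C"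
      using F unfolding boruvka_inv_def by (auto intro: priced_edges_min_cut)
    have F1: "card (components C F) = 1" using F by auto
    note pr = prune[OF assms(1) fin pF assms(4) F1 assms(5,6)]
    have le: "real (card C) * sum fst ?P \<le> 2 * (real (card C))\<^sup>2 * r"
      if T: "T \<subseteq> C" "T \<noteq> {}" "card T \<le> k" "\<forall>i\<in>C. set_dist d i T \<le> r" "0 \<le> r" for T r
    proof -
      have "fst e \<le> r" if "e \<in> ?P" for e
        using pruned_edge_le_radius[OF assms(1,2) _ F1 assms(4-6) T(1-3) _ that] F T(4) by auto
      then have "sum fst ?P \<le> real (card ?P) * r" by (rule sum_bounded_above)
      also have "\<dots> \<le> (2 * real (card C)) * r"
        using card_mono[OF fin pr(1)] cF T(5) by (intro mult_right_mono) auto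
      finally have "real (card C) * sum fst ?P \<le> real (card C) * ((2 * real (card C)) * r)"
        by (rule mult_left_mono) simp
      then show ?thesis by (simp add: power2_eq_square mult_ac)
    qed
    have "boruvka_result C k d (real (card C) * sum fst ?P) ?P"
      using finite_subset[OF pr(1) fin] priced_edges_subset[OF pF pr(1)] pr(2) le
      unfolding boruvka_result_def by blast
    then show "ensures d (Return (real (card C) * sum fst ?P, ?P))
      (\<lambda>r Q'. boruvka_result C k d (fst r) (snd r) \<and> (\<forall>i. real (count (Q + Q') i) \<le> log 2 (real (card C))))"
      using F by (intro ensures_Return) (simp add: card_components_empty)
  qed
qed

section \<open>Meyerson on a random order\<close>

definition random_order_mean :: "'a set \<Rightarrow> ('a list \<Rightarrow> real) \<Rightarrow> real" where
  "random_order_mean U h = measure_pmf.expectation (pmf_of_set (permutations_of_set U)) h"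

lemma random_order_mean_empty: "random_order_mean {} h = h []"
  by (simp add: random_order_mean_def pmf_of_set_singleton)

lemma integrable_permutations:
  fixes h :: "'a list \<Rightarrow> real"
  assumes "finite U"
  shows "integrable (pmf_of_set (permutations_of_set U)) h"
  using assms by (intro integrable_measure_pmf_finite) simp

text \<open>The first agent is uniform in \<open>U\<close>, and the rest is a uniformly random order
  of the others. Hence a potential may depend on the set of agents to come without knowing their
  order.\<close>

lemma random_order_mean_rec:
  assumes "finite U" "U \<noteq> {}"
  shows "random_order_mean U h = (\<Sum>x\<in>U. random_order_mean (U - {x}) (\<lambda>xs. h (x # xs))) / real (card U)"
proof -
  have "random_order_mean U h = (\<Sum>x\<in>U. measure_pmf.expectation
      (bind_pmf (pmf_of_set (permutations_of_set (U - {x}))) (\<lambda>xs. return_pmf (x # xs))) h /\<^sub>R real (card U))"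
    unfolding random_order_mean_def random_permutation_of_set[OF assms]
    using assms by (subst pmf_expectation_bind_pmf_of_set) auto
  then show ?thesis
    by (simp add: random_order_mean_def divide_inverse sum_distrib_left mult.commute flip: map_pmf_def)
qed

lemma random_order_mean_add:
  "finite U \<Longrightarrow> random_order_mean U (\<lambda>xs. h xs + h' xs) = random_order_mean U h + random_order_mean U h'"
  unfolding random_order_mean_def by (intro Bochner_Integration.integral_add integrable_permutations)

lemma random_order_mean_const: "random_order_mean U (\<lambda>_. c) = c"
  by (simp add: random_order_mean_def)

lemma random_order_mean_cmult: "random_order_mean U (\<lambda>xs. c * h xs) = c * random_order_mean U h"
  by (simp add: random_order_mean_def)

lemma random_order_mean_mono:
  assumes "finite U" "\<And>xs. set xs = U \<Longrightarrow> distinct xs \<Longrightarrow> h xs \<le> h' xs"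
  shows "random_order_mean U h \<le> random_order_mean U h'"
  unfolding random_order_mean_def
  using assms by (intro integral_mono_AE integrable_permutations)
    (auto simp: AE_measure_pmf_iff permutations_of_set_empty_iff dest: permutations_of_setD)

section \<open>Expected outlay of a run as a recursion over the arrivals\<close>

locale meyerson_guess =
  fixes C :: "nat set" and d :: dist_fun and k l :: nat and B :: real and Z :: "nat set"
  assumes fin: "finite C" and pm: "pmetric_on C d" and k: "1 \<le> k" and l: "1 \<le> l" and B: "0 < B"
    and Z: "Z \<subseteq> C" "Z \<noteq> {}" "card Z \<le> k" and guess: "Top_on l C (\<lambda>i. set_dist d i Z) \<le> B"
begin

text \<open>The two units of the analysis, both normalized by the guess: \<open>l\<close> times
  \<open>thr\<close> is \<open>B\<close>, and so is \<open>k\<close> times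
  \<open>fee\<close>.\<close>

definition thr :: real where "thr = B / real l"
definition fee :: real where "fee = B / real k"

definition exc :: "nat set \<Rightarrow> nat \<Rightarrow> real" where
  "exc S x = max (set_dist d x S - 3 * thr) 0"

definition prob_open :: "nat set \<Rightarrow> nat \<Rightarrow> real" where
  "prob_open S x = min 1 (exc S x / fee)"

text \<open>The expected final value of \<open>W\<close>, and the expected total price \<open>min (exc S x) fee\<close> of all steps.\<close>

fun mean_after :: "(nat set \<Rightarrow> real) \<Rightarrow> nat set \<Rightarrow> nat list \<Rightarrow> real" where
  "mean_after W S [] = W S"
| "mean_after W S (x # xs) = prob_open S x * mean_after W (insert x S) xs + (1 - prob_open S x) * mean_after W S xs"

fun pay :: "nat set \<Rightarrow> nat list \<Rightarrow> real" where
  "pay S [] = 0"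
| "pay S (x # xs) = min (exc S x) fee + (prob_open S x * pay (insert x S) xs + (1 - prob_open S x) * pay S xs)"

lemma thr_pos: "0 < thr" and fee_pos: "0 < fee"
  using B k l by (auto simp: thr_def fee_def)

lemmas met = pmetric_onD[OF pm]

lemma exc_nonneg: "0 \<le> exc S x"
  by (simp add: exc_def)

lemma prob_open_01: "0 \<le> prob_open S x" "prob_open S x \<le> 1"
  using fee_pos exc_nonneg[of S x] by (auto simp: prob_open_def)

lemma prob_open_times: "prob_open S x * fee = min (exc S x) fee"
  using fee_pos by (auto simp: prob_open_def min_def field_simps)

text \<open>By \<open>prob_open_times\<close>, an arrival costs \<open>min (exc S x) fee\<close> in
  expectation for opening. Staying closed costs at most the same again, hence the factor 2 in
  \<open>mean_after_le\<close>.\<close>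

lemma exc_if_not_opened: "(1 - prob_open S x) * exc S x \<le> min (exc S x) fee"
proof (cases "exc S x \<le> fee")
  case True
  then show ?thesis using exc_nonneg[of S x] prob_open_01[of S x] by (simp add: mult_left_le_one_le)
next
  case False
  then have "prob_open S x = 1" using fee_pos by (simp add: prob_open_def field_simps)
  then show ?thesis using fee_pos exc_nonneg[of S x] by simp
qed

lemma set_dist_triangle:
  assumes "S \<subseteq> C" "S \<noteq> {}" "x \<in> C" "y \<in> C"
  shows "set_dist d x S \<le> d x y + set_dist d y S"
proof -
  have finS: "finite S" using finite_subset[OF assms(1) fin] .
  obtain a where a: "a \<in> S" "set_dist d y S = d y a" using set_dist_attained[OF finS assms(2)] .
  have "set_dist d x S \<le> d x a" using finS a(1) by (rule set_dist_le)
  also have "\<dots> \<le> d x y + d y a" using met(4)[of x y a] assms a by auto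
  finally show ?thesis using a(2) by simp
qed

lemma exc_antimono:
  assumes "S \<subseteq> S'" "S' \<subseteq> C" "S \<noteq> {}"
  shows "exc S' x \<le> exc S x"
  using set_dist_antimono[OF finite_subset[OF assms(2) fin] assms(1,3), of d x] by (auto simp: exc_def)

lemma exc_opened:
  assumes "S \<subseteq> C" "x \<in> C" "x \<in> S"
  shows "exc S x = 0"
  using set_dist_le[OF finite_subset[OF assms(1) fin] assms(3), of d x] met(1)[OF assms(2)] thr_pos
  by (auto simp: exc_def)

text \<open>\<open>ys\<close> are the agents already served. The final value contains their
  connection costs, which can only fall as centers are added, so charging them on arrival is
  safe.\<close>

lemma mean_after_le:
  assumes "S \<subseteq> C" "S \<noteq> {}" "set xs \<subseteq> C"
  shows "mean_after (\<lambda>S'. fee * real (card S') + (\<Sum>x\<leftarrow>ys @ xs. exc S' x)) S xs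
    \<le> fee * real (card S) + (\<Sum>x\<leftarrow>ys. exc S x) + 2 * pay S xs"
  using assms
proof (induction xs arbitrary: S ys)
  case Nil
  then show ?case by simp
next
  case (Cons x xs)
  let ?W = "\<lambda>S'. fee * real (card S') + (\<Sum>x\<leftarrow>ys @ x # xs. exc S' x)"
  let ?p = "prob_open S x"
  let ?S = "insert x S"
  have S: "?S \<subseteq> C" using Cons.prems by auto
  have finS: "finite S" using Cons.prems fin finite_subset by auto
  have "mean_after ?W ?S xs \<le> fee * real (card ?S) + (\<Sum>x\<leftarrow>ys @ [x]. exc ?S x) + 2 * pay ?S xs"
    using Cons.IH[of ?S "ys @ [x]"] Cons.prems by simp
  also have "\<dots> \<le> fee * real (card S) + fee + (\<Sum>x\<leftarrow>ys. exc S x) + 2 * pay ?S xs"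
  proof -
    have "fee * real (card ?S) \<le> fee * (real (card S) + 1)"
      using fee_pos finS by (intro mult_left_mono) (auto simp: card_insert_if)
    moreover have "(\<Sum>x\<leftarrow>ys. exc ?S x) \<le> (\<Sum>x\<leftarrow>ys. exc S x)"
      using exc_antimono[OF _ S Cons.prems(2)] by (intro sum_list_mono) auto
    moreover have "exc ?S x = 0" using exc_opened[OF S] Cons.prems by auto
    ultimately show ?thesis by (simp add: distrib_left)
  qed
  finally have opened: "?p * mean_after ?W ?S xs
      \<le> ?p * (fee * real (card S) + fee + (\<Sum>x\<leftarrow>ys. exc S x) + 2 * pay ?S xs)"
    using prob_open_01 by (intro mult_left_mono)
  have "mean_after ?W S xs \<le> fee * real (card S) + (\<Sum>x\<leftarrow>ys @ [x]. exc S x) + 2 * pay S xs"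
    using Cons.IH[of S "ys @ [x]"] Cons.prems by simp
  then have closed: "(1 - ?p) * mean_after ?W S xs
      \<le> (1 - ?p) * (fee * real (card S) + (\<Sum>x\<leftarrow>ys. exc S x) + exc S x + 2 * pay S xs)"
    using prob_open_01[of S x] by (intro mult_left_mono) auto
  have "mean_after ?W S (x # xs) \<le> fee * real (card S) + (\<Sum>x\<leftarrow>ys. exc S x)
      + ?p * fee + (1 - ?p) * exc S x + 2 * (?p * pay ?S xs + (1 - ?p) * pay S xs)"
    using opened closed by (simp add: algebra_simps)
  also have "\<dots> \<le> fee * real (card S) + (\<Sum>x\<leftarrow>ys. exc S x) + 2 * pay S (x # xs)"
    using exc_if_not_opened[of S x] prob_open_times[of S x] by simp
  finally show ?case .
qed

text \<open>The supermartingale argument: if the price of the next arrival plus the expected new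
  potential is at most the old potential, on average over a uniformly random next agent, then the
  initial potential bounds the expected total price.\<close>

lemma mean_pay_le_potential:
  assumes base: "\<And>S. 0 \<le> \<Phi> S {}"
    and step: "\<And>S U. S \<subseteq> C \<Longrightarrow> S \<noteq> {} \<Longrightarrow> U \<subseteq> C \<Longrightarrow> U \<noteq> {} \<Longrightarrow>
      (\<Sum>x\<in>U. min (exc S x) fee + (prob_open S x * \<Phi> (insert x S) (U - {x}) + (1 - prob_open S x) * \<Phi> S (U - {x})))
        \<le> real (card U) * \<Phi> S U"
    and "S \<subseteq> C" "S \<noteq> {}" "U \<subseteq> C"
  shows "random_order_mean U (pay S) \<le> \<Phi> S U"
proof -
  have "finite U" using assms(5) fin finite_subset by blast
  then show ?thesis using assms(3-5)
  proof (induction U arbitrary: S rule: finite_psubset_induct)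
    case (psubset U)
    show ?case
    proof (cases "U = {}")
      case True
      then show ?thesis using base by (simp add: random_order_mean_empty)
    next
      case False
      have "random_order_mean U (pay S) * real (card U)
          = (\<Sum>x\<in>U. random_order_mean (U - {x}) (\<lambda>xs. pay S (x # xs)))"
        using random_order_mean_rec[OF psubset.hyps False, of "pay S"] psubset.hyps False by simp
      also have "\<dots> = (\<Sum>x\<in>U. min (exc S x) fee + (prob_open S x * random_order_mean (U - {x}) (pay (insert x S))
          + (1 - prob_open S x) * random_order_mean (U - {x}) (pay S)))"
        using psubset.hyps
        by (simp add: random_order_mean_add random_order_mean_const random_order_mean_cmult)
      also have "\<dots> \<le> (\<Sum>x\<in>U. min (exc S x) fee + (prob_open S x * \<Phi> (insert x S) (U - {x})
          + (1 - prob_open S x) * \<Phi> S (U - {x})))"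
      proof (intro sum_mono add_mono mult_left_mono order_refl)
        fix x assume x: "x \<in> U"
        have sub: "U - {x} \<subset> U" "U - {x} \<subseteq> C" using x psubset.prems by auto
        show "random_order_mean (U - {x}) (pay (insert x S)) \<le> \<Phi> (insert x S) (U - {x})"
          using psubset.IH[OF sub(1) _ _ sub(2), of "insert x S"] psubset.prems x by auto
        show "random_order_mean (U - {x}) (pay S) \<le> \<Phi> S (U - {x})"
          using psubset.IH[OF sub(1) _ _ sub(2), of S] psubset.prems by auto
      qed (use prob_open_01 in auto)
      also have "\<dots> \<le> real (card U) * \<Phi> S U" using psubset.prems False by (intro step) auto
      finally show ?thesis using psubset.hyps False by (simp add: mult.commute card_gt_0_iff)
    qed
  qed
qed

end

section \<open>Clusters of the comparison solution and their potentials\<close>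

context meyerson_guess
begin

lemma Z_fin: "finite Z"
  using Z(1) fin finite_subset by blast

definition ctr :: "nat \<Rightarrow> nat" where
  "ctr x = (SOME c. c \<in> Z \<and> set_dist d x Z = d x c)"

text \<open>Since \<open>B\<close> bounds the sum of the \<open>l\<close> largest distances, the
  remainders beyond \<open>thr\<close> sum to at most \<open>B\<close> over all agents, which the
  distances themselves need not do.\<close>

definition rem :: "nat \<Rightarrow> real" where
  "rem x = max (set_dist d x Z - thr) 0"

definition cluster :: "nat \<Rightarrow> nat set" where
  "cluster c = {x \<in> C. ctr x = c}"

definition avg :: "nat \<Rightarrow> real" where
  "avg c = sum rem (cluster c) / real (card (cluster c))"

text \<open>The factor 2 makes at least half of a cluster core, by Markov's inequality, while one
  open core agent still serves the whole cluster well (\<open>price_if_core_open\<close>).\<close>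

definition core :: "nat \<Rightarrow> nat set" where
  "core c = {x \<in> cluster c. rem x \<le> 2 * avg c}"

definition rim :: "nat \<Rightarrow> nat set" where
  "rim c = cluster c - core c"

lemma ctr: "ctr x \<in> Z" "set_dist d x Z = d x (ctr x)"
proof -
  have "\<exists>c. c \<in> Z \<and> set_dist d x Z = d x c"
    using set_dist_attained[OF Z_fin Z(2), of d x] by metis
  from someI_ex[OF this] show "ctr x \<in> Z" "set_dist d x Z = d x (ctr x)"
    unfolding ctr_def by auto
qed

lemma rem_nonneg: "0 \<le> rem x"
  by (simp add: rem_def)

lemma avg_nonneg: "0 \<le> avg c"
  by (simp add: avg_def sum_nonneg rem_nonneg)

lemma cluster_fin: "finite (cluster c)" "cluster c \<subseteq> C" "finite (core c)" "finite (rim c)"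
  "core c \<subseteq> cluster c" "rim c \<subseteq> cluster c"
  using fin by (auto simp: cluster_def core_def rim_def)

lemma avg_times_card: "avg c * real (card (cluster c)) = sum rem (cluster c)"
  using cluster_fin(1)[of c] by (auto simp: avg_def card_eq_0_iff)

lemma dist_to_center: "x \<in> cluster c \<Longrightarrow> d x c \<le> rem x + thr"
  using ctr(2)[of x] by (auto simp: cluster_def rem_def)

text \<open>Markov's inequality within a cluster.\<close>

lemma card_rim_le_core: "card (rim c) \<le> card (core c)"
proof -
  have split: "card (cluster c) = card (core c) + card (rim c)"
    unfolding rim_def using cluster_fin by (simp add: card_Diff_subset card_mono)
  have "real (card (rim c)) * (2 * avg c) \<le> sum rem (rim c)"
    by (intro sum_bounded_below) (auto simp: rim_def core_def)
  also have "\<dots> \<le> sum rem (cluster c)"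
    using cluster_fin rem_nonneg by (intro sum_mono2) auto
  also have "\<dots> = avg c * real (card (cluster c))" by (rule avg_times_card[symmetric])
  finally have le: "avg c * (2 * real (card (rim c))) \<le> avg c * real (card (cluster c))"
    by (simp add: mult_ac)
  show ?thesis
  proof (cases "avg c = 0")
    case True
    then have "sum rem (cluster c) = 0" using avg_times_card[of c] by simp
    then have "\<forall>x\<in>cluster c. rem x = 0"
      using cluster_fin(1) rem_nonneg by (simp add: sum_nonneg_eq_0_iff)
    then have "rim c = {}" using True by (auto simp: rim_def core_def)
    then show ?thesis by simp
  next
    case False
    then have "2 * real (card (rim c)) \<le> real (card (cluster c))"
      using le avg_nonneg[of c] by (simp add: mult_le_cancel_left)
    then show ?thesis using split by simp
  qed
qed

lemma sum_rem_clusters: "(\<Sum>c\<in>Z. sum rem (cluster c)) \<le> B"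
proof -
  have "(\<Sum>c\<in>Z. sum rem (cluster c)) = sum rem C"
    unfolding cluster_def using sum.group[OF fin Z_fin, of ctr rem] ctr(1) by auto
  also have "\<dots> \<le> B"
    unfolding rem_def thr_def
    using fin l guess set_dist_nonneg[OF fin pm Z(1,2)] by (intro sum_excess_le_Top) auto
  finally show ?thesis .
qed

text \<open>A rim agent has a positive remainder, so it is farther than \<open>thr\<close> from
  \<open>Z\<close>, and fewer than \<open>l\<close> agents are. This makes a loss of
  \<open>2 * thr\<close> per rim agent affordable.\<close>

lemma sum_card_rims: "(\<Sum>c\<in>Z. real (card (rim c))) \<le> real l"
proof -
  have "(\<Sum>c\<in>Z. card (rim c)) = card (\<Union>c\<in>Z. rim c)"
    using Z_fin cluster_fin(4)
    by (intro card_UN_disjoint[symmetric]) (auto simp: rim_def cluster_def)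
  also have "\<dots> \<le> card {x \<in> C. set_dist d x Z > thr}"
  proof (rule card_mono)
    show "(\<Union>c\<in>Z. rim c) \<subseteq> {x \<in> C. set_dist d x Z > thr}"
    proof
      fix x assume "x \<in> (\<Union>c\<in>Z. rim c)"
      then obtain c where "x \<in> C" "\<not> rem x \<le> 2 * avg c"
        by (auto simp: rim_def core_def cluster_def)
      then show "x \<in> {x \<in> C. set_dist d x Z > thr}"
        using avg_nonneg[of c] by (auto simp: rem_def max_def split: if_splits)
    qed
  qed (use fin in simp)
  also have "\<dots> \<le> l"
    unfolding thr_def using fin l guess set_dist_nonneg[OF fin pm Z(1,2)]
    by (intro less_imp_le[OF card_above_average_of_Top]) auto
  finally show ?thesis by (simp flip: of_nat_sum)
qed

text \<open>
  A capped lower estimate of the distance of the center to \<open>S\<close>: before a core agent is opened, each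
  core agent arriving is opened with probability roughly \<open>gap c S / fee\<close>, and each rim agent pays roughly
  \<open>gap c S\<close>. In a random order these balance out, whatever the values of \<open>gap\<close> over time.
\<close>

definition gap :: "nat \<Rightarrow> nat set \<Rightarrow> real" where
  "gap c S = min (max (set_dist d c S - 4 * thr) 0) fee"

lemma gap_le_fee: "gap c S \<le> fee"
  by (simp add: gap_def)

lemma price_le_gap:
  assumes "S \<subseteq> C" "S \<noteq> {}" "c \<in> C" "x \<in> cluster c"
  shows "min (exc S x) fee \<le> rem x + 2 * thr + gap c S"
proof -
  have x: "x \<in> C" using assms(4) cluster_fin(2) by auto
  have "set_dist d x S \<le> d x c + set_dist d c S" by (rule set_dist_triangle[OF assms(1,2) x assms(3)])
  then show ?thesis
    using dist_to_center[OF assms(4)] rem_nonneg[of x] thr_pos by (auto simp: exc_def gap_def)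
qed

text \<open>The discount \<open>4 * thr\<close> in \<open>gap\<close> exceeds the
  \<open>3 * thr\<close> in \<open>exc\<close> by just the \<open>thr\<close> lost between the
  center and \<open>x\<close>, so no multiple of \<open>thr\<close> is lost in this direction.
  \<open>price_le_gap\<close> loses \<open>2 * thr\<close> instead; it is applied to rim agents
  only.\<close>

lemma gap_le_price:
  assumes "S \<subseteq> C" "S \<noteq> {}" "c \<in> C" "x \<in> cluster c"
  shows "gap c S - rem x \<le> min (exc S x) fee"
proof -
  have x: "x \<in> C" using assms(4) cluster_fin(2) by auto
  have "set_dist d c S \<le> d c x + set_dist d x S" by (rule set_dist_triangle[OF assms(1-3) x])
  then show ?thesis
    using dist_to_center[OF assms(4)] met(3)[OF x assms(3)] rem_nonneg[of x] thr_pos fee_pos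
    by (auto simp: exc_def gap_def)
qed

lemma center_near_core:
  assumes "S \<subseteq> C" "c \<in> C" "S \<inter> core c \<noteq> {}"
  shows "set_dist d c S \<le> 2 * avg c + thr"
proof -
  obtain g where g: "g \<in> S" "g \<in> cluster c" "rem g \<le> 2 * avg c" using assms(3) by (auto simp: core_def)
  have gC: "g \<in> C" using g cluster_fin(2) by auto
  have "set_dist d c S \<le> d c g"
    using finite_subset[OF assms(1) fin] g(1) by (rule set_dist_le)
  then show ?thesis using dist_to_center[OF g(2)] g(3) met(3)[OF assms(2) gC] by simp
qed

text \<open>The way from \<open>x\<close> to the center and on to the open core agent costs
  \<open>thr\<close> twice, which the free allowance of \<open>3 * thr\<close> covers.\<close>

lemma price_if_core_open:
  assumes "S \<subseteq> C" "c \<in> C" "S \<inter> core c \<noteq> {}" "x \<in> cluster c"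
  shows "min (exc S x) fee \<le> rem x + 2 * avg c"
proof -
  have x: "x \<in> C" and ne: "S \<noteq> {}" using assms cluster_fin(2) by auto
  have "set_dist d x S \<le> d x c + set_dist d c S" by (rule set_dist_triangle[OF assms(1) ne x assms(2)])
  then have "exc S x \<le> rem x + 2 * avg c"
    using dist_to_center[OF assms(4)] center_near_core[OF assms(1-3)] rem_nonneg[of x] avg_nonneg[of c] thr_pos
    by (auto simp: exc_def)
  then show ?thesis by simp
qed

definition lin :: "nat \<Rightarrow> nat set \<Rightarrow> real" where
  "lin c U = (\<Sum>x\<in>U \<inter> core c. rem x + 2 * avg c) + (\<Sum>x\<in>U \<inter> rim c. rem x + 2 * thr + 2 * avg c)"

text \<open>
  Before a core agent is opened, \<open>fee\<close> pays in expectation for the core agents up to the first opening.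
  A random rim agent has its nearest core predecessor uniformly distributed, which yields the
  factor \<open>card (U \<inter> rim c) / (card (U \<inter> core c) + 1)\<close> for the rim agents. The terms \<open>2 * thr\<close> in \<open>lin\<close>
  add up to \<open>2 * B\<close> at most, because fewer than \<open>l\<close> agents are farther than \<open>thr\<close> from \<open>Z\<close>.
\<close>

definition pot :: "nat \<Rightarrow> nat set \<Rightarrow> nat set \<Rightarrow> real" where
  "pot c S U = lin c U + (if S \<inter> core c \<noteq> {} then 0 else
     fee + (fee + sum rem (U \<inter> core c)) * real (card (U \<inter> rim c)) / (real (card (U \<inter> core c)) + 1))"

lemma lin_remove_core:
  assumes "finite U" "x \<in> U \<inter> core c"
  shows "lin c (U - {x}) = lin c U - (rem x + 2 * avg c)"
proof -
  have "(U - {x}) \<inter> core c = U \<inter> core c - {x}" "(U - {x}) \<inter> rim c = U \<inter> rim c"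
    using assms(2) by (auto simp: rim_def)
  then show ?thesis using assms by (simp add: lin_def sum_diff1)
qed

lemma lin_remove_rim:
  assumes "finite U" "x \<in> U \<inter> rim c"
  shows "lin c (U - {x}) = lin c U - (rem x + 2 * thr + 2 * avg c)"
proof -
  have "(U - {x}) \<inter> rim c = U \<inter> rim c - {x}" "(U - {x}) \<inter> core c = U \<inter> core c"
    using assms(2) by (auto simp: rim_def)
  then show ?thesis using assms by (simp add: lin_def sum_diff1)
qed

lemma lin_nonneg: "0 \<le> lin c U"
  unfolding lin_def using rem_nonneg avg_nonneg thr_pos
  by (intro add_nonneg_nonneg sum_nonneg) (auto intro!: add_nonneg_nonneg simp: less_imp_le)

text \<open>\<open>z\<close> cancels: the \<open>g\<close> core cases lower the total by
  \<open>z * b\<close>, and the \<open>b\<close> rim cases raise it by \<open>z * b\<close>. What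
  remains is \<open>F * b + F * b * (b - 1) / (g + 1) = (g + b) * F * b / (g + 1)\<close>, which
  explains the denominator \<open>g + 1\<close>. For \<open>g = 0\<close> there is no core case, and
  \<open>z \<le> F\<close> is used instead.\<close>

lemma balance:
  fixes b g o' F z L :: real
  assumes "0 \<le> b" "0 \<le> g" "z \<le> F" "g = 0 \<or> 0 < g"
  shows "g * (L + (F - z) * b / g) + b * (L + z + F * (b - 1) / (g + 1)) + o' * (L + F * b / (g + 1))
    \<le> (g + b + o') * (L + F * b / (g + 1))"
proof (cases "g = 0")
  case True
  have "b * z \<le> b * F" using assms by (intro mult_left_mono)
  then show ?thesis using True by (simp add: algebra_simps)
next
  case False
  then have g: "0 < g" using assms by auto
  define X Y W where "X = F * b / (g + 1)" and "Y = F * (b - 1) / (g + 1)" and "W = (F - z) * b / g"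
  have "g * W = (F - z) * b" using g by (simp add: W_def)
  moreover have "b * Y + F * b = (g + b) * X" using g by (simp add: X_def Y_def field_simps)
  ultimately have "g * (L + W) + b * (L + z + Y) + o' * (L + X) \<le> (g + b + o') * (L + X)"
    by (simp add: algebra_simps)
  then show ?thesis unfolding X_def Y_def W_def .
qed

lemma pot_step:
  assumes S: "S \<subseteq> C" "S \<noteq> {}" and U: "U \<subseteq> C" and c: "c \<in> C"
  shows "(\<Sum>x\<in>U. (if x \<in> cluster c then min (exc S x) fee else 0) +
      (prob_open S x * pot c (insert x S) (U - {x}) + (1 - prob_open S x) * pot c S (U - {x})))
    \<le> real (card U) * pot c S U" (is "(\<Sum>x\<in>U. ?t x) \<le> _")
proof -
  have finU: "finite U" using U fin finite_subset by blast
  let ?G = "U \<inter> core c" and ?D = "U \<inter> rim c" and ?O = "U - cluster c"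
  have other: "lin c (U - {x}) = lin c U" "(U - {x}) \<inter> core c = ?G" "(U - {x}) \<inter> rim c = ?D"
    "insert x S \<inter> core c = S \<inter> core c" if "x \<in> ?O" for x
  proof -
    show 1: "(U - {x}) \<inter> core c = ?G" "(U - {x}) \<inter> rim c = ?D"
      using that by (auto simp: rim_def core_def)
    show "lin c (U - {x}) = lin c U" by (simp add: lin_def 1)
    show "insert x S \<inter> core c = S \<inter> core c" using that by (auto simp: core_def)
  qed
  have cl: "x \<in> cluster c" if "x \<in> ?G \<or> x \<in> ?D" for x using that by (auto simp: rim_def core_def)
  have same: "prob_open S x * v + (1 - prob_open S x) * v = v" for x and v :: real
    by (simp add: algebra_simps)
  show ?thesis
  proof (cases "S \<inter> core c \<noteq> {}")
    case True
    \<comment> \<open>Once a core agent is open, the potential is a plain sum of amounts reserved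
      for the single agents, so the bound holds for each arrival separately.\<close>
    have "?t x \<le> pot c S U" if xU: "x \<in> U" for x
    proof -
      have True': "insert x S \<inter> core c \<noteq> {}" using True by auto
      consider "x \<in> ?G" | "x \<in> ?D" | "x \<in> ?O" using xU by (auto simp: rim_def)
      then show ?thesis
      proof cases
        case 1
        then show ?thesis
          using True True' cl[of x] lin_remove_core[OF finU 1] price_if_core_open[OF S(1) c True, of x]
          by (simp add: pot_def same)
      next
        case 2
        then show ?thesis
          using True True' cl[of x] lin_remove_rim[OF finU 2] price_if_core_open[OF S(1) c True, of x] thr_pos
          by (simp add: pot_def same)
      next
        case 3
        then show ?thesis using True True' other(1)[OF 3] by (simp add: pot_def same)
      qed
    qed
    then have "(\<Sum>x\<in>U. ?t x) \<le> (\<Sum>x\<in>U. pot c S U)" by (rule sum_mono)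
    then show ?thesis by simp
  next
    case False
    define g where "g = real (card ?G)"
    define b where "b = real (card ?D)"
    define \<rho> where "\<rho> = sum rem ?G"
    define z where "z = gap c S"
    define L where "L = fee + lin c U"
    have \<rho>: "0 \<le> \<rho>" unfolding \<rho>_def by (intro sum_nonneg rem_nonneg)
    have pot: "pot c S U = L + (fee + \<rho>) * b / (g + 1)"
      using False unfolding pot_def L_def g_def b_def \<rho>_def by simp
    have tO: "?t x = L + (fee + \<rho>) * b / (g + 1)" if x: "x \<in> ?O" for x
      using False x other[OF x] unfolding pot_def same L_def g_def b_def \<rho>_def by (simp add: same)
    \<comment> \<open>Opening a rim agent does not change the core bit. Its price is paid from its
      share of \<open>lin\<close>, except for \<open>z\<close>.\<close>
    have tD: "?t x \<le> L + z + (fee + \<rho>) * (b - 1) / (g + 1)" if x: "x \<in> ?D" for x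
    proof -
      have "(U - {x}) \<inter> rim c = ?D - {x}" "(U - {x}) \<inter> core c = ?G" "insert x S \<inter> core c = S \<inter> core c"
        using x by (auto simp: rim_def)
      moreover have "real (card (?D - {x})) = b - 1"
        using arg_cong[OF card_Suc_Diff1[of ?D x], of real] x finU unfolding b_def
        by (simp del: card_Diff_insert card_Diff_singleton)
      ultimately have "?t x = min (exc S x) fee + (lin c (U - {x}) + (fee + (fee + \<rho>) * (b - 1) / (g + 1)))"
        using False cl[of x] x unfolding pot_def g_def \<rho>_def by (simp add: same)
      then show ?thesis
        using price_le_gap[OF S c, of x] cl[of x] x lin_remove_rim[OF finU x] avg_nonneg[of c]
        unfolding L_def z_def by simp
    qed
    have tG: "?t x \<le> L + (fee + \<rho> - z) * b / g" if x: "x \<in> ?G" for x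
    proof -
      have sets: "(U - {x}) \<inter> core c = ?G - {x}" "(U - {x}) \<inter> rim c = ?D" "insert x S \<inter> core c \<noteq> {}"
        using x by (auto simp: rim_def)
      have g: "real (card (?G - {x})) = g - 1" "0 < g"
        using arg_cong[OF card_Suc_Diff1[of ?G x], of real] x finU unfolding g_def
        by (auto simp: card_gt_0_iff simp del: card_Diff_insert card_Diff_singleton)
      have \<rho>x: "sum rem (?G - {x}) = \<rho> - rem x"
        using x finU unfolding \<rho>_def by (simp add: sum_diff1)
      let ?p = "prob_open S x"
      have "?t x = min (exc S x) fee + (?p * lin c (U - {x})
          + (1 - ?p) * (lin c (U - {x}) + (fee + (fee + (\<rho> - rem x)) * b / g)))"
        using False cl[of x] x sets g \<rho>x unfolding pot_def b_def by simp
      also have "\<dots> = lin c (U - {x}) + (min (exc S x) fee + (1 - ?p) * fee)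
          + (1 - ?p) * (fee + (\<rho> - rem x)) * b / g"
        by (simp add: algebra_simps)
      \<comment> \<open>The price is \<open>?p * fee\<close>, exactly the expected loss of the first
        \<open>fee\<close> in the potential through the opening of a core agent.\<close>
      also have "min (exc S x) fee + (1 - ?p) * fee = fee"
        using prob_open_times[of S x] by (simp add: algebra_simps)
      also have "lin c (U - {x}) + fee + (1 - ?p) * (fee + (\<rho> - rem x)) * b / g \<le> L + (fee + \<rho> - z) * b / g"
      proof (rule add_mono)
        show "lin c (U - {x}) + fee \<le> L"
          using lin_remove_core[OF finU x] rem_nonneg[of x] avg_nonneg[of c] unfolding L_def by simp
        have "rem x \<le> \<rho>"
          unfolding \<rho>_def using x finU rem_nonneg by (intro member_le_sum) auto
        then have "(1 - ?p) * (\<rho> - rem x) \<le> \<rho> - rem x"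
          using prob_open_01[of S x] by (simp add: mult_left_le_one_le)
        moreover have "(1 - ?p) * fee = fee - min (exc S x) fee"
          by (simp add: left_diff_distrib prob_open_times)
        \<comment> \<open>The error \<open>rem x\<close> is absorbed because \<open>x\<close> leaves
          the sum \<open>\<rho>\<close> in the same step; this is why \<open>pot\<close> adds the
          core remainders to \<open>fee\<close>.\<close>
        then have "(1 - ?p) * fee \<le> fee - z + rem x"
          using gap_le_price[OF S c cl[of x]] x unfolding z_def by linarith
        ultimately have "(1 - ?p) * (fee + (\<rho> - rem x)) \<le> fee + \<rho> - z" by (simp add: distrib_left)
        then show "(1 - ?p) * (fee + (\<rho> - rem x)) * b / g \<le> (fee + \<rho> - z) * b / g"
          using g unfolding b_def by (intro divide_right_mono mult_right_mono) auto
      qed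
      finally show ?thesis .
    qed
    have "(\<Sum>x\<in>U. ?t x) = (\<Sum>x\<in>?G. ?t x) + (\<Sum>x\<in>?D. ?t x) + (\<Sum>x\<in>?O. ?t x)"
    proof -
      have "U = (?G \<union> ?D) \<union> ?O" using cluster_fin(5)[of c] by (auto simp: rim_def)
      then have "(\<Sum>x\<in>U. ?t x) = (\<Sum>x\<in>(?G \<union> ?D) \<union> ?O. ?t x)" by simp
      also have "\<dots> = (\<Sum>x\<in>?G \<union> ?D. ?t x) + (\<Sum>x\<in>?O. ?t x)"
        using finU cluster_fin(5,6)[of c] by (intro sum.union_disjoint) auto
      also have "(\<Sum>x\<in>?G \<union> ?D. ?t x) = (\<Sum>x\<in>?G. ?t x) + (\<Sum>x\<in>?D. ?t x)"
        using finU by (intro sum.union_disjoint) (auto simp: rim_def)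
      finally show ?thesis .
    qed
    also have "\<dots> \<le> g * (L + (fee + \<rho> - z) * b / g) + b * (L + z + (fee + \<rho>) * (b - 1) / (g + 1))
        + real (card ?O) * (L + (fee + \<rho>) * b / (g + 1))"
      unfolding g_def b_def
      by (intro add_mono sum_bounded_above tG[unfolded g_def b_def] tD[unfolded g_def b_def]
          eq_refl[OF tO[unfolded g_def b_def]])
    also have "\<dots> \<le> (g + b + real (card ?O)) * (L + (fee + \<rho>) * b / (g + 1))"
      using gap_le_fee[of c S] \<rho> unfolding z_def by (intro balance) (auto simp: b_def g_def)
    also have "g + b + real (card ?O) = real (card U)"
    proof -
      have "card U = card ((?G \<union> ?D) \<union> ?O)"
        using cluster_fin(5)[of c] by (intro arg_cong[of _ _ card]) (auto simp: rim_def)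
      also have "\<dots> = card (?G \<union> ?D) + card ?O"
        using finU cluster_fin(5,6)[of c] by (intro card_Un_disjoint) auto
      also have "card (?G \<union> ?D) = card ?G + card ?D"
        using finU by (intro card_Un_disjoint) (auto simp: rim_def)
      finally show ?thesis unfolding g_def b_def by simp
    qed
    finally show ?thesis unfolding pot .
  qed
qed

text \<open>A cluster has no more rim than core agents, so the quotient in \<open>pot\<close> is at
  most 1. The averages charged to the members add up to multiples of the sum of remainders:
  \<open>lin\<close> contributes three such sums and the quotient term one.\<close>

lemma pot_initial:
  assumes "x \<in> C"
  shows "pot c {x} (C - {x}) \<le> 2 * fee + 4 * sum rem (cluster c) + 2 * thr * real (card (rim c))"
proof -
  let ?U = "C - {x}"
  have sub: "core c \<subseteq> C" "rim c \<subseteq> C" using cluster_fin by blast+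
  have R: "sum rem (core c) + sum rem (rim c) = sum rem (cluster c)"
    unfolding rim_def using cluster_fin by (simp add: sum.subset_diff[of "core c" "cluster c"])
  have N: "real (card (core c)) + real (card (rim c)) = real (card (cluster c))"
    unfolding rim_def using cluster_fin by (simp add: card_Diff_subset card_mono of_nat_diff)
  have "lin c ?U \<le> (\<Sum>x\<in>core c. rem x + 2 * avg c) + (\<Sum>x\<in>rim c. rem x + 2 * thr + 2 * avg c)"
    unfolding lin_def using cluster_fin rem_nonneg avg_nonneg thr_pos
    by (intro add_mono sum_mono2) (auto intro!: add_nonneg_nonneg simp: less_imp_le)
  also have "\<dots> = sum rem (core c) + sum rem (rim c)
      + 2 * (avg c * (real (card (core c)) + real (card (rim c)))) + 2 * thr * real (card (rim c))"
    by (simp add: sum.distrib algebra_simps)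
  also have "\<dots> = 3 * sum rem (cluster c) + 2 * thr * real (card (rim c))"
    unfolding R N avg_times_card by simp
  finally have lin: "lin c ?U \<le> 3 * sum rem (cluster c) + 2 * thr * real (card (rim c))" .
  have Rnn: "0 \<le> sum rem (cluster c)" by (intro sum_nonneg rem_nonneg)
  show ?thesis
  proof (cases "{x} \<inter> core c \<noteq> {}")
    case True
    then show ?thesis using lin Rnn fee_pos unfolding pot_def by simp
  next
    case False
    then have core: "?U \<inter> core c = core c" using sub by auto
    have "card (?U \<inter> rim c) \<le> card (rim c)" using cluster_fin by (intro card_mono) auto
    then have "real (card (?U \<inter> rim c)) \<le> real (card (core c)) + 1" using card_rim_le_core[of c] by simp
    then have q: "real (card (?U \<inter> rim c)) / (real (card (core c)) + 1) \<le> 1" by simp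
    have "sum rem (core c) \<le> sum rem (cluster c)"
      using cluster_fin rem_nonneg by (intro sum_mono2) auto
    moreover have "0 \<le> sum rem (core c)" by (intro sum_nonneg rem_nonneg)
    ultimately have "(fee + sum rem (core c)) * (real (card (?U \<inter> rim c)) / (real (card (core c)) + 1))
        \<le> (fee + sum rem (cluster c)) * 1"
      using q fee_pos by (intro mult_mono) auto
    then show ?thesis using lin False unfolding pot_def core by simp
  qed
qed

lemma mean_pay_initial:
  assumes "x \<in> C"
  shows "random_order_mean (C - {x}) (pay {x}) \<le> 8 * B"
proof -
  have "random_order_mean (C - {x}) (pay {x}) \<le> (\<Sum>c\<in>Z. pot c {x} (C - {x}))"
  proof (rule mean_pay_le_potential[where \<Phi> = "\<lambda>S U. \<Sum>c\<in>Z. pot c S U"])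
    show "0 \<le> (\<Sum>c\<in>Z. pot c S {})" for S
      using lin_nonneg fee_pos by (intro sum_nonneg) (auto simp: pot_def less_imp_le)
  next
    fix S U assume S: "S \<subseteq> C" "S \<noteq> {}" and U: "U \<subseteq> C"
    let ?avg = "\<lambda>x \<Phi>. prob_open S x * \<Phi> (insert x S) (U - {x}) + (1 - prob_open S x) * \<Phi> S (U - {x})"
    let ?t = "\<lambda>c x. (if x \<in> cluster c then min (exc S x) fee else 0) + ?avg x (pot c)"
    \<comment> \<open>An arrival is charged to its own cluster, but each step moves the potentials
      of all clusters.\<close>
    have "min (exc S x) fee + ?avg x (\<lambda>S U. \<Sum>c\<in>Z. pot c S U) = (\<Sum>c\<in>Z. ?t c x)" if "x \<in> U" for x
    proof -
      have "x \<in> C" using that U by auto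
      then have "(\<Sum>c\<in>Z. if x \<in> cluster c then min (exc S x) fee else 0) = min (exc S x) fee"
        using Z_fin ctr(1)[of x] by (simp add: cluster_def)
      then show ?thesis by (simp add: sum.distrib sum_distrib_left)
    qed
    then have "(\<Sum>x\<in>U. min (exc S x) fee + ?avg x (\<lambda>S U. \<Sum>c\<in>Z. pot c S U)) = (\<Sum>x\<in>U. \<Sum>c\<in>Z. ?t c x)"
      by (intro sum.cong refl)
    also have "\<dots> = (\<Sum>c\<in>Z. \<Sum>x\<in>U. ?t c x)" by (rule sum.swap)
    also have "\<dots> \<le> (\<Sum>c\<in>Z. real (card U) * pot c S U)"
      using Z(1) by (intro sum_mono pot_step S U) auto
    finally show "(\<Sum>x\<in>U. min (exc S x) fee + ?avg x (\<lambda>S U. \<Sum>c\<in>Z. pot c S U))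
      \<le> real (card U) * (\<Sum>c\<in>Z. pot c S U)" by (simp add: sum_distrib_left)
  qed (use assms in auto)
  also have "\<dots> \<le> (\<Sum>c\<in>Z. 2 * fee + 4 * sum rem (cluster c) + 2 * thr * real (card (rim c)))"
    by (intro sum_mono pot_initial assms)
  also have "\<dots> = 2 * (real (card Z) * fee) + 4 * (\<Sum>c\<in>Z. sum rem (cluster c))
      + 2 * (thr * (\<Sum>c\<in>Z. real (card (rim c))))"
    by (simp add: sum.distrib sum_distrib_left mult_ac)
  \<comment> \<open>At most \<open>k\<close> clusters with two fees each, the remainders, and the
    rim losses, in this order.\<close>
  also have "\<dots> \<le> 2 * B + 4 * B + 2 * B"
  proof -
    have "real (card Z) * fee \<le> real k * fee" using Z(3) fee_pos by (intro mult_right_mono) auto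
    moreover have "thr * (\<Sum>c\<in>Z. real (card (rim c))) \<le> thr * real l"
      using sum_card_rims thr_pos by (intro mult_left_mono) auto
    moreover have "real k * fee = B" "thr * real l = B" using k l by (auto simp: fee_def thr_def)
    ultimately show ?thesis using sum_rem_clusters by simp
  qed
  finally show ?thesis by simp
qed

definition outlay :: "nat set \<Rightarrow> real" where
  "outlay S = fee * real (card S) + (\<Sum>x\<in>C. exc S x)"

text \<open>The first agent is opened without a coin, so the mean is taken conditionally on it: one
  fee for it, and twice \<open>8 * B\<close> for the others.\<close>

lemma mean_outlay:
  assumes "C \<noteq> {}"
  shows "random_order_mean C (\<lambda>xs. mean_after outlay {hd xs} (tl xs)) \<le> 17 * B"
proof -
  have feeB: "fee \<le> B" using B k by (simp add: fee_def divide_le_eq)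
  have "random_order_mean (C - {x}) (mean_after outlay {x}) \<le> 17 * B" if x: "x \<in> C" for x
  proof -
    have "mean_after outlay {x} xs \<le> fee + 2 * pay {x} xs" if xs: "set xs = C - {x}" "distinct xs" for xs
    proof -
      have "outlay = (\<lambda>S'. fee * real (card S') + (\<Sum>y\<leftarrow>[x] @ xs. exc S' y))"
      proof
        fix S'
        have "(\<Sum>y\<leftarrow>[x] @ xs. exc S' y) = sum (exc S') (set (x # xs))"
          using xs sum_list_distinct_conv_sum_set[of "x # xs" "exc S'"] by simp
        also have "set (x # xs) = C" using xs x by auto
        finally show "outlay S' = fee * real (card S') + (\<Sum>y\<leftarrow>[x] @ xs. exc S' y)"
          by (simp add: outlay_def)
      qed
      then have "mean_after outlay {x} xs \<le> fee * real (card {x}) + (\<Sum>y\<leftarrow>[x]. exc {x} y) + 2 * pay {x} xs"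
        using mean_after_le[of "{x}" xs "[x]"] xs x by auto
      then show ?thesis using exc_opened[of "{x}" x] x by simp
    qed
    then have "random_order_mean (C - {x}) (mean_after outlay {x})
        \<le> random_order_mean (C - {x}) (\<lambda>xs. fee + 2 * pay {x} xs)"
      using fin by (intro random_order_mean_mono) auto
    also have "\<dots> = fee + 2 * random_order_mean (C - {x}) (pay {x})"
      using fin by (simp add: random_order_mean_add random_order_mean_const random_order_mean_cmult)
    finally show ?thesis using mean_pay_initial[OF x] feeB by simp
  qed
  then have "(\<Sum>x\<in>C. random_order_mean (C - {x}) (mean_after outlay {x})) \<le> real (card C) * (17 * B)"
    by (rule sum_bounded_above)
  then show ?thesis
    using random_order_mean_rec[OF fin assms, of "\<lambda>xs. mean_after outlay {hd xs} (tl xs)"] assms fin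
    by (simp add: divide_le_eq card_gt_0_iff mult.commute)
qed

end

section \<open>From the recursion to executions of the mechanism\<close>

lemma ensures_meyerson_from:
  "ensures d (meyerson_from \<sigma> k l B S xs)
     (\<lambda>S' Q. S \<subseteq> S' \<and> S' \<subseteq> S \<union> set xs \<and> (\<forall>i. count Q i \<le> count (mset xs) i))"
proof (induction xs arbitrary: S)
  case Nil
  then show ?case by (simp add: ensures_Return)
next
  case (Cons x xs)
  show ?case unfolding meyerson_from.simps Let_def
  proof (rule ensures_bind[OF ensures_ask[where R = "\<lambda>_ Q. Q = {#x#}"]], rule refl, rule ensures_Flip)
    fix z and Q :: "nat multiset" and b
    assume Q: "Q = {#x#}"
    show "ensures d (meyerson_from \<sigma> k l B (if b then insert x S else S) xs)
      (\<lambda>S' Q'. S \<subseteq> S' \<and> S' \<subseteq> S \<union> set (x # xs) \<and> (\<forall>i. count (Q + Q') i \<le> count (mset (x # xs)) i))"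
      by (rule ensures_mono[OF Cons.IH]) (auto simp: Q split: if_splits)
  qed
qed

lemma ensures_meyerson:
  assumes "set xs = C" "distinct xs" "C \<noteq> {}"
  shows "ensures d (meyerson \<sigma> k l B xs) (\<lambda>S Q. S \<subseteq> C \<and> S \<noteq> {} \<and> (\<forall>i. count Q i \<le> 1))"
  unfolding meyerson_def
proof (rule ensures_mono[OF ensures_meyerson_from], intro conjI allI)
  obtain x ys where xs: "xs = x # ys" using assms(1,3) by (cases xs) auto
  fix S Q i
  assume *: "{hd xs} \<subseteq> S \<and> S \<subseteq> {hd xs} \<union> set (tl xs) \<and> (\<forall>i. count Q i \<le> count (mset (tl xs)) i)"
  show "S \<subseteq> C" "S \<noteq> {}" using * xs assms(1) by auto
  have "count Q i \<le> count (mset ys) i" using * xs by simp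
  also have "\<dots> \<le> 1" using assms(2) xs distinct_count_atmost_1[of ys] by auto
  finally show "count Q i \<le> 1" .
qed

context meyerson_guess
begin

lemma run_meyerson_Cons:
  assumes "consistent_profile C \<sigma> d" "S \<subseteq> C" "S \<noteq> {}" "x \<in> C"
  shows "map_pmf fst (run d (meyerson_from \<sigma> k l B S (x # xs))) =
    bind_pmf (bernoulli_pmf (prob_open S x))
      (\<lambda>b. map_pmf fst (run d (meyerson_from \<sigma> k l B (if b then insert x S else S) xs)))"
  using dist_top_of[OF assms(1,4) finite_subset[OF assms(2) fin] assms(3,2)]
  by (simp add: ask_def Let_def map_bind_pmf pmf.map_comp comp_def case_prod_beta
      prob_open_def exc_def thr_def fee_def)

text \<open>Links the interactive program to the recursion. Finiteness of the support is carried
  along because the expectation of a bind is evaluated as a finite sum.\<close>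

lemma mean_meyerson_from:
  assumes "consistent_profile C \<sigma> d" "S \<subseteq> C" "S \<noteq> {}" "set xs \<subseteq> C"
  shows "finite (set_pmf (map_pmf fst (run d (meyerson_from \<sigma> k l B S xs))))"
    and "measure_pmf.expectation (map_pmf fst (run d (meyerson_from \<sigma> k l B S xs))) W = mean_after W S xs"
proof -
  let ?M = "\<lambda>S xs. map_pmf fst (run d (meyerson_from \<sigma> k l B S xs))"
  have "finite (set_pmf (?M S xs)) \<and> measure_pmf.expectation (?M S xs) W = mean_after W S xs"
    using assms(2-4)
  proof (induction xs arbitrary: S)
    case Nil
    then show ?case by simp
  next
    case (Cons x xs)
    have x: "x \<in> C" "set xs \<subseteq> C" "insert x S \<subseteq> C" using Cons.prems by auto
    note eq = run_meyerson_Cons[OF assms(1) Cons.prems(1,2) x(1), of xs]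
    have IH: "finite (set_pmf (?M (if b then insert x S else S) xs))"
      "measure_pmf.expectation (?M (if b then insert x S else S) xs) W
        = mean_after W (if b then insert x S else S) xs" for b
      using Cons.IH[of "insert x S"] Cons.IH[of S] Cons.prems x by auto
    have "measure_pmf.expectation (?M S (x # xs)) W =
      (\<Sum>b\<in>UNIV. pmf (bernoulli_pmf (prob_open S x)) b *\<^sub>R mean_after W (if b then insert x S else S) xs)"
      unfolding eq using IH by (subst pmf_expectation_bind[where A = UNIV]) auto
    also have "\<dots> = mean_after W S (x # xs)"
      using prob_open_01[of S x] by (simp add: UNIV_bool)
    finally show ?case using IH(1) unfolding eq by (simp only: set_bind_pmf) auto
  qed
  then show "finite (set_pmf (?M S xs))" "measure_pmf.expectation (?M S xs) W = mean_after W S xs"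
    by auto
qed

lemma outlay_nonneg: "0 \<le> outlay S"
  unfolding outlay_def using fee_pos exc_nonneg by (intro add_nonneg_nonneg sum_nonneg) auto

text \<open>At the level \<open>104 * B\<close>, \<open>small_outlay\<close> yields the mechanism's
  limit of \<open>104 * k\<close> centers; Markov's inequality then gives \<open>17 / 104\<close>,
  well below \<open>1 / 2\<close>.\<close>

lemma prob_outlay:
  assumes "consistent_profile C \<sigma> d" "C \<noteq> {}"
  shows "measure_pmf.prob (bind_pmf (pmf_of_set (permutations_of_set C))
      (\<lambda>xs. map_pmf fst (run d (meyerson \<sigma> k l B xs)))) {S. 104 * B \<le> outlay S} \<le> 1 / 2"
proof -
  let ?M = "\<lambda>xs. map_pmf fst (run d (meyerson \<sigma> k l B xs))"
  let ?D = "bind_pmf (pmf_of_set (permutations_of_set C)) ?M"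
  have perm: "finite (set_pmf (?M xs)) \<and>
      measure_pmf.expectation (?M xs) outlay = mean_after outlay {hd xs} (tl xs)"
    if xs: "xs \<in> permutations_of_set C" for xs
  proof -
    have "set xs = C" using xs by (rule permutations_of_setD)
    then obtain x ys where "xs = x # ys" "x \<in> C" "set ys \<subseteq> C" using assms(2) by (cases xs) auto
    then show ?thesis
      unfolding meyerson_def using mean_meyerson_from[OF assms(1), of "{x}" ys] by auto
  qed
  have fin_perm: "finite (permutations_of_set C)" "permutations_of_set C \<noteq> {}"
    using fin by auto
  have "measure_pmf.expectation ?D outlay
      = (\<Sum>xs\<in>permutations_of_set C. mean_after outlay {hd xs} (tl xs) /\<^sub>R real (card (permutations_of_set C)))"
    using perm fin_perm by (subst pmf_expectation_bind_pmf_of_set) auto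
  also have "\<dots> = random_order_mean C (\<lambda>xs. mean_after outlay {hd xs} (tl xs))"
    unfolding random_order_mean_def using fin_perm
    by (simp add: integral_pmf_of_set sum_distrib_left divide_inverse mult.commute)
  also have "\<dots> \<le> 17 * B" by (rule mean_outlay[OF assms(2)])
  finally have mean: "measure_pmf.expectation ?D outlay \<le> 17 * B" .
  have finD: "finite (set_pmf ?D)"
    using perm fin_perm by (auto simp: set_pmf_of_set)
  have "measure_pmf.prob ?D {S. 104 * B \<le> outlay S} \<le> measure_pmf.expectation ?D outlay / (104 * B)"
    using integral_Markov_inequality_measure[of ?D outlay "{}" "104 * B"] B outlay_nonneg
      integrable_measure_pmf_finite[OF finD, of outlay] by auto
  also have "\<dots> \<le> 17 * B / (104 * B)" using mean B by (intro divide_right_mono) auto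
  also have "\<dots> \<le> 1 / 2" using B by simp
  finally show ?thesis .
qed

text \<open>Both parts of the outlay are nonnegative, so each stays within \<open>104 * B\<close>.
  The connection part counts excess over \<open>3 * thr\<close> only; below that threshold,
  \<open>l\<close> entries add \<open>3 * B\<close> at most.\<close>

lemma small_outlay:
  assumes "S \<subseteq> C" "outlay S < 104 * B"
  shows "card S \<le> 104 * k" "cost l C d S \<le> 107 * B"
proof -
  have exc: "0 \<le> (\<Sum>x\<in>C. exc S x)" by (intro sum_nonneg exc_nonneg)
  have "fee * real (card S) < 104 * B" using assms(2) exc unfolding outlay_def by simp
  also have "104 * B = fee * (104 * real k)" using k by (simp add: fee_def)
  finally have "real (card S) < 104 * real k" using fee_pos by simp
  then show "card S \<le> 104 * k" by linarith
  have "cost l C d S \<le> real l * (3 * thr) + (\<Sum>x\<in>C. exc S x)"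
    unfolding cost_def exc_def using fin thr_pos by (intro Top_on_le_excess) auto
  also have "real l * (3 * thr) = 3 * B" using l by (simp add: thr_def)
  also have "(\<Sum>x\<in>C. exc S x) \<le> 104 * B"
    using assms(2) fee_pos unfolding outlay_def
    by (smt (verit, best) mult_nonneg_nonneg of_nat_0_le_iff)
  finally show "cost l C d S \<le> 107 * B" by simp
qed

end

section \<open>One attempt: run, size check and evaluation\<close>

definition evaluate :: "nat set \<Rightarrow> nat \<Rightarrow> profile \<Rightarrow> nat set \<Rightarrow> (nat set \<times> real) list mech" where
  "evaluate C l \<sigma> S = do { v \<leftarrow> distance_vector C \<sigma> S; Return [(S, Top l {# v i. i \<in># mset_set C #})] }"

definition attempt :: "nat set \<Rightarrow> nat \<Rightarrow> nat \<Rightarrow> profile \<Rightarrow> real \<Rightarrow> (nat set \<times> real) list mech" where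
  "attempt C k l \<sigma> B = Shuffle C (\<lambda>xs. do {
     S \<leftarrow> meyerson \<sigma> k l B xs;
     if card S \<le> 104 * k then evaluate C l \<sigma> S else Return [] })"

definition admissible :: "nat set \<Rightarrow> nat \<Rightarrow> nat set \<Rightarrow> bool" where
  "admissible C k S \<longleftrightarrow> S \<subseteq> C \<and> S \<noteq> {} \<and> card S \<le> 104 * k"

lemma ensures_evaluate:
  assumes "consistent_profile C \<sigma> d" "finite C" "S \<noteq> {}" "S \<subseteq> C"
  shows "ensures d (evaluate C l \<sigma> S) (\<lambda>ys Q. ys = [(S, cost l C d S)] \<and> (\<forall>i. count Q i \<le> 1))"
  unfolding evaluate_def
proof (rule ensures_bind[OF ensures_distance_vector[OF assms]])
  fix v and Q :: "nat multiset"
  assume v: "(\<forall>i\<in>C. v i = set_dist d i S) \<and> (\<forall>i. count Q i \<le> 1)"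
  then have "{# v i. i \<in># mset_set C #} = {# set_dist d i S. i \<in># mset_set C #}"
    using assms(2) by (intro image_mset_cong) auto
  then show "ensures d (Return [(S, Top l {# v i. i \<in># mset_set C #})])
     (\<lambda>ys Q'. ys = [(S, cost l C d S)] \<and> (\<forall>i. count (Q + Q') i \<le> 1))"
    using v by (intro ensures_Return) (simp add: cost_def)
qed

lemma ensures_attempt:
  assumes "consistent_profile C \<sigma> d" "finite C" "C \<noteq> {}"
  shows "ensures d (attempt C k l \<sigma> B)
    (\<lambda>ys Q. (\<forall>(S, c)\<in>set ys. admissible C k S \<and> c = cost l C d S) \<and> (\<forall>i. count Q i \<le> 2))"
  unfolding attempt_def
proof (intro ensures_Shuffle[OF assms(2)] ensures_bind[OF ensures_meyerson[OF _ _ assms(3)]])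
  fix S and Q :: "nat multiset"
  assume S: "S \<subseteq> C \<and> S \<noteq> {} \<and> (\<forall>i. count Q i \<le> 1)"
  have 2: "count Q i + n \<le> 2" if "n \<le> 1" for i n using S that by (metis add_mono one_add_one)
  show "ensures d (if card S \<le> 104 * k then evaluate C l \<sigma> S else Return [])
    (\<lambda>ys Q'. (\<forall>(S, c)\<in>set ys. admissible C k S \<and> c = cost l C d S) \<and> (\<forall>i. count (Q + Q') i \<le> 2))"
  proof (cases "card S \<le> 104 * k")
    case True
    have "ensures d (evaluate C l \<sigma> S)
      (\<lambda>ys Q'. (\<forall>(S, c)\<in>set ys. admissible C k S \<and> c = cost l C d S) \<and> (\<forall>i. count (Q + Q') i \<le> 2))"
      by (rule ensures_mono[OF ensures_evaluate[OF assms(1,2)]]) (use S True 2 in \<open>auto simp: admissible_def\<close>)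
    then show ?thesis using True by simp
  next
    case False
    then show ?thesis using 2[of 0] by (auto intro: ensures_Return)
  qed
qed

lemma (in meyerson_guess) prob_attempt_fails:
  assumes "consistent_profile C \<sigma> d" "C \<noteq> {}"
  shows "measure_pmf.prob (map_pmf fst (run d (attempt C k l \<sigma> B))) {ys. \<forall>(S, c)\<in>set ys. 107 * B < c} \<le> 1 / 2"
proof -
  let ?g = "\<lambda>S. if card S \<le> 104 * k then evaluate C l \<sigma> S else Return []"
  let ?D = "bind_pmf (pmf_of_set (permutations_of_set C)) (\<lambda>xs. map_pmf fst (run d (meyerson \<sigma> k l B xs)))"
  let ?Bad = "{ys. \<forall>(S, c)\<in>set ys. 107 * B < c}"
  have eq: "map_pmf fst (run d (attempt C k l \<sigma> B)) = bind_pmf ?D (\<lambda>S. map_pmf fst (run d (?g S)))"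
    unfolding attempt_def by (simp only: run.simps map_bind_pmf map_fst_run_bind bind_assoc_pmf)
  have "measure_pmf.prob (map_pmf fst (run d (attempt C k l \<sigma> B))) ?Bad
      \<le> measure_pmf.prob ?D {S. 104 * B \<le> outlay S} * 1"
    unfolding eq
  proof (rule prob_bind_pmf_le)
    fix S assume S: "S \<in> set_pmf ?D"
    then obtain xs Q where xs: "xs \<in> set_pmf (pmf_of_set (permutations_of_set C))"
      "(S, Q) \<in> set_pmf (run d (meyerson \<sigma> k l B xs))" by auto
    have "xs \<in> permutations_of_set C" using xs(1) fin by (simp add: set_pmf_of_set)
    then have "ensures d (meyerson \<sigma> k l B xs) (\<lambda>S Q. S \<subseteq> C \<and> S \<noteq> {} \<and> (\<forall>i. count Q i \<le> 1))"
      using assms(2) by (intro ensures_meyerson permutations_of_setD)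
    then have SC: "S \<subseteq> C" "S \<noteq> {}" using xs(2) unfolding ensures_def by auto
    show "measure_pmf.prob (map_pmf fst (run d (?g S))) ?Bad \<le> (if S \<in> {S. 104 * B \<le> outlay S} then 1 else 0)"
    proof (cases "104 * B \<le> outlay S")
      case False
      then have small: "card S \<le> 104 * k" "cost l C d S \<le> 107 * B"
        using small_outlay[OF SC(1)] by auto
      have "ensures d (?g S) (\<lambda>ys Q. ys = [(S, cost l C d S)] \<and> (\<forall>i. count Q i \<le> 1))"
        using ensures_evaluate[OF assms(1) fin SC(2,1)] small(1) by simp
      then have "set_pmf (map_pmf fst (run d (?g S))) \<inter> ?Bad = {}"
        using small(2) unfolding ensures_def by fastforce
      then have "measure_pmf.prob (map_pmf fst (run d (?g S))) ?Bad = 0"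
        by (simp only: measure_pmf_zero_iff)
      then show ?thesis using False by simp
    qed simp
  qed
  then show ?thesis using prob_outlay[OF assms] by simp
qed

section \<open>Rounding by BB-Top\<close>

text \<open>Unfolds a weighted instance into one entry per agent, placed at its representative, so
  that weighted costs become \<open>Top_on\<close> over all agents.\<close>

lemma sum_replicate_fibres:
  assumes "finite X" "finite P" "t ` X \<subseteq> P"
  shows "(\<Sum>i\<in>P. replicate_mset (card {j \<in> X. t j = i}) (h i)) = {# h (t j). j \<in># mset_set X #}"
  using assms(1,3)
proof (induction X rule: finite_induct)
  case (insert x X)
  have "card {j \<in> insert x X. t j = i} = card {j \<in> X. t j = i} + (if t x = i then 1 else 0)" for i
  proof -
    have "{j \<in> insert x X. t j = i} = (if t x = i then insert x {j \<in> X. t j = i} else {j \<in> X. t j = i})"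
      by auto
    then show ?thesis using insert.hyps by simp
  qed
  then have "replicate_mset (card {j \<in> insert x X. t j = i}) (h i)
      = replicate_mset (card {j \<in> X. t j = i}) (h i) + (if t x = i then {# h i #} else {#})" for i
    by simp
  then have "(\<Sum>i\<in>P. replicate_mset (card {j \<in> insert x X. t j = i}) (h i))
      = {# h (t j). j \<in># mset_set X #} + {# h (t x) #}"
    using insert assms(2) by (simp add: sum.distrib)
  then show ?case using insert.hyps by simp
qed auto

definition ring_number :: "real \<Rightarrow> real \<Rightarrow> nat \<Rightarrow> nat" where
  "ring_number \<rho> \<epsilon> n = nat \<lceil>log (1 + \<epsilon>) (real n ^ 3 * \<rho> * (1 + 3 * \<epsilon>) / \<epsilon>)\<rceil>"

text \<open>\<open>opt\<close> is any number satisfying the listed bounds, not necessarily the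
  optimum. \<open>R\<close> certifies that centers within \<open>P\<close> can reach cost
  \<open>B\<close>, on which the radii \<open>B0\<close> rely; \<open>Z\<close> is the comparison
  solution with centers anywhere in \<open>C\<close>.\<close>

locale bb_instance =
  fixes C P :: "nat set" and d :: dist_fun and \<sigma> :: profile and k l n :: nat and \<rho> \<epsilon> B opt :: real
    and w :: "nat \<Rightarrow> nat" and R Z :: "nat set"
  assumes fin: "finite C" and pm: "pmetric_on C d" and cons: "consistent_profile C \<sigma> d"
    and P: "P \<subseteq> C" "P \<noteq> {}" and n: "n = card C" and l: "1 \<le> l" "l \<le> n"
    and \<rho>: "1 \<le> \<rho>" and \<epsilon>: "0 < \<epsilon>" "\<epsilon> \<le> 1" and B: "0 < B" "B \<le> 2 * (real n)\<^sup>2 * opt"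
    and w: "w = (\<lambda>i. if i \<in> P then card {j \<in> C. top_of \<sigma> P j = i} else 0)"
    and R: "R \<subseteq> P" "R \<noteq> {}" "card R \<le> k" "\<And>i. i \<in> P \<Longrightarrow> real l * set_dist d i R \<le> B"
    and Z: "Z \<subseteq> C" "Z \<noteq> {}" "card Z \<le> k" "cost l C d Z \<le> opt"
    and costP: "cost l C d P \<le> 214 * opt"
begin

abbreviation t :: "nat \<Rightarrow> nat" where "t j \<equiv> top_of \<sigma> P j"

abbreviation wcost :: "dist_fun \<Rightarrow> nat set \<Rightarrow> real" where
  "wcost d' S \<equiv> Top_on l C (\<lambda>j. set_dist d' (t j) S)"

abbreviation I :: "nat set" where "I \<equiv> {i \<in> P. w i > 0}"

definition w' :: "nat \<Rightarrow> real" where "w' i = real (min (w i) l)"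
definition B0 :: "nat \<Rightarrow> real" where "B0 i = \<rho> * (1 + 3 * \<epsilon>) * B / w' i"
definition q :: "nat \<Rightarrow> nat" where
  "q i = nat \<lceil>log (1 + \<epsilon>) ((real n)\<^sup>2 * w' i * B0 i * real n / (\<epsilon> * B))\<rceil>"
definition dball :: "nat \<Rightarrow> nat \<Rightarrow> nat set" where
  "dball i r = {j \<in> P. d i j \<le> B0 i / (1 + \<epsilon>) ^ r}"
text \<open>Bounds the unresolved distances in the innermost balls. Even \<open>n\<close> times this
  amount is at most \<open>2 * opt\<close>, because \<open>B\<close> is at most
  \<open>2 * n ^ 2 * opt\<close>: hence the quadratic parameter.\<close>

definition slack :: real where "slack = \<epsilon> * B / ((real n)\<^sup>2 * real n)"

definition lp_feasible :: "(nat \<Rightarrow> nat \<Rightarrow> nat set) \<Rightarrow> dist_fun \<Rightarrow> bool" where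
  "lp_feasible S d' \<longleftrightarrow> pmetric_on P d' \<and>
     (\<forall>i\<in>I.
        (\<forall>j \<in> P - S i 0. B0 i \<le> d' i j) \<and>
        (\<forall>r<q i. \<forall>j \<in> S i r - S i (Suc r).
           B0 i / (1 + \<epsilon>) ^ Suc r \<le> d' i j \<and> d' i j \<le> B0 i / (1 + \<epsilon>) ^ r) \<and>
        (\<forall>j \<in> S i (q i). d' i j \<le> \<epsilon> * B / ((real n)\<^sup>2 * real n * w' i)))"

lemmas met = pmetric_onD[OF pm]

lemma finP: "finite P"
  using P fin finite_subset by blast

lemma n_pos: "1 \<le> n"
  using l by simp

lemma t_in_P: "j \<in> C \<Longrightarrow> t j \<in> P"
  using top_of(1)[OF cons _ finP P(2,1)] .

lemma t_in_I: "j \<in> C \<Longrightarrow> t j \<in> I"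
proof -
  assume j: "j \<in> C"
  then have "j \<in> {j' \<in> C. t j' = t j}" by simp
  then have "0 < card {j' \<in> C. t j' = t j}" using fin by (auto simp: card_gt_0_iff)
  then show ?thesis using t_in_P[OF j] by (simp add: w)
qed

lemma dist_t: "j \<in> C \<Longrightarrow> d j (t j) = set_dist d j P"
  using dist_top_of[OF cons _ finP P(2,1)] .

lemma sum_w: "sum w P = n"
proof -
  have "sum w P = (\<Sum>i\<in>P. \<Sum>j\<in>{j \<in> C. t j = i}. 1)" unfolding w by simp
  also have "\<dots> = (\<Sum>j\<in>C. 1)" using t_in_P by (intro sum.group fin finP) auto
  finally show ?thesis by (simp add: n)
qed

lemma weighted_cost_eq: "weighted_cost l P w d' S = wcost d' S"
proof -
  have "(\<Sum>i\<in>P. replicate_mset (w i) (set_dist d' i S))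
      = (\<Sum>i\<in>P. replicate_mset (card {j \<in> C. t j = i}) (set_dist d' i S))"
    unfolding w by (intro sum.cong) auto
  also have "\<dots> = {# set_dist d' (t j) S. j \<in># mset_set C #}"
    using t_in_P by (intro sum_replicate_fibres fin finP) auto
  finally show ?thesis unfolding weighted_cost_def by simp
qed

lemma w'_ge_1: "i \<in> I \<Longrightarrow> 1 \<le> w' i"
  using l by (simp add: w'_def)

lemma B0_pos: "i \<in> I \<Longrightarrow> 0 < B0 i"
  using w'_ge_1[of i] \<rho> \<epsilon> B unfolding B0_def by (intro divide_pos_pos mult_pos_pos) auto

lemma w'_B0: "i \<in> I \<Longrightarrow> w' i * B0 i = \<rho> * (1 + 3 * \<epsilon>) * B"
  using w'_ge_1[of i] unfolding B0_def by simp

text \<open>The weights cancel in \<open>w' i * B0 i\<close>, so the number of rings is the same for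
  all agents.\<close>

lemma q_eq: "i \<in> I \<Longrightarrow> q i = ring_number \<rho> \<epsilon> n"
proof -
  assume "i \<in> I"
  then have "(real n)\<^sup>2 * w' i * B0 i * real n / (\<epsilon> * B) = (real n)\<^sup>2 * (\<rho> * (1 + 3 * \<epsilon>) * B) * real n / (\<epsilon> * B)"
    using w'_B0[of i] by (simp add: mult.assoc)
  also have "\<dots> = real n ^ 3 * \<rho> * (1 + 3 * \<epsilon>) / \<epsilon>"
    using B \<epsilon> by (simp add: power2_eq_square power3_eq_cube field_simps)
  finally show ?thesis unfolding q_def ring_number_def by simp
qed

lemma slack_nonneg: "0 \<le> slack"
  using \<epsilon> B by (simp add: slack_def)

lemma small_le_slack:
  assumes "i \<in> I"
  shows "\<epsilon> * B / ((real n)\<^sup>2 * real n * w' i) \<le> slack"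
proof -
  have "slack / w' i \<le> slack / 1"
    using w'_ge_1[OF assms] slack_nonneg by (intro divide_left_mono) auto
  then show ?thesis by (simp add: slack_def)
qed

lemma n_slack: "real n * slack = \<epsilon> * (B / (real n)\<^sup>2)"
  using n_pos by (simp add: slack_def)

lemma n_slack_le: "real n * slack \<le> \<epsilon> * B" "real n * slack \<le> 2 * opt"
proof -
  have n2: "1 \<le> (real n)\<^sup>2" using n_pos by simp
  then have "B / (real n)\<^sup>2 \<le> B / 1" using B(1) n_pos by (intro divide_left_mono) auto
  then show "real n * slack \<le> \<epsilon> * B" unfolding n_slack using \<epsilon> by (intro mult_left_mono) auto
  have le: "B / (real n)\<^sup>2 \<le> 2 * opt" using B(2) n_pos by (simp add: divide_le_eq mult_ac)
  have "\<epsilon> * (B / (real n)\<^sup>2) \<le> 1 * (B / (real n)\<^sup>2)" using \<epsilon> B(1) by (intro mult_right_mono) auto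
  then show "real n * slack \<le> 2 * opt" unfolding n_slack using le by simp
qed

lemma opt_pos: "0 < opt"
proof (rule ccontr)
  assume "\<not> 0 < opt"
  then have "2 * (real n)\<^sup>2 * opt \<le> 0" by (intro mult_nonneg_nonpos) auto
  then show False using B by linarith
qed

text \<open>The constraints have a solution, so the \<open>SOME\<close> in \<open>bb_top\<close>
  selects one. For the innermost ball this needs the number of rings to be as large as
  \<open>q i\<close>.\<close>

lemma true_metric_feasible: "lp_feasible dball d"
  unfolding lp_feasible_def
proof (intro conjI ballI allI impI)
  show "pmetric_on P d" using pm P(1) unfolding pmetric_on_def by (meson subsetD)
next
  fix i assume i: "i \<in> I"
  show "B0 i \<le> d i j" if "j \<in> P - dball i 0" for j using that by (auto simp: dball_def)
  show "B0 i / (1 + \<epsilon>) ^ Suc r \<le> d i j" "d i j \<le> B0 i / (1 + \<epsilon>) ^ r"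
    if "j \<in> dball i r - dball i (Suc r)" for j r
    using that by (auto simp: dball_def)
  show "d i j \<le> \<epsilon> * B / ((real n)\<^sup>2 * real n * w' i)" if "j \<in> dball i (q i)" for j
  proof -
    let ?X = "(real n)\<^sup>2 * w' i * B0 i * real n / (\<epsilon> * B)"
    have pos: "0 < w' i" "0 < B0 i" "0 < real n" "0 < ?X"
      using w'_ge_1[OF i] B0_pos[OF i] n_pos \<epsilon> B by auto
    have "log (1 + \<epsilon>) ?X \<le> real (q i)" unfolding q_def by linarith
    then have "?X \<le> (1 + \<epsilon>) powr real (q i)" using pos(4) \<epsilon> by (simp add: log_le_iff)
    then have "?X \<le> (1 + \<epsilon>) ^ q i" using \<epsilon> by (simp add: powr_realpow)
    then have "B0 i / (1 + \<epsilon>) ^ q i \<le> B0 i / ?X"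
      using pos by (intro divide_left_mono mult_pos_pos) (auto intro: less_le_trans)
    also have "\<dots> = \<epsilon> * B / ((real n)\<^sup>2 * real n * w' i)" using pos \<epsilon> B by (simp add: field_simps)
    finally show ?thesis using that by (simp add: dball_def)
  qed
qed

lemma ball_cases:
  assumes "j \<in> dball i 0"
  obtains "j \<in> dball i (q i)" | r where "r < q i" "j \<in> dball i r - dball i (Suc r)"
proof (cases "j \<in> dball i (q i)")
  case False
  have "\<exists>r<m. j \<in> dball i r - dball i (Suc r)" if "j \<notin> dball i m" for m
    using that
  proof (induction m)
    case (Suc m)
    then show ?case by (cases "j \<in> dball i m") (auto intro: less_SucI)
  qed (use assms in simp)
  then show ?thesis using False that by blast
qed (use that in blast)

lemma ring_ratio:
  fixes x y :: real
  assumes "B0 i / (1 + \<epsilon>) ^ Suc r \<le> x" "y \<le> B0 i / (1 + \<epsilon>) ^ r"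
  shows "y \<le> (1 + \<epsilon>) * x"
proof -
  have "(1 + \<epsilon>) * (B0 i / (1 + \<epsilon>) ^ Suc r) = B0 i / (1 + \<epsilon>) ^ r" using \<epsilon> by simp
  moreover have "(1 + \<epsilon>) * (B0 i / (1 + \<epsilon>) ^ Suc r) \<le> (1 + \<epsilon>) * x"
    using assms(1) \<epsilon> by (intro mult_left_mono) auto
  ultimately show ?thesis using assms(2) by simp
qed

text \<open>A ring fixes a distance up to a factor \<open>1 + \<epsilon>\<close>, the innermost ball
  up to \<open>slack\<close>. Having two arbitrary solutions allows the transfer from
  \<open>d\<close> to the computed metric and back.\<close>

lemma feasible_compare:
  assumes "lp_feasible dball d1" "lp_feasible dball d2" "i \<in> I" "j \<in> dball i 0"
  shows "d1 i j \<le> (1 + \<epsilon>) * d2 i j + slack"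
  using assms(4)
proof (cases rule: ball_cases)
  case 1
  have "i \<in> P" "j \<in> P" using assms(3,4) by (auto simp: dball_def)
  then have "0 \<le> d2 i j" using assms(2) pmetric_onD(2) unfolding lp_feasible_def by blast
  moreover have "d1 i j \<le> slack"
    using assms(1,3) 1 small_le_slack[OF assms(3)] unfolding lp_feasible_def by fastforce
  ultimately show ?thesis using \<epsilon> by (simp add: add_increasing)
next
  case (2 r)
  have "B0 i / (1 + \<epsilon>) ^ Suc r \<le> d2 i j" "d1 i j \<le> B0 i / (1 + \<epsilon>) ^ r"
    using assms(1-3) 2 unfolding lp_feasible_def by blast+
  then show ?thesis using ring_ratio[of i r "d2 i j" "d1 i j"] slack_nonneg by simp
qed

lemma feasible_metric:
  assumes "lp_feasible dball d'"
  shows "pmetric_on P d'"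
  using assms unfolding lp_feasible_def by blast

text \<open>At least \<open>min (w i) l\<close> agents share the representative \<open>i\<close>,
  and so many equal entries can all be among the \<open>l\<close> counted ones; this is why weights
  are truncated at \<open>l\<close>. A cost of at most \<open>w' i * B0 i\<close> thus forces a
  center within \<open>B0 i\<close> of \<open>i\<close>.\<close>

lemma weight_le_cost:
  assumes "i \<in> I" "pmetric_on P d'" "S \<subseteq> P" "S \<noteq> {}"
  shows "w' i * set_dist d' i S \<le> wcost d' S"
proof -
  have "min (w i) l \<le> card {j \<in> C. t j = i}" using assms(1) by (auto simp: w)
  then obtain A where A: "A \<subseteq> {j \<in> C. t j = i}" "card A = min (w i) l"
    by (meson obtain_subset_with_card_n)
  have "w' i * set_dist d' i S = (\<Sum>j\<in>A. set_dist d' i S)" by (simp add: A(2) w'_def)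
  also have "\<dots> = (\<Sum>j\<in>A. set_dist d' (t j) S)" using A(1) by (intro sum.cong) auto
  also have "\<dots> \<le> wcost d' S"
    using A fin set_dist_nonneg[OF finP assms(2-4)] t_in_P by (intro sum_le_Top_on) auto
  finally show ?thesis .
qed

text \<open>Only the centers nearest under \<open>d2\<close> must lie in the resolved range, since
  any center gives an upper bound under \<open>d1\<close>. The error \<open>slack\<close> occurs in
  \<open>l \<le> n\<close> entries.\<close>

lemma wcost_compare:
  assumes "lp_feasible dball d1" "lp_feasible dball d2" "S \<subseteq> P" "S \<noteq> {}"
    and near: "\<And>i a. i \<in> I \<Longrightarrow> a \<in> S \<Longrightarrow> d2 i a = set_dist d2 i S \<Longrightarrow> a \<in> dball i 0"
  shows "wcost d1 S \<le> (1 + \<epsilon>) * wcost d2 S + real n * slack"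
proof -
  have "wcost d1 S \<le> (1 + \<epsilon>) * wcost d2 S + 1 * Top_on l C (\<lambda>_. slack)"
  proof (rule Top_on_linear_le[OF fin])
    fix j assume j: "j \<in> C"
    show "0 \<le> set_dist d2 (t j) S"
      using set_dist_nonneg[OF finP feasible_metric[OF assms(2)] assms(3,4) t_in_P[OF j]] .
    have finS: "finite S" using assms(3) finP finite_subset by blast
    obtain a where a: "a \<in> S" "set_dist d2 (t j) S = d2 (t j) a"
      using set_dist_attained[OF finS assms(4)] .
    have "set_dist d1 (t j) S \<le> d1 (t j) a" using finS a(1) by (rule set_dist_le)
    also have "\<dots> \<le> (1 + \<epsilon>) * d2 (t j) a + slack"
      using near[OF t_in_I[OF j] a(1)] a(2) by (intro feasible_compare[OF assms(1,2) t_in_I[OF j]]) simp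
    finally show "set_dist d1 (t j) S \<le> (1 + \<epsilon>) * set_dist d2 (t j) S + 1 * slack" using a(2) by simp
  qed (use \<epsilon> slack_nonneg in auto)
  moreover have "Top_on l C (\<lambda>_. slack) \<le> real l * slack"
    using fin slack_nonneg by (intro Top_on_const_le) auto
  moreover have "real l * slack \<le> real n * slack"
    using l slack_nonneg by (intro mult_right_mono) auto
  ultimately show ?thesis by simp
qed

text \<open>Each center \<open>s\<close> moves to its own favourite \<open>p s\<close> in
  \<open>P\<close>, which is no farther from \<open>s\<close> than \<open>t j\<close>. So the detour
  at most doubles the distance between \<open>t j\<close> and \<open>s\<close>, and the bound is
  \<open>2 * 214 + 2 = 430\<close> times \<open>opt\<close>.\<close>

lemma wcost_moved_centers:
  obtains S where "S \<subseteq> P" "S \<noteq> {}" "card S \<le> k" "wcost d S \<le> 430 * opt"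
proof -
  define p where "p s = t s" for s
  have finZ: "finite Z" using Z(1) fin finite_subset by blast
  have pZ: "p ` Z \<subseteq> P" "p ` Z \<noteq> {}" "card (p ` Z) \<le> k"
    using t_in_P Z card_image_le[OF finZ, of p] unfolding p_def by auto
  have "wcost d (p ` Z) \<le> 2 * Top_on l C (\<lambda>j. set_dist d j P) + 2 * Top_on l C (\<lambda>j. set_dist d j Z)"
  proof (rule Top_on_linear_le[OF fin])
    fix j assume j: "j \<in> C"
    have tj: "t j \<in> C" "t j \<in> P" using t_in_P[OF j] P by auto
    obtain s where s: "s \<in> Z" "set_dist d j Z = d j s" using set_dist_attained[OF finZ Z(2)] .
    have sC: "s \<in> C" and psC: "p s \<in> C" using s Z pZ P by auto
    show "0 \<le> set_dist d j P" using dist_t[OF j] met(2)[OF j tj(1)] by simp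
    show "0 \<le> set_dist d j Z" using s met(2)[OF j sC] by simp
    have "set_dist d (t j) (p ` Z) \<le> d (t j) (p s)" using finZ s by (intro set_dist_le) auto
    also have "\<dots> \<le> d (t j) s + d s (p s)" using met(4)[OF tj(1) sC psC] .
    also have "d s (p s) \<le> d s (t j)"
      using dist_t[OF sC] set_dist_le[OF finP tj(2), of d s] unfolding p_def by simp
    also have "d s (t j) = d (t j) s" using met(3)[OF sC tj(1)] .
    also have "d (t j) s \<le> d (t j) j + d j s" using met(4)[OF tj(1) j sC] .
    also have "d (t j) j = set_dist d j P" using met(3)[OF tj(1) j] dist_t[OF j] by simp
    finally show "set_dist d (t j) (p ` Z) \<le> 2 * set_dist d j P + 2 * set_dist d j Z"
      using s(2) by simp
  qed auto
  also have "\<dots> \<le> 430 * opt" using costP Z(4) by (simp add: cost_def)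
  finally show ?thesis using that[OF pZ] by blast
qed

lemma cost_le_wcost:
  assumes "S \<subseteq> P" "S \<noteq> {}"
  shows "cost l C d S \<le> cost l C d P + wcost d S"
proof -
  have finS: "finite S" using assms(1) finP finite_subset by blast
  have "Top_on l C (\<lambda>j. set_dist d j S) \<le> 1 * Top_on l C (\<lambda>j. set_dist d j P) + 1 * wcost d S"
  proof (rule Top_on_linear_le[OF fin])
    fix j assume j: "j \<in> C"
    have tj: "t j \<in> C" "t j \<in> P" using t_in_P[OF j] P by auto
    obtain a where a: "a \<in> S" "set_dist d (t j) S = d (t j) a" using set_dist_attained[OF finS assms(2)] .
    have aC: "a \<in> C" using a assms P by auto
    show "0 \<le> set_dist d j P" using dist_t[OF j] met(2)[OF j tj(1)] by simp
    show "0 \<le> set_dist d (t j) S" using a met(2)[OF tj(1) aC] by simp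
    have "set_dist d j S \<le> d j a" using finS a(1) by (rule set_dist_le)
    also have "\<dots> \<le> d j (t j) + d (t j) a" using met(4)[OF j tj(1) aC] .
    finally show "set_dist d j S \<le> 1 * set_dist d j P + 1 * set_dist d (t j) S"
      using a(2) dist_t[OF j] by simp
  qed auto
  then show ?thesis by (simp add: cost_def)
qed

lemma approx_cost:
  assumes "approx_alg k l \<rho> \<A>" "lp_feasible dball d'"
  defines "F \<equiv> \<A> P w d'"
  shows "F \<subseteq> P" "F \<noteq> {}" "card F \<le> k" "cost l C d F \<le> 2000 * \<rho> * opt"
proof -
  let ?\<S> = "{S. S \<subseteq> P \<and> S \<noteq> {} \<and> card S \<le> k}"
  have pm': "pmetric_on P d'" using assms(2) by (rule feasible_metric)
  have pre: "finite P \<and> P \<noteq> {} \<and> l \<le> sum w P \<and> pmetric_on P d'"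
    using finP P(2) pm' sum_w l by simp
  have alg: "F \<subseteq> P \<and> F \<noteq> {} \<and> card F \<le> k \<and>
      weighted_cost l P w d' F \<le> \<rho> * Min (weighted_cost l P w d' ` ?\<S>)"
    using assms(1)[unfolded approx_alg_def, rule_format, OF pre] unfolding F_def .
  then show F: "F \<subseteq> P" "F \<noteq> {}" "card F \<le> k" by auto
  have fin\<S>: "finite ?\<S>" using finP by simp
  have pmP: "pmetric_on P d" using true_metric_feasible by (rule feasible_metric)
  \<comment> \<open>\<open>M\<close> is optimal under the true distances among the sets with which
    the algorithm competes. It inherits the bound \<open>B\<close> from \<open>R\<close> and
    \<open>430 * opt\<close> from the moved centers.\<close>
  obtain M where M: "M \<in> ?\<S>" "\<And>S. S \<in> ?\<S> \<Longrightarrow> wcost d M \<le> wcost d S"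
  proof -
    have "wcost d ` ?\<S> \<noteq> {}" using R by auto
    then have "Min (wcost d ` ?\<S>) \<in> wcost d ` ?\<S>" using fin\<S> by (intro Min_in) auto
    then obtain M where M: "M \<in> ?\<S>" "Min (wcost d ` ?\<S>) = wcost d M" by (rule imageE) simp
    have "wcost d M \<le> wcost d S" if "S \<in> ?\<S>" for S
      unfolding M(2)[symmetric] using fin\<S> that by (intro Min_le finite_imageI imageI)
    then show ?thesis using that[OF M(1)] by simp
  qed
  have MP: "M \<subseteq> P" "M \<noteq> {}" using M(1) by auto
  have MB: "wcost d M \<le> B"
  proof -
    have "wcost d M \<le> wcost d R" using M(2)[of R] R by auto
    also have "\<dots> \<le> real l * (B / real l)"
      using fin B(1) R(4) t_in_P l by (intro Top_on_const_le) (auto simp: le_divide_eq mult.commute)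
    finally show ?thesis using l by simp
  qed
  have Mopt: "wcost d M \<le> 430 * opt"
  proof -
    obtain S where "S \<subseteq> P" "S \<noteq> {}" "card S \<le> k" "wcost d S \<le> 430 * opt" by (rule wcost_moved_centers)
    then show ?thesis using M(2)[of S] by auto
  qed
  have budget: "B \<le> \<rho> * (1 + 3 * \<epsilon>) * B"
  proof -
    have "1 * 1 \<le> \<rho> * (1 + 3 * \<epsilon>)" using \<rho> \<epsilon> by (intro mult_mono) auto
    then have "1 * B \<le> \<rho> * (1 + 3 * \<epsilon>) * B" using B(1) by (intro mult_right_mono) auto
    then show ?thesis by simp
  qed
  have dM: "wcost d' M \<le> (1 + \<epsilon>) * wcost d M + real n * slack"
  proof (rule wcost_compare[OF assms(2) true_metric_feasible MP])
    fix i a assume i: "i \<in> I" and a: "a \<in> M" "d i a = set_dist d i M"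
    have "w' i * d i a \<le> wcost d M" using weight_le_cost[OF i pmP MP] a(2) by simp
    also have "\<dots> \<le> w' i * B0 i" using MB budget w'_B0[OF i] by simp
    finally have "d i a \<le> B0 i" using w'_ge_1[OF i] by (simp add: mult_le_cancel_left)
    then show "a \<in> dball i 0" using a(1) MP by (auto simp: dball_def)
  qed
  have "wcost d' F \<le> \<rho> * Min (weighted_cost l P w d' ` ?\<S>)" using alg by (simp add: weighted_cost_eq)
  also have "\<dots> \<le> \<rho> * wcost d' M"
  proof (rule mult_left_mono)
    show "Min (weighted_cost l P w d' ` ?\<S>) \<le> wcost d' M"
      unfolding weighted_cost_eq[of d' M, symmetric] using M(1) fin\<S> by (intro Min_le finite_imageI imageI)
  qed (use \<rho> in simp)
  also have "\<dots> \<le> \<rho> * ((1 + \<epsilon>) * wcost d M + real n * slack)" using dM \<rho> by (intro mult_left_mono) auto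
  finally have F': "wcost d' F \<le> \<rho> * ((1 + \<epsilon>) * wcost d M + real n * slack)" .
  \<comment> \<open>Strictness comes from
    \<open>(1 + \<epsilon>) + \<epsilon> < 1 + 3 * \<epsilon>\<close>. It places the chosen centers
    nearer than \<open>B0 i\<close> under \<open>d'\<close>, whereas \<open>d'\<close> is at least
    \<open>B0 i\<close> outside the first ball.\<close>
  have F_lt: "wcost d' F < \<rho> * (1 + 3 * \<epsilon>) * B"
  proof -
    have "(1 + \<epsilon>) * wcost d M \<le> (1 + \<epsilon>) * B" using MB \<epsilon> by (intro mult_left_mono) auto
    then have "(1 + \<epsilon>) * wcost d M + real n * slack \<le> (1 + 2 * \<epsilon>) * B"
      using n_slack_le(1) by (simp add: algebra_simps)
    also have "\<dots> < (1 + 3 * \<epsilon>) * B" using \<epsilon> B(1) by simp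
    finally have "\<rho> * ((1 + \<epsilon>) * wcost d M + real n * slack) < \<rho> * ((1 + 3 * \<epsilon>) * B)"
      using \<rho> by (intro mult_strict_left_mono) auto
    then show ?thesis using F' by (simp add: mult.assoc)
  qed
  have dF: "wcost d F \<le> (1 + \<epsilon>) * wcost d' F + real n * slack"
  proof (rule wcost_compare[OF true_metric_feasible assms(2) F(1,2)])
    fix i a assume i: "i \<in> I" and a: "a \<in> F" "d' i a = set_dist d' i F"
    have "w' i * d' i a \<le> wcost d' F" using weight_le_cost[OF i pm' F(1,2)] a(2) by simp
    also have "\<dots> < w' i * B0 i" using F_lt w'_B0[OF i] by simp
    finally have lt: "d' i a < B0 i" using w'_ge_1[OF i] by (simp add: mult_less_cancel_left)
    show "a \<in> dball i 0"
    proof (rule ccontr)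
      assume "a \<notin> dball i 0"
      then have "a \<in> P - dball i 0" using a(1) F(1) by auto
      then have "B0 i \<le> d' i a" using assms(2) i unfolding lp_feasible_def by blast
      then show False using lt by simp
    qed
  qed
  \<comment> \<open>By \<open>\<epsilon> \<le> 1\<close> the factors are
    \<open>2 * 430 + 2 = 862\<close> before and \<open>2 * 862 = 1724\<close> after returning to the
    true distances.\<close>
  have "(1 + \<epsilon>) * wcost d M \<le> (1 + \<epsilon>) * (430 * opt)" using Mopt \<epsilon> by (intro mult_left_mono) auto
  also have "\<dots> \<le> 2 * (430 * opt)" using \<epsilon> opt_pos by (intro mult_right_mono) auto
  finally have "(1 + \<epsilon>) * wcost d M + real n * slack \<le> 862 * opt" using n_slack_le(2) by simp
  then have "\<rho> * ((1 + \<epsilon>) * wcost d M + real n * slack) \<le> \<rho> * (862 * opt)"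
    using \<rho> by (intro mult_left_mono) auto
  then have "wcost d' F \<le> \<rho> * (862 * opt)" using F' by simp
  then have "(1 + \<epsilon>) * wcost d' F \<le> (1 + \<epsilon>) * (\<rho> * (862 * opt))" using \<epsilon> by (intro mult_left_mono) auto
  also have "\<dots> \<le> 2 * (\<rho> * (862 * opt))" using \<epsilon> \<rho> opt_pos by (intro mult_right_mono) auto
  finally have "(1 + \<epsilon>) * wcost d' F \<le> 2 * (\<rho> * (862 * opt))" .
  then have "wcost d F \<le> 1724 * (\<rho> * opt) + 2 * opt" using dF n_slack_le(2) by simp
  then have "cost l C d F \<le> 216 * opt + 1724 * (\<rho> * opt)"
    using cost_le_wcost[OF F(1,2)] costP by simp
  also have "\<dots> \<le> 2000 * \<rho> * opt"
  proof -
    have "1 * opt \<le> \<rho> * opt" using \<rho> opt_pos by (intro mult_right_mono) auto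
    then show ?thesis using opt_pos by (simp add: algebra_simps)
  qed
  finally show "cost l C d F \<le> 2000 * \<rho> * opt" .
qed

text \<open>The balls found by queries are specified only for \<open>i \<in> I\<close> and
  \<open>r \<le> q i\<close>; the constraints read no others.\<close>

lemma lp_feasible_cong:
  assumes "\<And>i r. i \<in> I \<Longrightarrow> r \<le> q i \<Longrightarrow> S i r = dball i r"
  shows "lp_feasible S d' \<longleftrightarrow> lp_feasible dball d'"
  unfolding lp_feasible_def using assms by (intro conj_cong ball_cong refl) auto

lemma ensures_bb_top:
  assumes "approx_alg k l \<rho> \<A>" "card P < 2 ^ m"
  shows "ensures d (bb_top \<rho> \<epsilon> ((real n)\<^sup>2) n l P \<sigma> w B \<A>)
    (\<lambda>F Q. F \<subseteq> P \<and> F \<noteq> {} \<and> card F \<le> k \<and> cost l C d F \<le> 2000 * \<rho> * opt \<and>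
       (\<forall>i. count Q i \<le> Suc (ring_number \<rho> \<epsilon> n) * m))"
proof -
  let ?q = "ring_number \<rho> \<epsilon> n"
  have eq: "bb_top \<rho> \<epsilon> ((real n)\<^sup>2) n l P \<sigma> w B \<A> = do {
       S \<leftarrow> for_each I (\<lambda>i. for_each {0..q i} (\<lambda>r. query_ball \<sigma> P i (B0 i / (1 + \<epsilon>) ^ r)));
       Return (\<A> P w (SOME d'. lp_feasible S d')) }"
    unfolding bb_top_def Let_def lp_feasible_def w'_def B0_def q_def ..
  have inner: "ensures d (for_each {0..q i} (\<lambda>r. query_ball \<sigma> P i (B0 i / (1 + \<epsilon>) ^ r)))
      (\<lambda>g Q. (\<forall>r\<in>{0..q i}. g r = dball i r) \<and> (\<forall>x. count Q x \<le> (if x = i then Suc ?q * m else 0)))"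
    if i: "i \<in> I" for i
  proof (rule ensures_mono)
    show "ensures d (for_each {0..q i} (\<lambda>r. query_ball \<sigma> P i (B0 i / (1 + \<epsilon>) ^ r)))
      (\<lambda>g Q. (\<forall>r\<in>{0..q i}. g r = dball i r) \<and> (\<forall>x. count Q x \<le> (\<Sum>r\<in>{0..q i}. if x = i then m else 0)))"
    proof (rule ensures_for_each)
      fix r
      have "i \<in> C" using i P by auto
      from ensures_query_ball[OF cons this finP P(1) assms(2)]
      show "ensures d (query_ball \<sigma> P i (B0 i / (1 + \<epsilon>) ^ r))
        (\<lambda>S Q. S = dball i r \<and> (\<forall>x. count Q x \<le> (if x = i then m else 0)))"
        unfolding dball_def .
    qed simp
    fix g Q
    assume "(\<forall>r\<in>{0..q i}. g r = dball i r) \<and> (\<forall>x. count Q x \<le> (\<Sum>r\<in>{0..q i}. if x = i then m else 0))"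
    moreover have "(\<Sum>r\<in>{0..q i}. if x = i then m else 0) = (if x = i then Suc ?q * m else 0)" for x
      using q_eq[OF i] by simp
    ultimately show "(\<forall>r\<in>{0..q i}. g r = dball i r) \<and> (\<forall>x. count Q x \<le> (if x = i then Suc ?q * m else 0))"
      by simp
  qed
  show ?thesis unfolding eq
  proof (rule ensures_bind[OF ensures_for_each])
    show "finite I" using finP by simp
    show "ensures d (for_each {0..q i} (\<lambda>r. query_ball \<sigma> P i (B0 i / (1 + \<epsilon>) ^ r)))
      (\<lambda>g Q. (\<forall>r\<in>{0..q i}. g r = dball i r) \<and> (\<forall>x. count Q x \<le> (if x = i then Suc ?q * m else 0)))"
      if "i \<in> I" for i using inner[OF that] .
  next
    fix S and Q :: "nat multiset"
    assume S: "(\<forall>i\<in>I. \<forall>r\<in>{0..q i}. S i r = dball i r) \<and>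
      (\<forall>x. count Q x \<le> (\<Sum>i\<in>I. if x = i then Suc ?q * m else 0))"
    have "lp_feasible S d' \<longleftrightarrow> lp_feasible dball d'" for d'
      using S by (intro lp_feasible_cong) auto
    then have feas: "lp_feasible dball (SOME d'. lp_feasible S d')"
      using true_metric_feasible by (simp add: someI)
    have "count Q x \<le> Suc ?q * m" for x
    proof -
      have "count Q x \<le> (\<Sum>i\<in>I. if x = i then Suc ?q * m else 0)" using S by blast
      also have "\<dots> \<le> Suc ?q * m" using finP by (simp add: sum.delta)
      finally show ?thesis .
    qed
    then show "ensures d (Return (\<A> P w (SOME d'. lp_feasible S d')))
      (\<lambda>F Q'. F \<subseteq> P \<and> F \<noteq> {} \<and> card F \<le> k \<and> cost l C d F \<le> 2000 * \<rho> * opt \<and>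
         (\<forall>i. count (Q + Q') i \<le> Suc ?q * m))"
      using approx_cost[OF assms(1) feas] by (intro ensures_Return) simp
  qed
qed

end

section \<open>Meyerson-BB\<close>

text \<open>One member of \<open>P\<close> is taken from each component meeting \<open>P\<close>.
  Linked agents are at distance at most the total edge cost \<open>B / card C\<close>, and
  \<open>l \<le> card C\<close>.\<close>

lemma component_representatives:
  assumes "finite C" "pmetric_on C d" "boruvka_result C k d B F" "P \<subseteq> C" "P \<noteq> {}" "l \<le> card C"
  obtains R where "R \<subseteq> P" "R \<noteq> {}" "card R \<le> k" "\<forall>i\<in>P. real l * set_dist d i R \<le> B"
proof -
  have F: "finite F" "priced_edges C d F" "card (components C F) = k"
    "B = real (card C) * (\<Sum>e\<in>F. fst e)"
    using assms(3) unfolding boruvka_result_def by auto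
  define rep where "rep K = (SOME x. x \<in> K \<inter> P)" for K
  have rep: "rep (component C F i) \<in> component C F i \<inter> P" if "i \<in> P" for i
  proof -
    have "i \<in> component C F i \<inter> P" using that assms(4) component_self by auto
    then show ?thesis unfolding rep_def by (rule someI)
  qed
  let ?R = "rep ` component C F ` P"
  have finP: "finite P" using assms(1,4) finite_subset by blast
  have sub: "?R \<subseteq> P" using rep by auto
  have "component C F ` P \<subseteq> components C F" using assms(4) unfolding components_def by auto
  then have "card (component C F ` P) \<le> k"
    using card_mono[OF finite_components[OF assms(1)]] F(3) by metis
  then have card: "card ?R \<le> k" using card_image_le[of "component C F ` P" rep] finP by simp
  have dist: "real l * set_dist d i ?R \<le> B" if i: "i \<in> P" for i
  proof -
    have iC: "i \<in> C" using i assms(4) by auto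
    have "set_dist d i ?R \<le> d i (rep (component C F i))" using i finP by (intro set_dist_le) auto
    also have "\<dots> \<le> (\<Sum>e\<in>F. fst e)"
      using rep[OF i] by (intro dist_le_forest_cost[OF assms(2) F(1,2) iC]) (simp add: in_component_iff)
    finally have le: "set_dist d i ?R \<le> (\<Sum>e\<in>F. fst e)" .
    have nn: "0 \<le> (\<Sum>e\<in>F. fst e)" using priced_edges_nonneg[OF assms(2) F(2)] by (intro sum_nonneg)
    have "real l * set_dist d i ?R \<le> real l * (\<Sum>e\<in>F. fst e)" using le by (intro mult_left_mono) auto
    also have "\<dots> \<le> real (card C) * (\<Sum>e\<in>F. fst e)" using assms(6) nn by (intro mult_right_mono) auto
    finally show ?thesis using F(4) by simp
  qed
  show ?thesis using that[OF sub _ card] dist assms(5) by auto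
qed

lemma colocated_components:
  assumes "finite C" "pmetric_on C d" "boruvka_result C k d 0 F" "C \<noteq> {}"
  shows "Min ` components C F \<noteq> {}" "Min ` components C F \<subseteq> C" "card (Min ` components C F) \<le> k"
    "cost l C d (Min ` components C F) \<le> 0"
proof -
  have "card C \<noteq> 0" using assms(1,4) by simp
  then have F: "finite F" "priced_edges C d F" "card (components C F) = k" "(\<Sum>e\<in>F. fst e) = 0"
    using assms(3) unfolding boruvka_result_def by auto
  have fin: "finite (components C F)" by (rule finite_components[OF assms(1)])
  have Min: "Min K \<in> K" if "K \<in> components C F" for K
    using components_subset[OF that] finite_subset[OF _ assms(1)] by (intro Min_in) auto
  show "Min ` components C F \<noteq> {}" using assms(4) by (simp add: components_def)
  show "Min ` components C F \<subseteq> C" using Min components_subset by blast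
  show "card (Min ` components C F) \<le> k" using card_image_le[OF fin, of Min] F(3) by simp
  have "set_dist d i (Min ` components C F) \<le> 0" if i: "i \<in> C" for i
  proof -
    have K: "component C F i \<in> components C F" using i by (simp add: components_def)
    have "set_dist d i (Min ` components C F) \<le> d i (Min (component C F i))"
      using fin K by (intro set_dist_le) auto
    also have "\<dots> \<le> (\<Sum>e\<in>F. fst e)"
      using Min[OF K] by (intro dist_le_forest_cost[OF assms(2) F(1,2) i]) (simp add: in_component_iff)
    finally show ?thesis using F(4) by simp
  qed
  then have "cost l C d (Min ` components C F) \<le> real l * 0"
    unfolding cost_def using assms(1) by (intro Top_on_const_le) auto
  then show "cost l C d (Min ` components C F) \<le> 0" by simp
qed

lemma OPT_attained:
  assumes "finite C" "1 \<le> k" "k \<le> card C"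
  obtains Z where "Z \<subseteq> C" "Z \<noteq> {}" "card Z \<le> k" "cost l C d Z = OPT k l C d"
proof -
  let ?\<S> = "{S. S \<subseteq> C \<and> S \<noteq> {} \<and> card S \<le> k}"
  have fin: "finite ?\<S>" using assms(1) by simp
  obtain x where "x \<in> C" using assms(2,3) by fastforce
  then have "{x} \<in> ?\<S>" using assms(2) by auto
  then have "OPT k l C d \<in> cost l C d ` ?\<S>" unfolding OPT_def using fin by (intro Min_in) auto
  then obtain S where "S \<in> ?\<S>" "OPT k l C d = cost l C d S" by (rule imageE) simp
  then show ?thesis using that[of S] by simp
qed

lemma OPT_le:
  assumes "finite C" "S \<subseteq> C" "S \<noteq> {}" "card S \<le> k"
  shows "OPT k l C d \<le> cost l C d S"
  unfolding OPT_def using assms by (intro Min_le) auto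

lemma set_dist_le_cost:
  assumes "finite C" "pmetric_on C d" "S \<subseteq> C" "S \<noteq> {}" "1 \<le> l" "i \<in> C"
  shows "set_dist d i S \<le> cost l C d S" "0 \<le> set_dist d i S"
proof -
  note nn = set_dist_nonneg[OF assms(1-4)]
  show "0 \<le> set_dist d i S" using nn[OF assms(6)] .
  have "(\<Sum>j\<in>{i}. set_dist d j S) \<le> cost l C d S"
    unfolding cost_def using assms nn by (intro sum_le_Top_on) auto
  then show "set_dist d i S \<le> cost l C d S" by simp
qed

text \<open>\<open>OPT\<close> is at most \<open>B\<close> by one representative per component.
  Conversely, as \<open>l \<ge> 1\<close>, no agent is farther than \<open>OPT\<close> from an
  optimal solution, so \<open>OPT\<close> is an admissible radius in
  \<open>boruvka_result\<close>.\<close>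

lemma boruvka_estimate:
  assumes "finite C" "pmetric_on C d" "boruvka_result C k d B F"
    and "1 \<le> k" "k \<le> card C" "1 \<le> l" "l \<le> card C"
  shows "OPT k l C d \<le> B" "B \<le> 2 * (real (card C))\<^sup>2 * OPT k l C d" "0 \<le> OPT k l C d" "0 \<le> B"
proof -
  have ne: "C \<noteq> {}" using assms(4,5) by auto
  obtain Z where Z: "Z \<subseteq> C" "Z \<noteq> {}" "card Z \<le> k" "cost l C d Z = OPT k l C d"
    using OPT_attained[OF assms(1,4,5)] .
  have le: "set_dist d i Z \<le> OPT k l C d" "0 \<le> set_dist d i Z" if "i \<in> C" for i
    using set_dist_le_cost[OF assms(1,2) Z(1,2) assms(6) that] Z(4) by auto
  obtain x where x: "x \<in> C" using ne by auto
  show nn: "0 \<le> OPT k l C d" using le[OF x] by simp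
  show "B \<le> 2 * (real (card C))\<^sup>2 * OPT k l C d"
    using assms(3) Z(1-3) le(1) nn unfolding boruvka_result_def by blast
  obtain R where R: "R \<subseteq> C" "R \<noteq> {}" "card R \<le> k" "\<forall>i\<in>C. real l * set_dist d i R \<le> B"
    using component_representatives[OF assms(1-3) subset_refl ne assms(7)] .
  have "0 \<le> real l * set_dist d x R"
    using set_dist_le_cost(2)[OF assms(1,2) R(1,2) assms(6) x] by simp
  then show B: "0 \<le> B" using R(4) x by (meson bspec order_trans)
  have "OPT k l C d \<le> cost l C d R" using R by (intro OPT_le[OF assms(1)])
  also have "\<dots> \<le> real l * (B / real l)"
    unfolding cost_def using assms(1,6) B R(4)
    by (intro Top_on_const_le) (auto simp: le_divide_eq mult.commute)
  finally show "OPT k l C d \<le> B" using assms(6) by simp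
qed

lemma le_two_power_log:
  fixes x :: real
  assumes "0 < x"
  shows "x \<le> 2 ^ nat \<lceil>log 2 x\<rceil>"
proof -
  have "x = 2 powr log 2 x" using assms by simp
  also have "\<dots> \<le> 2 powr real (nat \<lceil>log 2 x\<rceil>)" by (intro powr_mono) linarith+
  finally show ?thesis by (simp only: powr_realpow zero_less_numeral)
qed

text \<open>Take the smallest guess reaching \<open>opt\<close>. If it is the first one, it is
  \<open>B / x \<le> 2 * opt\<close>; otherwise its half is the previous guess, which is below
  \<open>opt\<close>.\<close>

lemma good_guess:
  fixes B opt x :: real
  assumes "0 < opt" "opt \<le> B" "B \<le> 2 * x * opt" "1 \<le> x"
  obtains i where "i < Suc (nat \<lceil>log 2 x\<rceil>)" "opt \<le> 2 ^ i * B / x" "2 ^ i * B / x \<le> 2 * opt"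
proof -
  let ?N = "nat \<lceil>log 2 x\<rceil>"
  have x: "x \<le> 2 ^ ?N" using assms(4) by (intro le_two_power_log) simp
  have B: "0 < B" using assms by simp
  have "x * B \<le> 2 ^ ?N * B" using x B by (intro mult_right_mono) auto
  moreover have "x * opt \<le> x * B" using assms(2,4) by (intro mult_left_mono) auto
  ultimately have "opt * x \<le> 2 ^ ?N * B" unfolding mult.commute[of opt x] by (rule order_trans[rotated])
  then have N: "opt \<le> 2 ^ ?N * B / x" using assms(4) by (simp only: le_divide_eq) simp
  define i where "i = (LEAST i. opt \<le> 2 ^ i * B / x)"
  have "i \<le> ?N" unfolding i_def using N by (rule Least_le)
  moreover have "opt \<le> 2 ^ i * B / x" unfolding i_def using N by (rule LeastI)
  moreover have "2 ^ i * B / x \<le> 2 * opt"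
  proof (cases i)
    case 0
    then show ?thesis using assms by (simp add: divide_le_eq mult_ac)
  next
    case (Suc j)
    then have "\<not> opt \<le> 2 ^ j * B / x" unfolding i_def by (intro not_less_Least) simp
    then show ?thesis using Suc by simp
  qed
  ultimately show ?thesis using that[of i] by simp
qed

definition best_candidate :: "nat set \<times> real \<Rightarrow> (nat set \<times> real) list list \<Rightarrow> nat set" where
  "best_candidate s ys = fst (arg_min_list snd (s # concat ys))"

lemma best_candidate:
  assumes "\<And>S c. (S, c) = s \<or> (\<exists>y\<in>set ys. (S, c) \<in> set y) \<Longrightarrow> Q S \<and> c = g S"
  shows "Q (best_candidate s ys)"
    and "y \<in> set ys \<Longrightarrow> (S, c) \<in> set y \<Longrightarrow> g (best_candidate s ys) \<le> c"
proof -
  let ?l = "s # concat ys"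
  obtain P c0 where Pc: "arg_min_list snd ?l = (P, c0)" by (cases "arg_min_list snd ?l")
  then have P: "best_candidate s ys = P" by (simp add: best_candidate_def)
  have "arg_min_list snd ?l \<in> set ?l" by (rule arg_min_list_in) simp
  then have "(P, c0) = s \<or> (\<exists>y\<in>set ys. (P, c0) \<in> set y)" unfolding Pc by auto
  from assms[OF this] have Q: "Q P" "c0 = g P" by auto
  then show "Q (best_candidate s ys)" using P by simp
  show "g (best_candidate s ys) \<le> c" if "y \<in> set ys" "(S, c) \<in> set y"
  proof -
    have "c0 = Min (snd ` set ?l)" using f_arg_min_list_f[of ?l snd] Pc by simp
    also have "\<dots> \<le> snd (S, c)" using that by (intro Min_le imageI) auto
    finally show ?thesis using P Q by simp
  qed
qed

text \<open>The mechanism after Boruvka. Splitting it off allows the analysis to fix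
  \<open>B\<close> as a parameter.\<close>

definition search_and_round ::
    "nat set \<Rightarrow> nat \<Rightarrow> nat \<Rightarrow> real \<Rightarrow> real \<Rightarrow> nat set \<Rightarrow> profile \<Rightarrow> centrum_alg \<Rightarrow> real \<Rightarrow> real \<Rightarrow> nat set mech" where
  "search_and_round C k l \<rho> \<epsilon> S0 \<sigma> \<A> \<delta> B = do {
     v0 \<leftarrow> distance_vector C \<sigma> S0;
     cands \<leftarrow> map_mech (\<lambda>(i, j). attempt C k l \<sigma> (2 ^ i * B / (real (card C))\<^sup>2))
       (List.product [0..<Suc (nat \<lceil>log 2 ((real (card C))\<^sup>2)\<rceil>)] [0..<nat \<lceil>log 2 (1 / \<delta>)\<rceil>]);
     let P = best_candidate (S0, Top l {# v0 i. i \<in># mset_set C #}) cands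
     in bb_top \<rho> \<epsilon> ((real (card C))\<^sup>2) (card C) l P \<sigma>
          (\<lambda>i. if i \<in> P then card {j \<in> C. top_of \<sigma> P j = i} else 0) B \<A> }"

lemma meyerson_bb_eq:
  "meyerson_bb C k l \<rho> \<epsilon> \<tau> S0 \<sigma> \<A> \<delta> =
     bind_mech (boruvka C k \<sigma> \<tau>) (\<lambda>r. if fst r = 0 then Return (Min ` components C (snd r))
       else search_and_round C k l \<rho> \<epsilon> S0 \<sigma> \<A> \<delta> (fst r))"
  unfolding meyerson_bb_def search_and_round_def best_candidate_def attempt_def evaluate_def Let_def
  by (intro arg_cong2[where f = bind_mech] refl ext) (simp add: case_prod_beta)

locale centrum_instance =
  fixes C :: "nat set" and k l :: nat and d :: dist_fun and \<sigma> :: profile and \<A> :: centrum_alg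
    and \<delta> \<rho> \<epsilon> B :: real and F :: "edge set" and S0 :: "nat set"
  assumes fin: "finite C" and k: "1 \<le> k" "k \<le> card C" and l: "1 \<le> l" "l \<le> card C"
    and pm: "pmetric_on C d" and cons: "consistent_profile C \<sigma> d" and alg: "approx_alg k l \<rho> \<A>"
    and \<delta>: "0 < \<delta>" "\<delta> < 1" and \<rho>: "1 \<le> \<rho>" and \<epsilon>: "0 < \<epsilon>" "\<epsilon> \<le> 1"
    and S0: "S0 \<subseteq> C" "card S0 = k" and bor: "boruvka_result C k d B F" and B: "B \<noteq> 0"
begin

abbreviation opt :: real where "opt \<equiv> OPT k l C d"
abbreviation guess :: "nat \<Rightarrow> real" where "guess i \<equiv> 2 ^ i * B / (real (card C))\<^sup>2"
abbreviation runs :: "(nat \<times> nat) list" where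
  "runs \<equiv> List.product [0..<Suc (nat \<lceil>log 2 ((real (card C))\<^sup>2)\<rceil>)] [0..<nat \<lceil>log 2 (1 / \<delta>)\<rceil>]"
abbreviation round_on :: "nat set \<Rightarrow> nat set mech" where
  "round_on P \<equiv> bb_top \<rho> \<epsilon> ((real (card C))\<^sup>2) (card C) l P \<sigma>
     (\<lambda>i. if i \<in> P then card {j \<in> C. top_of \<sigma> P j = i} else 0) B \<A>"

definition good :: "nat set \<Rightarrow> bool" where
  "good S \<longleftrightarrow> S \<noteq> {} \<and> S \<subseteq> C \<and> card S \<le> k \<and> cost l C d S \<le> 2000 * \<rho> * opt"

text \<open>Number of radii times number of probes. Rounding down and adding one gives the strict
  inequality on the list length that the binary search needs.\<close>

definition round_queries :: nat where
  "round_queries = Suc (ring_number \<rho> \<epsilon> (card C))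
     * Suc (nat \<lfloor>log 2 (104 * real k)\<rfloor>)"

lemma est: "opt \<le> B" "B \<le> 2 * (real (card C))\<^sup>2 * opt" "0 < opt" "0 < B"
proof -
  note e = boruvka_estimate[OF fin pm bor k l]
  show "opt \<le> B" "B \<le> 2 * (real (card C))\<^sup>2 * opt" "0 < B" using e B by auto
  then show "0 < opt" using e(3) B by (cases "opt = 0") auto
qed

lemma ensures_round_on:
  assumes "admissible C k P" "opt \<le> opt'" "cost l C d P \<le> 214 * opt'"
  shows "ensures d (round_on P) (\<lambda>S Q. S \<subseteq> P \<and> S \<noteq> {} \<and> card S \<le> k \<and>
    cost l C d S \<le> 2000 * \<rho> * opt' \<and> (\<forall>i. count Q i \<le> round_queries))"
proof -
  have adm: "P \<subseteq> C" "P \<noteq> {}" "card P \<le> 104 * k" using assms(1) unfolding admissible_def by auto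
  obtain Z where Z: "Z \<subseteq> C" "Z \<noteq> {}" "card Z \<le> k" "cost l C d Z = opt"
    using OPT_attained[OF fin k] .
  obtain R where R: "R \<subseteq> P" "R \<noteq> {}" "card R \<le> k" "\<forall>i\<in>P. real l * set_dist d i R \<le> B"
    using component_representatives[OF fin pm bor adm(1,2) l(2)] .
  have "2 * (real (card C))\<^sup>2 * opt \<le> 2 * (real (card C))\<^sup>2 * opt'"
    using assms(2) by (intro mult_left_mono) auto
  then have B_le: "B \<le> 2 * (real (card C))\<^sup>2 * opt'" using est(2) by simp
  let ?w = "\<lambda>i. if i \<in> P then card {j \<in> C. top_of \<sigma> P j = i} else 0"
  interpret bb_instance C P d \<sigma> k l "card C" \<rho> \<epsilon> B opt' ?w R Z
    using fin pm cons adm l \<rho> \<epsilon> est B_le R Z assms(2,3) by unfold_locales auto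
  let ?m = "Suc (nat \<lfloor>log 2 (104 * real k)\<rfloor>)"
  have "card P < 2 ^ ?m"
  proof -
    have "real (card P) \<le> 104 * real k" using adm(3) by linarith
    also have "\<dots> < 2 powr real ?m"
    proof -
      have "0 \<le> log 2 (104 * real k)" using k by simp
      then have "log 2 (104 * real k) < real ?m" by linarith
      then show ?thesis using k by (simp add: log_less_iff)
    qed
    also have "\<dots> = real (2 ^ ?m)" by (simp only: powr_realpow) simp
    finally show ?thesis by linarith
  qed
  from ensures_bb_top[OF alg this] show ?thesis unfolding round_queries_def .
qed

text \<open>
  The query bound is needed for bad candidates, too. They are covered since \<open>opt'\<close> may be any upper bound on
  the optimum.
\<close>

lemma count_round_on:
  assumes "admissible C k P"
  shows "ensures d (round_on P) (\<lambda>S Q. \<forall>i. count Q i \<le> round_queries)"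
  by (rule ensures_mono[OF ensures_round_on[OF assms, of "max opt (cost l C d P)"]])
     (use est(3) in auto)

lemma good_round_on:
  assumes "admissible C k P" "cost l C d P \<le> 214 * opt"
  shows "ensures d (round_on P) (\<lambda>S Q. good S)"
  by (rule ensures_mono[OF ensures_round_on[OF assms(1) order_refl assms(2)]])
     (use assms(1) in \<open>auto simp: good_def admissible_def\<close>)

lemma ne: "C \<noteq> {}"
  using k by auto

lemma S0_ne: "S0 \<noteq> {}"
  using S0 k by auto

lemma admissible_S0: "admissible C k S0"
  using S0 S0_ne unfolding admissible_def by simp

lemma ensures_candidates:
  "ensures d (map_mech (\<lambda>(i, j). attempt C k l \<sigma> (guess i)) runs)
    (\<lambda>ys Q. (\<forall>y\<in>set ys. \<forall>(S, c)\<in>set y. admissible C k S \<and> c = cost l C d S) \<and> (\<forall>i. count Q i \<le> 2 * length runs))"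
proof (rule ensures_mono)
  show "ensures d (map_mech (\<lambda>(i, j). attempt C k l \<sigma> (guess i)) runs)
    (\<lambda>ys Q. list_all2 (\<lambda>x y. \<forall>(S, c)\<in>set y. admissible C k S \<and> c = cost l C d S) runs ys \<and>
       (\<forall>i. count Q i \<le> (\<Sum>x\<leftarrow>runs. 2)))"
  proof (rule ensures_map_mech)
    fix x assume "x \<in> set runs"
    from ensures_attempt[OF cons fin ne]
    show "ensures d (case x of (i, j) \<Rightarrow> attempt C k l \<sigma> (guess i))
       (\<lambda>r Q. (\<forall>(S, c)\<in>set r. admissible C k S \<and> c = cost l C d S) \<and> (\<forall>i. count Q i \<le> 2))"
      by (simp add: case_prod_beta)
  qed
next
  fix ys Q
  assume *: "list_all2 (\<lambda>x y. \<forall>(S, c)\<in>set y. admissible C k S \<and> c = cost l C d S) runs ys \<and>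
       (\<forall>i. count Q i \<le> (\<Sum>x\<leftarrow>runs. 2))"
  have "\<forall>y\<in>set ys. \<forall>(S, c)\<in>set y. admissible C k S \<and> c = cost l C d S"
  proof
    fix y assume "y \<in> set ys"
    then obtain m where "m < length ys" "y = ys ! m" by (auto simp: in_set_conv_nth)
    then show "\<forall>(S, c)\<in>set y. admissible C k S \<and> c = cost l C d S"
      using * list_all2_nthD2[of _ runs ys m] by blast
  qed
  then show "(\<forall>y\<in>set ys. \<forall>(S, c)\<in>set y. admissible C k S \<and> c = cost l C d S) \<and> (\<forall>i. count Q i \<le> 2 * length runs)"
    using * by (simp add: sum_list_triv mult.commute)
qed

lemma Top_S0:
  assumes "\<forall>i\<in>C. v i = set_dist d i S0"
  shows "Top l {# v i. i \<in># mset_set C #} = cost l C d S0"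
  unfolding cost_def using assms fin by (intro arg_cong[of _ _ "Top l"] image_mset_cong) auto

lemma admissible_best:
  assumes "\<forall>y\<in>set ys. \<forall>(S, c)\<in>set y. admissible C k S \<and> c = cost l C d S"
  shows "admissible C k (best_candidate (S0, cost l C d S0) ys)"
    and "y \<in> set ys \<Longrightarrow> (S, c) \<in> set y \<Longrightarrow> cost l C d (best_candidate (S0, cost l C d S0) ys) \<le> c"
proof -
  have *: "admissible C k S \<and> c = cost l C d S"
    if "(S, c) = (S0, cost l C d S0) \<or> (\<exists>y\<in>set ys. (S, c) \<in> set y)" for S c
    using that assms admissible_S0 by auto
  show "admissible C k (best_candidate (S0, cost l C d S0) ys)"
    using * by (rule best_candidate(1))
  show "y \<in> set ys \<Longrightarrow> (S, c) \<in> set y \<Longrightarrow> cost l C d (best_candidate (S0, cost l C d S0) ys) \<le> c"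
    using best_candidate(2)[of "(S0, cost l C d S0)" ys "admissible C k" "cost l C d" y S c, OF *] .
qed

lemma count_search_and_round:
  "ensures d (search_and_round C k l \<rho> \<epsilon> S0 \<sigma> \<A> \<delta> B)
     (\<lambda>S Q. \<forall>i. count Q i \<le> 1 + 2 * length runs + round_queries)"
  unfolding search_and_round_def Let_def
proof (rule ensures_bind[OF ensures_distance_vector[OF cons fin S0_ne S0(1)]],
    rule ensures_bind[OF ensures_candidates])
  fix v ys and Q Q' :: "nat multiset"
  assume v: "(\<forall>i\<in>C. v i = set_dist d i S0) \<and> (\<forall>i. count Q i \<le> 1)"
    and ys: "(\<forall>y\<in>set ys. \<forall>(S, c)\<in>set y. admissible C k S \<and> c = cost l C d S) \<and> (\<forall>i. count Q' i \<le> 2 * length runs)"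
  have eq: "Top l {# v i. i \<in># mset_set C #} = cost l C d S0" using v by (intro Top_S0) simp
  have "admissible C k (best_candidate (S0, cost l C d S0) ys)" using ys by (intro admissible_best(1)) simp
  note count = count_round_on[OF this]
  show "ensures d (round_on (best_candidate (S0, Top l {# v i. i \<in># mset_set C #}) ys))
     (\<lambda>S Q''. \<forall>i. count (Q + (Q' + Q'')) i \<le> 1 + 2 * length runs + round_queries)"
    unfolding eq
  proof (rule ensures_mono[OF count], intro allI)
    fix S and Q'' :: "nat multiset" and i
    assume "\<forall>i. count Q'' i \<le> round_queries"
    then have "count Q'' i \<le> round_queries" "count Q i \<le> 1" "count Q' i \<le> 2 * length runs"
      using v ys by blast+
    then show "count (Q + (Q' + Q'')) i \<le> 1 + 2 * length runs + round_queries"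
      by (simp only: count_union)
  qed
qed

text \<open>\<open>214\<close> is \<open>2 * 107\<close>, since the useful guess is at most
  \<open>2 * opt\<close>. Only the runs with that guess are counted; there are
  \<open>log 2 (1 / \<delta>)\<close> of them, rounded up.\<close>

lemma prob_no_good_candidate:
  "measure_pmf.prob (map_pmf fst (run d (map_mech (\<lambda>(i, j). attempt C k l \<sigma> (guess i)) runs)))
     {ys. \<forall>y\<in>set ys. y \<in> {y. \<forall>(S, c)\<in>set y. 214 * opt < c}} \<le> \<delta>"
proof -
  have n2: "1 \<le> (real (card C))\<^sup>2" using k by simp
  obtain i0 where i0: "i0 < Suc (nat \<lceil>log 2 ((real (card C))\<^sup>2)\<rceil>)" "opt \<le> guess i0" "guess i0 \<le> 2 * opt"
    using good_guess[OF est(3,1,2) n2] .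
  obtain Z where Z: "Z \<subseteq> C" "Z \<noteq> {}" "card Z \<le> k" "cost l C d Z = opt"
    using OPT_attained[OF fin k] .
  interpret meyerson_guess C d k l "guess i0" Z
    using fin pm k l Z i0 est(3) by unfold_locales (auto simp: cost_def)
  let ?M = "nat \<lceil>log 2 (1 / \<delta>)\<rceil>"
  have "measure_pmf.prob (map_pmf fst (run d (map_mech (\<lambda>(i, j). attempt C k l \<sigma> (guess i)) runs)))
     {ys. \<forall>y\<in>set ys. y \<in> {y. \<forall>(S, c)\<in>set y. 214 * opt < c}} \<le> (1 / 2) ^ length (filter (\<lambda>x. fst x = i0) runs)"
  proof (rule prob_map_mech_none_le)
    fix x :: "nat \<times> nat" assume x: "fst x = i0"
    have "measure_pmf.prob (map_pmf fst (run d (attempt C k l \<sigma> (guess i0)))) {y. \<forall>(S, c)\<in>set y. 214 * opt < c}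
      \<le> measure_pmf.prob (map_pmf fst (run d (attempt C k l \<sigma> (guess i0)))) {y. \<forall>(S, c)\<in>set y. 107 * guess i0 < c}"
      using i0(3) by (intro measure_pmf.finite_measure_mono) fastforce+
    also have "\<dots> \<le> 1 / 2" by (rule prob_attempt_fails[OF cons ne])
    finally show "measure_pmf.prob (map_pmf fst (run d (case x of (i, j) \<Rightarrow> attempt C k l \<sigma> (guess i))))
        {y. \<forall>(S, c)\<in>set y. 214 * opt < c} \<le> 1 / 2"
      using x by (simp only: case_prod_beta)
  qed
  also have "length (filter (\<lambda>x. fst x = i0) runs) = ?M"
  proof -
    have "length (filter (\<lambda>x. fst x = i0) (List.product xs ys)) = length (filter (\<lambda>i. i = i0) xs) * length ys"
      for xs ys :: "nat list"
      by (induction xs) (auto simp: filter_map comp_def)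
    moreover have "length (filter (\<lambda>i. i = i0) [0..<N]) = 1" if "i0 < N" for N
    proof -
      have "length (filter (\<lambda>i. i = i0) [0..<N]) = card {i. i < N \<and> i = i0}"
        by (simp add: length_filter_conv_card cong: conj_cong)
      also have "{i. i < N \<and> i = i0} = {i0}" using that by auto
      finally show ?thesis by simp
    qed
    ultimately show ?thesis using i0(1) by simp
  qed
  also have "(1 / 2) ^ ?M \<le> \<delta>"
  proof -
    have "1 / \<delta> \<le> 2 ^ ?M" using \<delta> by (intro le_two_power_log) simp
    then show ?thesis using \<delta> by (simp add: power_divide field_simps)
  qed
  finally show ?thesis .
qed

text \<open>The chosen candidate is at least as cheap as every evaluated one, and from a candidate
  of cost at most \<open>214 * opt\<close> the rounding succeeds with certainty. So only the search
  can fail.\<close>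

lemma prob_search_and_round:
  "1 - \<delta> \<le> measure_pmf.prob (map_pmf fst (run d (search_and_round C k l \<rho> \<epsilon> S0 \<sigma> \<A> \<delta> B))) {S. good S}"
  unfolding search_and_round_def Let_def map_fst_run_bind
proof (rule prob_bind_pmf_ge)
  fix v assume "v \<in> set_pmf (map_pmf fst (run d (distance_vector C \<sigma> S0)))"
  then have "\<forall>i\<in>C. v i = set_dist d i S0"
    using ensures_distance_vector[OF cons fin S0_ne S0(1)] unfolding ensures_def by fastforce
  then have eq: "Top l {# v i. i \<in># mset_set C #} = cost l C d S0" by (rule Top_S0)
  let ?cand = "map_pmf fst (run d (map_mech (\<lambda>(i, j). attempt C k l \<sigma> (guess i)) runs))"
  let ?X = "{ys. \<forall>y\<in>set ys. y \<in> {y. \<forall>(S, c)\<in>set y. 214 * opt < c}}"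
  let ?out = "bind_pmf ?cand (\<lambda>ys. map_pmf fst (run d (round_on (best_candidate (S0, cost l C d S0) ys))))"
  have "measure_pmf.prob ?out (UNIV - {S. good S}) \<le> measure_pmf.prob ?cand ?X * 1"
  proof (rule prob_bind_pmf_le)
    fix ys assume "ys \<in> set_pmf ?cand"
    then have ys: "\<forall>y\<in>set ys. \<forall>(S, c)\<in>set y. admissible C k S \<and> c = cost l C d S"
      using ensures_candidates unfolding ensures_def by fastforce
    let ?P = "best_candidate (S0, cost l C d S0) ys"
    show "measure_pmf.prob (map_pmf fst (run d (round_on ?P))) (UNIV - {S. good S}) \<le> (if ys \<in> ?X then 1 else 0)"
    proof (cases "ys \<in> ?X")
      case False
      then obtain y S c where "y \<in> set ys" "(S, c) \<in> set y" "c \<le> 214 * opt" by force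
      then have "cost l C d ?P \<le> 214 * opt" using admissible_best(2)[OF ys, of y S c] by simp
      from good_round_on[OF admissible_best(1)[OF ys] this]
      have "set_pmf (map_pmf fst (run d (round_on ?P))) \<inter> (UNIV - {S. good S}) = {}"
        unfolding ensures_def by fastforce
      then have "measure_pmf.prob (map_pmf fst (run d (round_on ?P))) (UNIV - {S. good S}) = 0"
        by (simp only: measure_pmf_zero_iff)
      then show ?thesis using False by simp
    qed simp
  qed
  then have "measure_pmf.prob ?out (UNIV - {S. good S}) \<le> \<delta>" using prob_no_good_candidate by simp
  moreover have "measure_pmf.prob ?out (UNIV - {S. good S}) = 1 - measure_pmf.prob ?out {S. good S}"
    using measure_pmf.prob_compl[of "{S. good S}" ?out] by simp
  ultimately show "1 - \<delta> \<le> measure_pmf.prob (bind_pmf ?cand (\<lambda>ys. map_pmf fst (run d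
      (round_on (best_candidate (S0, Top l {# v i. i \<in># mset_set C #}) ys))))) {S. good S}"
    unfolding eq by simp
qed

end

text \<open>The summands are Boruvka, the evaluation of \<open>S0\<close>, two queries per attempt,
  and the binary searches. \<open>max 1\<close> absorbs the rounding of logarithms when
  \<open>\<delta>\<close> is close to 1 and \<open>k\<close> is small.\<close>

lemma query_budget:
  fixes \<rho> \<epsilon> \<delta> :: real and n k :: nat
  assumes "2 \<le> n" "1 \<le> k" "0 < \<delta>" "\<delta> < 1" "1 \<le> \<rho>" "0 < \<epsilon>" "\<epsilon> \<le> 1"
  defines "\<kappa> \<equiv> \<rho> * (1 + 3 * \<epsilon>) / \<epsilon>"
  shows "log 2 (real n) + real (1 + 2 * (Suc (nat \<lceil>log 2 ((real n)\<^sup>2)\<rceil>) * nat \<lceil>log 2 (1 / \<delta>)\<rceil>)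
      + Suc (ring_number \<rho> \<epsilon> n) * Suc (nat \<lfloor>log 2 (104 * real k)\<rfloor>))
    \<le> (18 + 9 * ((3 + log 2 \<kappa>) / log 2 (1 + \<epsilon>) + 2)) * max 1 (log 2 (1 / \<delta>) + log 2 (real k)) * log 2 (real n)"
proof -
  define L where "L = log 2 (real n)"
  define X where "X = max 1 (log 2 (1 / \<delta>) + log 2 (real k))"
  define D where "D = (3 + log 2 \<kappa>) / log 2 (1 + \<epsilon>) + 2"
  have L: "1 \<le> L" using assms(1) by (simp add: L_def le_log_iff)
  have ld: "0 \<le> log 2 (1 / \<delta>)" using assms(3,4) by simp
  have lk: "0 \<le> log 2 (real k)" using assms(2) by simp
  have X: "1 \<le> X" "log 2 (1 / \<delta>) \<le> X" "log 2 (real k) \<le> X" using ld lk unfolding X_def by auto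
  have \<kappa>: "1 \<le> \<kappa>"
  proof -
    have "1 * \<epsilon> \<le> \<rho> * (1 + 3 * \<epsilon>)" using assms(5-7) by (intro mult_mono) auto
    then show ?thesis using assms(6) by (simp add: \<kappa>_def le_divide_eq)
  qed
  have le: "0 < log 2 (1 + \<epsilon>)" using assms(6) by simp
  have a: "real (Suc (nat \<lceil>log 2 ((real n)\<^sup>2)\<rceil>)) \<le> 4 * L"
  proof -
    have "log 2 ((real n)\<^sup>2) = 2 * L" using assms(1) by (simp add: L_def log_nat_power)
    then show ?thesis using L by linarith
  qed
  have b: "real (nat \<lceil>log 2 (1 / \<delta>)\<rceil>) \<le> 2 * X" using X ld by linarith
  have c: "real (Suc (ring_number \<rho> \<epsilon> n)) \<le> D * L"
  proof -
    have "log (1 + \<epsilon>) (real n ^ 3 * \<rho> * (1 + 3 * \<epsilon>) / \<epsilon>) = log (1 + \<epsilon>) (real n ^ 3 * \<kappa>)"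
      by (simp add: \<kappa>_def mult.assoc)
    also have "\<dots> = log 2 (real n ^ 3 * \<kappa>) / log 2 (1 + \<epsilon>)"
      using assms(6) by (simp add: log_def)
    also have "log 2 (real n ^ 3 * \<kappa>) = 3 * L + log 2 \<kappa>"
      using assms(1) \<kappa> by (simp add: L_def log_mult log_nat_power)
    finally have eq: "log (1 + \<epsilon>) (real n ^ 3 * \<rho> * (1 + 3 * \<epsilon>) / \<epsilon>) = (3 * L + log 2 \<kappa>) / log 2 (1 + \<epsilon>)" .
    have "0 \<le> log 2 \<kappa>" using \<kappa> by simp
    then have "log 2 \<kappa> * 1 \<le> log 2 \<kappa> * L" using L by (intro mult_left_mono)
    then have "(3 * L + log 2 \<kappa>) / log 2 (1 + \<epsilon>) \<le> ((3 + log 2 \<kappa>) * L) / log 2 (1 + \<epsilon>)"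
      using le by (intro divide_right_mono) (auto simp: algebra_simps)
    moreover have "0 \<le> (3 * L + log 2 \<kappa>) / log 2 (1 + \<epsilon>)" using L \<open>0 \<le> log 2 \<kappa>\<close> le by simp
    ultimately have "real (Suc (ring_number \<rho> \<epsilon> n))
        \<le> ((3 + log 2 \<kappa>) * L) / log 2 (1 + \<epsilon>) + 2"
      unfolding ring_number_def eq by linarith
    also have "\<dots> \<le> ((3 + log 2 \<kappa>) * L) / log 2 (1 + \<epsilon>) + 2 * L" using L by simp
    also have "\<dots> = D * L" by (simp add: D_def algebra_simps)
    finally show ?thesis .
  qed
  \<comment> \<open>Seven for \<open>104 \<le> 2 ^ 7\<close>, one for \<open>log 2 k\<close>, one
    for the successor, each at most a multiple of \<open>X\<close>.\<close>
  have e: "real (Suc (nat \<lfloor>log 2 (104 * real k)\<rfloor>)) \<le> 9 * X"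
  proof -
    have "log 2 (104 * real k) = log 2 104 + log 2 (real k)" using assms(2) by (simp add: log_mult)
    moreover have "log 2 104 \<le> (7::real)" by (simp add: log_le_iff)
    moreover have "0 \<le> log 2 (104 * real k)" using assms(2) by simp
    ultimately show ?thesis using X by linarith
  qed
  have ab: "real (Suc (nat \<lceil>log 2 ((real n)\<^sup>2)\<rceil>)) * real (nat \<lceil>log 2 (1 / \<delta>)\<rceil>) \<le> (4 * L) * (2 * X)"
    using a b L by (intro mult_mono) auto
  have ce: "real (Suc (ring_number \<rho> \<epsilon> n)) * real (Suc (nat \<lfloor>log 2 (104 * real k)\<rfloor>))
      \<le> (D * L) * (9 * X)"
    using c e by (intro mult_mono) auto
  \<comment> \<open>\<open>L + 1\<close> costs \<open>2 * L * X\<close> and the attempts cost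
    \<open>16 * L * X\<close>, which makes up the 18.\<close>
  have "L * 1 \<le> L * X" using L X by (intro mult_left_mono) auto
  then have "L + 1 \<le> 2 * (L * X)" using L by linarith
  then have "L + (1 + 2 * ((4 * L) * (2 * X)) + (D * L) * (9 * X)) \<le> (18 + 9 * D) * X * L"
    by (simp add: algebra_simps)
  moreover have "L + real (1 + 2 * (Suc (nat \<lceil>log 2 ((real n)\<^sup>2)\<rceil>) * nat \<lceil>log 2 (1 / \<delta>)\<rceil>)
      + Suc (ring_number \<rho> \<epsilon> n) * Suc (nat \<lfloor>log 2 (104 * real k)\<rfloor>))
    \<le> L + (1 + 2 * ((4 * L) * (2 * X)) + (D * L) * (9 * X))"
    using ab ce by (simp only: of_nat_add of_nat_mult of_nat_1 of_nat_numeral)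
  ultimately show ?thesis unfolding L_def X_def D_def by linarith
qed

theorem theorem4p10:
  fixes \<rho> \<epsilon> :: real
  assumes "\<rho> \<ge> 1" and "0 < \<epsilon>" and "\<epsilon> \<le> 1"
  shows "\<exists>c_query c_dist :: real.
    \<forall>(C :: nat set) (k :: nat) (l :: nat) (d :: dist_fun) (\<sigma> :: profile) (\<A> :: centrum_alg)
      (\<delta> :: real) (\<tau> :: nat set \<Rightarrow> nat) (S0 :: nat set).
      finite C \<and> 1 \<le> k \<and> k \<le> card C \<and> 1 \<le> l \<and> l \<le> card C \<and>
      pmetric_on C d \<and> consistent_profile C \<sigma> d \<and> approx_alg k l \<rho> \<A> \<and>
      0 < \<delta> \<and> \<delta> < 1 \<and> inj_on \<tau> (all_edges C) \<and> S0 \<subseteq> C \<and> card S0 = k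
      \<longrightarrow>
      (\<forall>(F, Q) \<in> set_pmf (run d (meyerson_bb C k l \<rho> \<epsilon> \<tau> S0 \<sigma> \<A> \<delta>)). \<forall>i\<in>C.
         real (count Q i)
           \<le> c_query * max 1 (log 2 (1 / \<delta>) + log 2 (real k)) * log 2 (real (card C))) \<and>
      measure_pmf.prob (run d (meyerson_bb C k l \<rho> \<epsilon> \<tau> S0 \<sigma> \<A> \<delta>))
        {(F, Q). F \<noteq> {} \<and> F \<subseteq> C \<and> card F \<le> k \<and> cost l C d F \<le> c_dist * OPT k l C d}
        \<ge> 1 - \<delta>"
proof -
  define D where "D = (3 + log 2 (\<rho> * (1 + 3 * \<epsilon>) / \<epsilon>)) / log 2 (1 + \<epsilon>) + 2"
  define c where "c = 18 + 9 * D"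
  have "1 * \<epsilon> \<le> \<rho> * (1 + 3 * \<epsilon>)" using assms by (intro mult_mono) auto
  then have "1 \<le> \<rho> * (1 + 3 * \<epsilon>) / \<epsilon>" using assms(2) by (simp add: le_divide_eq)
  then have "0 \<le> D" using assms(2) unfolding D_def by simp
  then have c: "1 \<le> c" unfolding c_def by simp
  show ?thesis
  proof (rule exI[of _ c], rule exI[of _ "2000 * \<rho>"], intro allI impI)
    fix C S0 :: "nat set" and k l :: nat and d :: dist_fun and \<sigma> :: profile and \<A> :: centrum_alg
      and \<delta> :: real and \<tau> :: "nat set \<Rightarrow> nat"
    assume a: "finite C \<and> 1 \<le> k \<and> k \<le> card C \<and> 1 \<le> l \<and> l \<le> card C \<and>
      pmetric_on C d \<and> consistent_profile C \<sigma> d \<and> approx_alg k l \<rho> \<A> \<and>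
      0 < \<delta> \<and> \<delta> < 1 \<and> inj_on \<tau> (all_edges C) \<and> S0 \<subseteq> C \<and> card S0 = k"
    let ?M = "meyerson_bb C k l \<rho> \<epsilon> \<tau> S0 \<sigma> \<A> \<delta>"
    let ?X = "max 1 (log 2 (1 / \<delta>) + log 2 (real k))"
    let ?L = "log 2 (real (card C))"
    let ?good = "\<lambda>F. F \<noteq> {} \<and> F \<subseteq> C \<and> card F \<le> k \<and> cost l C d F \<le> 2000 * \<rho> * OPT k l C d"
    let ?rest = "\<lambda>r. if fst r = 0 then Return (Min ` components C (snd r))
       else search_and_round C k l \<rho> \<epsilon> S0 \<sigma> \<A> \<delta> (fst r)"
    have fin: "finite C" and k: "1 \<le> k" "k \<le> card C" and l: "1 \<le> l" "l \<le> card C"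
      and pm: "pmetric_on C d" using a by auto
    have ne: "C \<noteq> {}" using k by auto
    have L: "0 \<le> ?L" using k by simp
    have bor: "ensures d (boruvka C k \<sigma> \<tau>)
      (\<lambda>r Q. boruvka_result C k d (fst r) (snd r) \<and> (\<forall>i. real (count Q i) \<le> ?L))"
      using a by (intro ensures_boruvka) auto
    have inst: "centrum_instance C k l d \<sigma> \<A> \<delta> \<rho> \<epsilon> B F S0"
      if "boruvka_result C k d B F" "B \<noteq> 0" for B F
      using a assms that by unfold_locales auto
    have "ensures d ?M (\<lambda>F Q. \<forall>i. real (count Q i) \<le> c * ?X * ?L)"
      unfolding meyerson_bb_eq
    proof (rule ensures_bind[OF bor])
      fix r and Q :: "nat multiset"
      assume r: "boruvka_result C k d (fst r) (snd r) \<and> (\<forall>i. real (count Q i) \<le> ?L)"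
      show "ensures d (?rest r) (\<lambda>F Q'. \<forall>i. real (count (Q + Q') i) \<le> c * ?X * ?L)"
      proof (cases "fst r = 0")
        case True
        have "1 * 1 \<le> c * ?X" using c by (intro mult_mono) auto
        then have le: "1 * ?L \<le> c * ?X * ?L" using L by (intro mult_right_mono) auto
        have "real (count Q i) \<le> c * ?X * ?L" for i
        proof -
          have "real (count Q i) \<le> ?L" using r by blast
          then show ?thesis using le by simp
        qed
        then show ?thesis using True by (auto intro: ensures_Return)
      next
        case False
        interpret centrum_instance C k l d \<sigma> \<A> \<delta> \<rho> \<epsilon> "fst r" "snd r" S0
          using r False by (intro inst) simp_all
        \<comment> \<open>For a single agent the claimed bound is 0. Then there is no edge, so
          \<open>B\<close> is 0 and this branch is not reached.\<close>
        have n2: "2 \<le> card C"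
        proof (rule ccontr)
          assume "\<not> 2 \<le> card C"
          then have "card C = 1" using k by simp
          then obtain x where x: "C = {x}" using card_1_singletonE by blast
          have "priced_edges C d (snd r)" using r unfolding boruvka_result_def by simp
          then have "\<forall>e\<in>snd r. False" unfolding priced_edges_def x by simp
          then have "snd r = {}" by blast
          then show False using r False unfolding boruvka_result_def by simp
        qed
        have budget: "?L + real (1 + 2 * length runs + round_queries) \<le> c * ?X * ?L"
          using query_budget[OF n2 k(1) \<delta> \<rho> \<epsilon>] unfolding round_queries_def c_def D_def by simp
        show ?thesis
          using False
        proof (simp only: if_False, intro ensures_mono[OF count_search_and_round] allI)
          fix F and Q' :: "nat multiset" and i
          assume "\<forall>i. count Q' i \<le> 1 + 2 * length runs + round_queries"
          then have "real (count Q' i) \<le> real (1 + 2 * length runs + round_queries)"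
            using of_nat_mono by blast
          moreover have "real (count Q i) \<le> ?L" using r by blast
          ultimately show "real (count (Q + Q') i) \<le> c * ?X * ?L"
            using budget by (simp only: count_union of_nat_add)
        qed
      qed
    qed
    then have queries: "\<forall>(F, Q) \<in> set_pmf (run d ?M). \<forall>i\<in>C. real (count Q i) \<le> c * ?X * ?L"
      unfolding ensures_def by fast
    have "1 - \<delta> \<le> measure_pmf.prob (map_pmf fst (run d ?M)) {F. ?good F}"
      unfolding meyerson_bb_eq map_fst_run_bind
    proof (rule prob_bind_pmf_ge)
      fix r assume "r \<in> set_pmf (map_pmf fst (run d (boruvka C k \<sigma> \<tau>)))"
      then have r: "boruvka_result C k d (fst r) (snd r)" using bor unfolding ensures_def by fastforce
      show "1 - \<delta> \<le> measure_pmf.prob (map_pmf fst (run d (?rest r))) {F. ?good F}"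
      proof (cases "fst r = 0")
        case True
        have opt: "0 \<le> 2000 * \<rho> * OPT k l C d"
          using boruvka_estimate(3)[OF fin pm r k l] assms by simp
        have "boruvka_result C k d 0 (snd r)" using r True by simp
        note co = colocated_components[OF fin pm this ne]
        have "?good (Min ` components C (snd r))" using co(1-3) co(4)[of l] opt by simp
        then show ?thesis using True a by simp
      next
        case False
        interpret centrum_instance C k l d \<sigma> \<A> \<delta> \<rho> \<epsilon> "fst r" "snd r" S0
          using r False by (intro inst) simp_all
        show ?thesis using False prob_search_and_round unfolding good_def by simp
      qed
    qed
    moreover have "fst -` {F. ?good F} = {(F, Q :: nat multiset). ?good F}" by auto
    ultimately have "1 - \<delta> \<le> measure_pmf.prob (run d ?M) {(F, Q). ?good F}"
      by (simp only: measure_map_pmf)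
    then show "(\<forall>(F, Q) \<in> set_pmf (run d ?M). \<forall>i\<in>C. real (count Q i) \<le> c * ?X * ?L) \<and>
      measure_pmf.prob (run d ?M) {(F, Q). ?good F} \<ge> 1 - \<delta>"
      using queries by simp
  qed
qed

end
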